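(* Let $\{a(i,j): i\in\mathbb N\}$, $j\in\mathbb N$, be independent and identically distributed families of real-valued random variables, each family $\{a(i,j):i\in\mathbb N\}$ being a stationary sequence. For $n\in\mathbb N$ let $m=m(n)\in\mathbb N$ with $m/n\to y\in(0,\infty)$ as $n\to\infty$, let $\mathbf X_n=(a(i,j))_{1\le i\le m,\,1\le j\le n}$, and let $\mathbf W_n=\frac1n\mathbf X_n\mathbf X_n^T$. Put $t(i,i')=\mathrm{Cov}(a(i,j),a(i',j))$ (independent of $j$), $\mathbf T_m=(t(i,i'))_{1\le i,i'\le m}$, and assume that for every $k\in\mathbb N$ the limit $$H_k:=\lim_{m\to\infty}\frac1m\operatorname{tr}(\mathbf T_m^k)$$ exists. Assume further that there is $\alpha\in[0,1)$, with $t'(i,i'):=\alpha^{|i-i'|}$, such that for every $k\in\mathbb N$ there is a constant $c(k)\ge0$ (independent of $m$) such that for all $i_1\le i_2\le\dots\le i_{2k}$ in $\mathbb N$: (A1) $\mathbb E[a(i_1,1)\cdots a(i_{2k},1)]=\prod_{l=1}^k t(i_{2l-1},i_{2l})+R(i_1,\dots,i_{2k})$ with $$|R(i_1,\dots,i_{2k})|\le c(k)\sum_{j=1}^k\sum_{\sigma\in S^j_{2k}}\prod_{l=1}^j t'(i_{\sigma(2l-1)},i_{\sigma(2l)});$$ (A2) $\left|\mathbb E[a(i_1,1)\cdots a(i_{2k},1)]\right|\le c(k)\prod_{l=1}^k t'(i_{2l-1},i_{2l})$. Then the expected empirical spectral distribution $\bar\mu_n=\mathbb E\big[\frac1m\sum_{j=1}^m\delta_{\lambda_j}\big]$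 of $\mathbf W_n$ (with $\lambda_1,\dots,\lambda_m$ the eigenvalues of $\mathbf W_n$ counted with multiplicity) converges weakly to a probability measure whose $k$-th moment equals, for every $k\in\mathbb N$, $$\sum_{s=1}^k y^{k-s}\,\frac{k!}{s!}\sum_{\substack{i_1+\dots+i_s=k-s+1\\ i_1+2i_2+\dots+si_s=k}}\ \prod_{l=1}^s\frac{H_l^{i_l}}{i_l!},$$ where the inner sum runs over tuples $(i_1,\dots,i_s)$ of nonnegative integers.
   Context: For $k\in\mathbb N$ and $j\in\{1,\dots,k\}$, $S^j_{2k}$ denotes the set of all permutations $\sigma$ of $\{1,\dots,2k\}$ such that for at least one $l\in\{1,\dots,j\}$ one has $\{\sigma(2l-1),\sigma(2l)\}\neq\{2l'-1,2l'\}$ for every $l'\in\{1,\dots,k\}$. *)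

theory Defs
  imports "HOL-Probability.Probability" "Jordan_Normal_Form.Char_Poly"
begin

definition mat_trace :: "real mat \<Rightarrow> real" where
  "mat_trace A = (\<Sum>i<dim_row A. A $$ (i, i))"

definition cov :: "'a measure \<Rightarrow> ('a \<Rightarrow> real) \<Rightarrow> ('a \<Rightarrow> real) \<Rightarrow> real" where
  "cov M X Y = (\<integral>\<omega>. (X \<omega> - (\<integral>\<eta>. X \<eta> \<partial>M)) * (Y \<omega> - (\<integral>\<eta>. Y \<eta> \<partial>M)) \<partial>M)"

definition S_perm :: "nat \<Rightarrow> nat \<Rightarrow> (nat \<Rightarrow> nat) set" where
  "S_perm j k = {\<sigma>. \<sigma> permutes {1..2*k} \<and>
     (\<exists>l\<in>{1..j}. \<forall>l'\<in>{1..k}. {\<sigma> (2*l - 1), \<sigma> (2*l)} \<noteq> {2*l' - 1, 2*l'})}"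

definition esd :: "real mat \<Rightarrow> real measure" where
  "esd A = distr (measure_pmf (pmf_of_multiset (proots (char_poly A)))) borel (\<lambda>x. x)"

definition data_mat :: "(nat \<Rightarrow> nat \<Rightarrow> 'a \<Rightarrow> real) \<Rightarrow> nat \<Rightarrow> nat \<Rightarrow> 'a \<Rightarrow> real mat" where
  "data_mat a m n \<omega> = mat m n (\<lambda>(i, j). a i j \<omega>)"

definition W_mat :: "(nat \<Rightarrow> nat \<Rightarrow> 'a \<Rightarrow> real) \<Rightarrow> nat \<Rightarrow> nat \<Rightarrow> 'a \<Rightarrow> real mat" where
  "W_mat a m n \<omega> = (1 / real n) \<cdot>\<^sub>m (data_mat a m n \<omega> * transpose_mat (data_mat a m n \<omega>))"

definition moment_formula :: "real \<Rightarrow> (nat \<Rightarrow> real) \<Rightarrow> nat \<Rightarrow> real" where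
  "moment_formula y H k = (\<Sum>s=1..k. y ^ (k - s) * (fact k / fact s) *
     (\<Sum>f\<in>{f. f \<in> {1..s} \<rightarrow>\<^sub>E {0..k} \<and> (\<Sum>l=1..s. f l) = k - s + 1 \<and> (\<Sum>l=1..s. l * f l) = k}.
        \<Prod>l=1..s. H l ^ f l / fact (f l)))"

end

(* Write W, T for the operators of W_n, T_m and x_j for the columns of X_n. Expanding one factor W gives
   tr(W^(k+1) T^p) / n as the average over j of x_j^T W^k T^p x_j / n. In W^k T^p x_j the column x_j can be
   split off: with A = W - x_j x_j^T / n,
     x_j^T W^k f / n = x_j^T A^k f / n + sum_(q<k) (x_j^T A^q f / n) (x_j^T W^(k-1-q) x_j / n),
   and A is independent of x_j. By (A1) and (A2) for k = 1, 2 the quadratic form x_j^T A^q T^p x_j / n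
   concentrates in L^2 at tr(A^q T^(p+1)) / n, uniformly in j, while (A2) for all k bounds all its moments.
   Hence tr(W^k T^p) / n converges in L^2 to limits tau(k,p) satisfying
     tau(k+1,p) = sum_(q<=k) tau(q,p+1) M(k-q),  M(0) = 1,  M(k) = tau(k,0) for k > 0,
   with tau(0,p) = y H_p. The generating function of M therefore solves
     M(z) = 1 + y sum_(p>=1) H_p z^p M(z)^p,
   and Lagrange inversion together with the multinomial theorem yields the stated moments M(k) / y. They grow
   at most geometrically, so the method of moments applies. *)

theory Submission
  imports Defs "HOL-Combinatorics.Combinatorics" "Jordan_Normal_Form.Schur_Decomposition"
begin

section \<open>Lagrange inversion of the moment recursion\<close>

text \<open>The index p cannot be avoided: averaging a quadratic form over its column replaces x_j
  x_j^T by T_m, so a recursion for tr(W^k) alone does not close. Splitting off a column also changes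
  the matrix. Statements are therefore made for Gram operators over arbitrary column sets J, with
  the factor 1/n kept, and J may miss any fixed number of columns. The recursion multiplies random
  quantities, and L^2 convergence does not survive products; all even moments are bounded uniformly
  to repair this. These bounds rest on the positivity of A^q: diagonal entries control the
  off-diagonal ones, and sums over index tuples collapse to powers of tr(A^q). Concentration needs
  the covariances of products of two entries for every order of the four indices. (A1) is strong
  when the middle gap of the sorted indices is long, (A2) when the outer gaps are long; taking the
  better of the two costs a root, whence the decay rate \<alpha>^(1/4).\<close>

lemma lagrange_recursion:
  fixes A :: "nat \<Rightarrow> nat \<Rightarrow> real" and w :: "nat \<Rightarrow> real"
  assumes A0: "\<And>k. A k 0 = (if k = 0 then 1 else 0)"
    and AS: "\<And>k r. A k (Suc r) = (\<Sum>l\<le>k. w l * A (k - l) (r + l))"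
  shows "real (k + r) * A k r = real r * fps_nth (Abs_fps w ^ (k + r)) k"
proof (induction k arbitrary: r rule: less_induct)
  case (less k)
  note IHk = less
  show ?case
  proof (induction r)
    case 0
    then show ?case by (simp add: A0)
  next
    case (Suc r)
    let ?\<phi> = "Abs_fps w"
    \<comment> \<open>Read \<open>A k r\<close> as the coefficient of z^k in F^r, where F = \<phi>(z
      F); the recursion is F^(r+1) = F^r \<phi>(z F). The two indices keep their sum along its
      right-hand side, so all terms there are governed by the same power
      \<open>?\<phi> ^ N\<close>.\<close>
    define N where "N = k + r"
    show ?case
    proof (cases "N = 0")
      case True
      then show ?thesis by (simp add: AS A0 N_def)
    next
      case False
      have IH: "real N * A (k - l) (r + l) = real (r + l) * fps_nth (?\<phi> ^ N) (k - l)" if "l \<le> k" for l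
      \<comment> \<open>The term l = 0 keeps k and needs the inner induction on r; all other terms
        lower k.\<close>
      proof (cases "l = 0")
        case True
        then show ?thesis using Suc by (simp add: N_def)
      next
        case False
        then have "k - l < k" using that by auto
        from IHk[OF this, of "r + l"] that show ?thesis by (simp add: N_def)
      qed
      have "real N * A k (Suc r) = (\<Sum>l\<le>k. w l * (real N * A (k - l) (r + l)))"
        by (simp add: AS sum_distrib_left mult_ac)
      also have "\<dots> = (\<Sum>l\<le>k. w l * (real (r + l) * fps_nth (?\<phi> ^ N) (k - l)))"
        by (intro sum.cong refl) (simp add: IH)
      also have "\<dots> = real r * (\<Sum>l\<le>k. w l * fps_nth (?\<phi> ^ N) (k - l))
           + (\<Sum>l\<le>k. real l * w l * fps_nth (?\<phi> ^ N) (k - l))"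
        by (simp only: of_nat_add distrib_right distrib_left sum.distrib sum_distrib_left mult_ac)
      also have "(\<Sum>l\<le>k. w l * fps_nth (?\<phi> ^ N) (k - l)) = fps_nth (?\<phi> ^ Suc N) k"
        by (simp add: fps_mult_nth atLeast0AtMost)
      also have "(\<Sum>l\<le>k. real l * w l * fps_nth (?\<phi> ^ N) (k - l)) = fps_nth (fps_X * fps_deriv ?\<phi> * ?\<phi> ^ N) k"
      proof -
        have "fps_nth (fps_X * fps_deriv ?\<phi>) l = real l * w l" for l
          by (cases l) auto
        then show ?thesis by (simp add: fps_mult_nth[of "fps_X * fps_deriv ?\<phi>"] atLeast0AtMost del: fps_X_mult_nth)
      qed
      finally have 1: "real N * A k (Suc r) = real r * fps_nth (?\<phi> ^ Suc N) k + fps_nth (fps_X * fps_deriv ?\<phi> * ?\<phi> ^ N) k" .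
      \<comment> \<open>The operator z d/dz applied to \<open>?\<phi> ^ Suc N\<close> and read off
        at degree k; this eliminates the coefficient that contains the derivative.\<close>
      have "real k * fps_nth (?\<phi> ^ Suc N) k = fps_nth (fps_X * fps_deriv (?\<phi> ^ Suc N)) k"
        unfolding fps_X_mult_nth fps_deriv_nth by (cases k) simp_all
      also have "\<dots> = real (Suc N) * fps_nth (fps_X * fps_deriv ?\<phi> * ?\<phi> ^ N) k"
        unfolding fps_deriv_power diff_Suc_1
        by (subst fps_mult_left_const_nth[symmetric]) (simp only: mult_ac)
      finally have 2: "real k * fps_nth (?\<phi> ^ Suc N) k = real (Suc N) * fps_nth (fps_X * fps_deriv ?\<phi> * ?\<phi> ^ N) k" .
      have "real N * (real (Suc N) * A k (Suc r)) = real (Suc N) * (real r * fps_nth (?\<phi> ^ Suc N) k) + real k * fps_nth (?\<phi> ^ Suc N) k"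
        unfolding 2 by (metis 1 distrib_left mult.left_commute)
      also have "\<dots> = real N * (real (Suc r) * fps_nth (?\<phi> ^ Suc N) k)"
        by (simp add: N_def algebra_simps)
      finally have "real (Suc N) * A k (Suc r) = real (Suc r) * fps_nth (?\<phi> ^ Suc N) k"
        using False by (simp only: mult_cancel_left of_nat_eq_0_iff) simp
      then show ?thesis by (simp only: N_def add_Suc_right)
    qed
  qed
qed

text \<open>The generating functions in the first index satisfy W p = \<tau> 0 p + z W (p+1) F.
  Unrolling this gives F = sum_(l <= P) w l (z F)^l up to a multiple of z^(P+1). For the coefficient
  of degree k the choice P = k is enough, so no infinite sum or composition of power series
  occurs.\<close>

lemma loop_recursion_lagrange:
  fixes \<tau> :: "nat \<Rightarrow> nat \<Rightarrow> real" and M w :: "nat \<Rightarrow> real"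
  assumes M: "\<And>j. M j = (if j = 0 then 1 else \<tau> j 0)"
    and w: "\<And>l. w l = (if l = 0 then 1 else \<tau> 0 l)"
    and \<tau>: "\<And>k p. \<tau> (Suc k) p = (\<Sum>q\<le>k. \<tau> q (Suc p) * M (k - q))"
  shows "real (Suc k) * M k = fps_nth (Abs_fps w ^ Suc k) k"
proof -
  define W where "W = (\<lambda>p. Abs_fps (\<lambda>k. \<tau> k p))"
  define F where "F = Abs_fps M"
  have W: "W p = fps_const (\<tau> 0 p) + fps_X * (W (Suc p) * F)" for p
  proof (rule fps_ext)
    fix n show "fps_nth (W p) n = fps_nth (fps_const (\<tau> 0 p) + fps_X * (W (Suc p) * F)) n"
      unfolding fps_add_nth fps_X_mult_nth
      by (cases n) (simp_all add: W_def F_def \<tau> fps_mult_nth atLeast0AtMost)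
  qed
  \<comment> \<open>\<open>F\<close> and \<open>W 0\<close> differ only in the constant coefficient,
    which is 1 instead of \<open>\<tau> 0 0\<close>.\<close>
  have F: "F = 1 + fps_X * (W 1 * F)"
  proof (rule fps_ext)
    fix n show "fps_nth F n = fps_nth (1 + fps_X * (W 1 * F)) n"
      unfolding fps_add_nth fps_X_mult_nth
      by (cases n) (simp_all add: W_def F_def \<tau> M fps_mult_nth atLeast0AtMost)
  qed
  have FP: "F = (\<Sum>l\<le>P. fps_const (w l) * (fps_X ^ l * F ^ l)) + fps_X ^ Suc P * (W (Suc P) * F ^ Suc P)" for P
  proof (induction P)
    case 0
    then show ?case using F by (simp add: w)
  next
    case (Suc P)
    have "fps_X ^ Suc P * (W (Suc P) * F ^ Suc P) = 
       fps_const (w (Suc P)) * (fps_X ^ Suc P * F ^ Suc P) + fps_X ^ Suc (Suc P) * (W (Suc (Suc P)) * F ^ Suc (Suc P))"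
      by (subst W) (simp add: w algebra_simps)
    with Suc show ?case by (simp only: sum.atMost_Suc add.assoc)
  qed
  define A where "A = (\<lambda>k r. fps_nth (F ^ r) k)"
  have "real (k + 1) * A k 1 = real 1 * fps_nth (Abs_fps w ^ (k + 1)) k"
  proof (rule lagrange_recursion)
    show "A k 0 = (if k = 0 then 1 else 0)" for k by (simp add: A_def)
    show "A k (Suc r) = (\<Sum>l\<le>k. w l * A (k - l) (r + l))" for k r
    proof -
      have "F ^ Suc r = F ^ r * F" by simp
      also have "\<dots> = F ^ r * ((\<Sum>l\<le>k. fps_const (w l) * (fps_X ^ l * F ^ l)) + fps_X ^ Suc k * (W (Suc k) * F ^ Suc k))"
        using FP[of k] by simp
      also have "\<dots> = (\<Sum>l\<le>k. fps_const (w l) * (fps_X ^ l * F ^ (r + l))) + fps_X ^ Suc k * (W (Suc k) * F ^ Suc k * F ^ r)"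
        by (simp add: algebra_simps sum_distrib_left power_add)
      finally have "fps_nth (F ^ Suc r) k = fps_nth \<dots> k" by simp
      also have "\<dots> = (\<Sum>l\<le>k. fps_nth (fps_const (w l) * (fps_X ^ l * F ^ (r + l))) k)"
        unfolding fps_add_nth fps_sum_nth fps_X_power_mult_nth by simp
      also have "\<dots> = (\<Sum>l\<le>k. w l * fps_nth (F ^ (r + l)) (k - l))"
        by (intro sum.cong refl) (simp add: fps_X_power_mult_nth)
      finally show ?thesis by (simp add: A_def)
    qed
  qed
  then show ?thesis by (simp add: A_def F_def)
qed

section \<open>Multinomial expansion of powers of a series\<close>

definition exponents :: "nat \<Rightarrow> nat \<Rightarrow> (nat \<Rightarrow> nat) set" where
  "exponents L N = {f \<in> {1..L} \<rightarrow>\<^sub>E UNIV. (\<Sum>l=1..L. f l) \<le> N}"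

lemma finite_exponents: "finite (exponents L N)"
proof (rule finite_subset)
  show "exponents L N \<subseteq> {1..L} \<rightarrow>\<^sub>E {0..N}"
  proof
    fix f assume f: "f \<in> exponents L N"
    have "f l \<le> N" if "l \<in> {1..L}" for l
      using member_le_sum[OF that, of f] f by (simp add: exponents_def)
    then show "f \<in> {1..L} \<rightarrow>\<^sub>E {0..N}"
      using f by (auto simp: exponents_def PiE_iff)
  qed
qed (simp add: finite_PiE)

text \<open>The exponents of the L positive powers need not add up to N: what is missing is the
  exponent of the summand 1, which is why \<open>exponents\<close> bounds the sum instead of fixing
  it. Induction on L splits off the highest power by the binomial theorem.\<close>

lemma fps_multinomial:
  fixes w :: "nat \<Rightarrow> real"
  shows "(1 + (\<Sum>l=1..L. fps_const (w l) * fps_X ^ l)) ^ N =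
    (\<Sum>f\<in>exponents L N. fps_const (fact N / fact (N - (\<Sum>l=1..L. f l)) * (\<Prod>l=1..L. w l ^ f l / fact (f l)))
        * fps_X ^ (\<Sum>l=1..L. l * f l))"
proof (induction L arbitrary: N)
  case 0
  have "exponents 0 N = {\<lambda>_. undefined}" by (auto simp: exponents_def)
  then show ?case by simp
next
  case (Suc L)
  define c where "c = (\<lambda>L N f. fact N / fact (N - (\<Sum>l=1..L. f l)) * (\<Prod>l=1..L. w l ^ f l / fact (f l)))"
  let ?X = "fps_X :: real fps"
  define e where "e = (\<lambda>L f. (\<Sum>l=1..L. l * f l) :: nat)"
  let ?P = "1 + (\<Sum>l=1..L. fps_const (w l) * ?X ^ l)"
  have bij: "bij_betw (\<lambda>(j, f). f(Suc L := j)) (SIGMA j:{..N}. exponents L (N - j)) (exponents (Suc L) N)"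
  proof (rule bij_betwI[where g = "\<lambda>f. (f (Suc L), f(Suc L := undefined))"])
    have 1: "(\<Sum>l = 1..L. (f(Suc L := j)) l) = sum f {1..L}" for f and j :: nat
      by (rule sum.cong) auto
    show "(\<lambda>(j, f). f(Suc L := j)) \<in> (SIGMA j:{..N}. exponents L (N - j)) \<rightarrow> exponents (Suc L) N"
    proof
      fix z assume "z \<in> (SIGMA j:{..N}. exponents L (N - j))"
      then obtain j f where z: "z = (j, f)" and j: "j \<le> N" and f: "f \<in> exponents L (N - j)" by auto
      have "(\<Sum>l = 1..Suc L. (f(Suc L := j)) l) \<le> N"
        using 1[of f j] j f by (auto simp: exponents_def)
      moreover have "f(Suc L := j) \<in> {1..Suc L} \<rightarrow>\<^sub>E UNIV"
        using f by (auto simp: exponents_def PiE_iff extensional_def)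
      ultimately show "(case z of (j, f) \<Rightarrow> f(Suc L := j)) \<in> exponents (Suc L) N"
        by (simp add: z exponents_def)
    qed
    show "(\<lambda>f. (f (Suc L), f(Suc L := undefined))) \<in> exponents (Suc L) N \<rightarrow> (SIGMA j:{..N}. exponents L (N - j))"
    proof
      fix f assume f: "f \<in> exponents (Suc L) N"
      then have "sum f {1..L} + f (Suc L) \<le> N" by (simp add: exponents_def)
      moreover have "f(Suc L := undefined) \<in> {1..L} \<rightarrow>\<^sub>E UNIV"
        using f by (auto simp: exponents_def PiE_iff extensional_def)
      ultimately show "(f (Suc L), f(Suc L := undefined)) \<in> (SIGMA j:{..N}. exponents L (N - j))"
        using 1[of f undefined] by (auto simp: exponents_def)
    qed
  qed (auto simp: exponents_def PiE_iff extensional_def)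
  have "(1 + (\<Sum>l=1..Suc L. fps_const (w l) * ?X ^ l)) ^ N = (fps_const (w (Suc L)) * ?X ^ Suc L + ?P) ^ N"
    by (simp add: algebra_simps)
  also have "\<dots> = (\<Sum>j\<le>N. of_nat (N choose j) * (fps_const (w (Suc L)) * ?X ^ Suc L) ^ j * ?P ^ (N - j))"
    by (rule binomial_ring)
  also have "\<dots> = (\<Sum>j\<le>N. \<Sum>f\<in>exponents L (N - j). of_nat (N choose j) * (fps_const (w (Suc L)) * ?X ^ Suc L) ^ j * 
      (fps_const (c L (N - j) f) * ?X ^ e L f))"
    unfolding Suc.IH by (simp only: sum_distrib_left c_def e_def)
  also have "\<dots> = (\<Sum>(j, f)\<in>(SIGMA j:{..N}. exponents L (N - j)). of_nat (N choose j) * (fps_const (w (Suc L)) * ?X ^ Suc L) ^ j * 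
      (fps_const (c L (N - j) f) * ?X ^ e L f))"
    by (rule sum.Sigma) (auto simp: finite_exponents)
  also have "\<dots> = (\<Sum>(j, f)\<in>(SIGMA j:{..N}. exponents L (N - j)). fps_const (c (Suc L) N (f(Suc L := j))) * ?X ^ e (Suc L) (f(Suc L := j)))"
  proof (rule sum.cong, goal_cases)
    case (2 z)
    then obtain j f where z: "z = (j, f)" and j: "j \<le> N" and f: "f \<in> exponents L (N - j)" by auto
    have s: "(\<Sum>l=1..L. (f(Suc L := j)) l) = (\<Sum>l=1..L. f l)"
      "(\<Sum>l=1..L. l * (f(Suc L := j)) l) = (\<Sum>l=1..L. l * f l)"
      "(\<Prod>l=1..L. w l ^ (f(Suc L := j)) l / fact ((f(Suc L := j)) l)) = (\<Prod>l=1..L. w l ^ f l / fact (f l))"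
      by (auto intro!: sum.cong prod.cong)
    have "c (Suc L) N (f(Suc L := j)) = (real (N choose j) * w (Suc L) ^ j) * c L (N - j) f"
      unfolding c_def using j s by (simp add: binomial_fact field_simps)
    moreover have "e (Suc L) (f(Suc L := j)) = Suc L * j + e L f"
      unfolding e_def using s by simp
    moreover have "(fps_const (w (Suc L)) * ?X ^ Suc L) ^ j = fps_const (w (Suc L) ^ j) * ?X ^ (Suc L * j)"
      by (simp only: power_mult_distrib power_mult[symmetric] fps_const_power)
    moreover have "of_nat (N choose j) = fps_const (real (N choose j))"
      by (simp add: fps_of_nat)
    ultimately show ?case
      by (simp only: z prod.case power_add fps_const_mult[symmetric] mult_ac)
  qed auto
  also have "\<dots> = (\<Sum>f\<in>exponents (Suc L) N. fps_const (c (Suc L) N f) * ?X ^ e (Suc L) f)"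
    by (subst sum.reindex_bij_betw[OF bij, symmetric]) (simp add: case_prod_unfold)
  finally show ?case by (simp only: c_def e_def)
qed

text \<open>The coefficient of degree k sees only coefficients of degree at most k, so the series
  may be cut to a polynomial before it is expanded.\<close>

lemma fps_nth_power_multinomial:
  fixes w :: "nat \<Rightarrow> real"
  assumes "w 0 = 1"
  shows "fps_nth (Abs_fps w ^ N) k = (\<Sum>f | f \<in> exponents k N \<and> (\<Sum>l=1..k. l * f l) = k.
    fact N / fact (N - (\<Sum>l=1..k. f l)) * (\<Prod>l=1..k. w l ^ f l / fact (f l)))"
proof -
  let ?P = "1 + (\<Sum>l=1..k. fps_const (w l) * fps_X ^ l)"
  have *: "fps_nth ?P i = w i" if "i \<le> k" for i
    using that assms by (cases "i = 0") (auto simp: fps_sum_nth fps_X_power_nth if_distrib[of "\<lambda>x. _ * x"] cong: if_cong)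
  have "fps_nth (Abs_fps w ^ N) i = fps_nth (?P ^ N) i" if "i \<le> k" for i
    using that
  proof (induction N arbitrary: i)
    case (Suc N)
    have "fps_nth (Abs_fps w ^ Suc N) i = (\<Sum>j=0..i. w j * fps_nth (Abs_fps w ^ N) (i - j))"
      by (simp add: fps_mult_nth)
    also have "\<dots> = (\<Sum>j=0..i. fps_nth ?P j * fps_nth (?P ^ N) (i - j))"
    proof (rule sum.cong[OF refl])
      fix j assume "j \<in> {0..i}"
      then have "j \<le> k" "i - j \<le> k" using Suc.prems by auto
      then show "w j * fps_nth (Abs_fps w ^ N) (i - j) = fps_nth ?P j * fps_nth (?P ^ N) (i - j)"
        using *[of j] Suc.IH[of "i - j"] by (simp only: mult_cancel_left refl simp_thms)
    qed
    also have "\<dots> = fps_nth (?P ^ Suc N) i" by (simp only: power_Suc fps_mult_nth)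
    finally show ?case .
  qed simp
  from this[of k] have "fps_nth (Abs_fps w ^ N) k = fps_nth (?P ^ N) k" by simp
  also have "\<dots> = (\<Sum>f\<in>exponents k N. if (\<Sum>l=1..k. l * f l) = k then
     fact N / fact (N - (\<Sum>l=1..k. f l)) * (\<Prod>l=1..k. w l ^ f l / fact (f l)) else 0)"
    unfolding fps_multinomial by (auto simp: fps_sum_nth fps_X_power_nth intro!: sum.cong)
  also have "\<dots> = (\<Sum>f\<in>{f\<in>exponents k N. (\<Sum>l=1..k. l * f l) = k}.
    fact N / fact (N - (\<Sum>l=1..k. f l)) * (\<Prod>l=1..k. w l ^ f l / fact (f l)))"
    by (rule sum.inter_filter[symmetric]) (rule finite_exponents)
  finally show ?thesis by simp
qed

text \<open>Let b = f 1 + ... + f k and s = k + 1 - b. Then (k+1)!/(k+1-b)! equals (k+1) k!/s!, and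
  y^b equals y y^(k-s), which is the outer shape of \<open>moment_formula\<close>. The remaining
  point is that its inner tuples have length s and not k.\<close>

lemma moment_formula_lagrange:
  fixes H :: "nat \<Rightarrow> real"
  assumes k: "k \<ge> 1" and y: "y > 0"
    and w: "\<And>l. w l = (if l = 0 then 1 else y * H l)"
  shows "fps_nth (Abs_fps w ^ Suc k) k = real (Suc k) * (y * moment_formula y H k)"
proof -
  define B where "B = {f. f \<in> exponents k (Suc k) \<and> (\<Sum>l=1..k. l * f l) = k}"
  define b where "b = (\<lambda>f :: nat \<Rightarrow> nat. \<Sum>l=1..k. f l)"
  define G where "G = (\<lambda>s. {f. f \<in> {1..s} \<rightarrow>\<^sub>E {0..k} \<and> (\<Sum>l=1..s. f l) = k - s + 1 \<and> (\<Sum>l=1..s. l * f l) = k})"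
  \<comment> \<open>Padding by zeros from s up to k; outside, \<open>undefined\<close> keeps the
    function extensional.\<close>
  define ext where "ext = (\<lambda>s (f :: nat \<Rightarrow> nat) l. if l \<in> {1..s} then f l else if l \<in> {1..k} then 0 else undefined)"
  have finB: "finite B" unfolding B_def using finite_exponents[of k "Suc k"] by auto
  have b1: "1 \<le> b f" "b f \<le> k" if "f \<in> B" for f
  proof -
    have "b f \<noteq> 0"
    proof
      assume "b f = 0"
      then have "f l = 0" if "l \<in> {1..k}" for l using that by (auto simp: b_def)
      then have "(\<Sum>l=1..k. l * f l) = 0" by simp
      with \<open>f \<in> B\<close> k show False by (simp add: B_def)
    qed
    then show "1 \<le> b f" by simp
    have "b f \<le> (\<Sum>l=1..k. l * f l)" unfolding b_def by (intro sum_mono) auto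
    then show "b f \<le> k" using that by (simp add: B_def)
  qed
  have sum_restr: "sum h {1..k} = sum h {1..s}" if "s \<le> k" "\<And>l. l \<in> {s<..k} \<Longrightarrow> h l = 0" for h :: "nat \<Rightarrow> nat" and s
    by (rule sum.mono_neutral_right) (use that in auto)
  have prod_restr: "prod h {1..k} = prod h {1..s}" if "s \<le> k" "\<And>l. l \<in> {s<..k} \<Longrightarrow> h l = 1" for h :: "nat \<Rightarrow> real" and s
    by (rule prod.mono_neutral_right) (use that in auto)
  have bij: "bij_betw (ext s) (G s) {f\<in>B. b f = k - s + 1}" if s: "s \<in> {1..k}" for s
  proof (rule bij_betwI[where g = "\<lambda>f. restrict f {1..s}"])
    have sk: "s \<le> k" using s by simp
    show "ext s \<in> G s \<rightarrow> {f\<in>B. b f = k - s + 1}"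
    proof
      fix f assume f: "f \<in> G s"
      have "sum (ext s f) {1..k} = sum (ext s f) {1..s}"
        by (rule sum_restr) (use s in \<open>auto simp: ext_def\<close>)
      also have "\<dots> = sum f {1..s}" by (rule sum.cong) (auto simp: ext_def)
      also have "\<dots> = k - s + 1" using f by (simp add: G_def)
      finally have 1: "sum (ext s f) {1..k} = k - s + 1" .
      have "(\<Sum>l=1..k. l * ext s f l) = (\<Sum>l=1..s. l * ext s f l)"
        by (rule sum_restr) (use s in \<open>auto simp: ext_def\<close>)
      also have "\<dots> = (\<Sum>l=1..s. l * f l)" by (rule sum.cong) (auto simp: ext_def)
      also have "\<dots> = k" using f by (simp add: G_def)
      finally have 2: "(\<Sum>l=1..k. l * ext s f l) = k" .
      have 3: "ext s f \<in> {1..k} \<rightarrow>\<^sub>E UNIV" using s by (auto simp: ext_def PiE_iff extensional_def)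
      show "ext s f \<in> {f\<in>B. b f = k - s + 1}"
        unfolding B_def b_def exponents_def using 1 2 3 s by (simp del: One_nat_def)
    qed
    \<comment> \<open>Subtracting the two constraints gives sum (l - 1) f l = s - 1, so a positive f
      l forces l <= s.\<close>
    have vanish: "f l = 0" if f: "f \<in> {f\<in>B. b f = k - s + 1}" and l: "l \<in> {s<..k}" for f l
    proof (rule ccontr)
      assume "f l \<noteq> 0"
      have lk: "l \<in> {1..k}" using l by auto
      have "k - s + 1 = f l + sum f ({1..k} - {l})"
        using f sum.remove[OF _ lk, of f] by (simp add: b_def)
      moreover have "k = l * f l + (\<Sum>i\<in>{1..k} - {l}. i * f i)"
        using f sum.remove[OF _ lk, of "\<lambda>i. i * f i"] by (simp add: B_def)
      moreover have "sum f ({1..k} - {l}) \<le> (\<Sum>i\<in>{1..k} - {l}. i * f i)"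
        by (intro sum_mono) auto
      moreover have "l * f l \<ge> (s + 1) * f l" using l by (intro mult_right_mono) auto
      moreover have "(s + 1) * f l \<ge> f l + s" using \<open>f l \<noteq> 0\<close> by (cases "f l") auto
      ultimately show False using sk by linarith
    qed
    show "(\<lambda>f. restrict f {1..s}) \<in> {f\<in>B. b f = k - s + 1} \<rightarrow> G s"
    proof
      fix f assume f: "f \<in> {f\<in>B. b f = k - s + 1}"
      have "sum (restrict f {1..s}) {1..s} = sum f {1..s}" by (rule sum.cong) auto
      also have "\<dots> = sum f {1..k}" using vanish[OF f] sk by (intro sum_restr[symmetric]) auto
      also have "\<dots> = k - s + 1" using f by (simp add: b_def)
      finally have 1: "sum (restrict f {1..s}) {1..s} = k - s + 1" .
      have "(\<Sum>l=1..s. l * restrict f {1..s} l) = (\<Sum>l=1..s. l * f l)" by (rule sum.cong) auto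
      also have "\<dots> = (\<Sum>l=1..k. l * f l)" using vanish[OF f] sk by (intro sum_restr[symmetric]) auto
      also have k: "\<dots> = k" using f by (simp add: B_def)
      finally have 2: "(\<Sum>l=1..s. l * restrict f {1..s} l) = k" .
      have "f l \<le> k" if "l \<in> {1..s}" for l
      proof -
        have "f l \<le> l * f l" using that by auto
        also have "\<dots> \<le> (\<Sum>l=1..k. l * f l)" using that sk by (intro member_le_sum) auto
        finally show ?thesis using k by simp
      qed
      with 1 2 show "restrict f {1..s} \<in> G s" by (auto simp: G_def)
    qed
    show "restrict (ext s f) {1..s} = f" if "f \<in> G s" for f
      using that by (auto simp: G_def ext_def PiE_iff extensional_def fun_eq_iff)
    show "ext s (restrict f {1..s}) = f" if "f \<in> {f\<in>B. b f = k - s + 1}" for f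
    proof
      fix l show "ext s (restrict f {1..s}) l = f l"
        using vanish[OF that, of l] that sk
        by (auto simp: ext_def B_def exponents_def PiE_iff extensional_def)
    qed
  qed
  define g where "g = (\<lambda>f. y ^ (b f - 1) * (fact k / fact (k + 1 - b f)) * (\<Prod>l=1..k. H l ^ f l / fact (f l)))"
  have "fps_nth (Abs_fps w ^ Suc k) k = (\<Sum>f\<in>B. fact (Suc k) / fact (Suc k - b f) * (\<Prod>l=1..k. w l ^ f l / fact (f l)))"
    using fps_nth_power_multinomial[of w "Suc k" k] by (simp add: w B_def b_def)
  also have "\<dots> = (\<Sum>f\<in>B. real (Suc k) * y * g f)"
  proof (rule sum.cong)
    fix f assume f: "f \<in> B"
    have "(\<Prod>l=1..k. w l ^ f l / fact (f l)) = (\<Prod>l=1..k. y ^ f l * (H l ^ f l / fact (f l)))"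
      by (rule prod.cong) (auto simp: w power_mult_distrib)
    also have "\<dots> = y ^ b f * (\<Prod>l=1..k. H l ^ f l / fact (f l))"
      by (simp only: prod.distrib b_def power_sum)
    also have "y ^ b f = y * y ^ (b f - 1)" using b1(1)[OF f] by (cases "b f") auto
    finally show "fact (Suc k) / fact (Suc k - b f) * (\<Prod>l=1..k. w l ^ f l / fact (f l)) = real (Suc k) * y * g f"
      by (simp add: g_def mult_ac)
  qed simp
  also have "\<dots> = real (Suc k) * (y * sum g B)" by (simp add: sum_distrib_left mult_ac)
  also have "sum g B = (\<Sum>s=1..k. \<Sum>f\<in>{f\<in>B. k + 1 - b f = s}. g f)"
    by (rule sum.group[symmetric, OF finB]) (use b1 in \<open>fastforce+\<close>)
  also have "\<dots> = moment_formula y H k"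
    unfolding moment_formula_def
  proof (rule sum.cong[OF refl])
    fix s assume s: "s \<in> {1..k}"
    have "{f\<in>B. k + 1 - b f = s} = {f\<in>B. b f = k - s + 1}" using s b1 by force
    then have "sum g {f\<in>B. k + 1 - b f = s} = (\<Sum>f\<in>G s. g (ext s f))"
      by (simp only: sum.reindex_bij_betw[OF bij[OF s]])
    also have "\<dots> = (\<Sum>f\<in>G s. y ^ (k - s) * (fact k / fact s) * (\<Prod>l=1..s. H l ^ f l / fact (f l)))"
    proof (rule sum.cong[OF refl])
      fix f assume "f \<in> G s"
      then have "b (ext s f) = k - s + 1" using bij_betwE[OF bij[OF s]] by auto
      moreover have "(\<Prod>l=1..k. H l ^ ext s f l / fact (ext s f l)) = (\<Prod>l=1..s. H l ^ ext s f l / fact (ext s f l))"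
        by (rule prod_restr) (use s in \<open>auto simp: ext_def\<close>)
      moreover have "\<dots> = (\<Prod>l=1..s. H l ^ f l / fact (f l))"
        by (rule prod.cong) (auto simp: ext_def)
      ultimately show "g (ext s f) = y ^ (k - s) * (fact k / fact s) * (\<Prod>l=1..s. H l ^ f l / fact (f l))"
        using s by (simp add: g_def del: One_nat_def)
    qed
    finally show "sum g {f\<in>B. k + 1 - b f = s} = y ^ (k - s) * (fact k / fact s) *
        (\<Sum>f\<in>{f. f \<in> {1..s} \<rightarrow>\<^sub>E {0..k} \<and> (\<Sum>l=1..s. f l) = k - s + 1 \<and> (\<Sum>l=1..s. l * f l) = k}.
        \<Prod>l=1..s. H l ^ f l / fact (f l))"
      by (simp add: G_def sum_distrib_left)
  qed
  finally show ?thesis .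
qed

text \<open>For D > 0 the weighted norm sum |w l| (2D)^(-l) is at most sum 2^(-l) <= 2, and it is
  submultiplicative; each of the N factors therefore contributes a 2.\<close>

lemma fps_nth_power_bound:
  fixes w :: "nat \<Rightarrow> real"
  assumes D: "D \<ge> 0" and w: "\<And>l. \<bar>w l\<bar> \<le> D ^ l"
  shows "\<bar>fps_nth (Abs_fps w ^ N) k\<bar> \<le> (2 * D) ^ k * 2 ^ N"
proof (induction N arbitrary: k)
  case 0
  then show ?case using D by auto
next
  case (Suc N)
  have "\<bar>fps_nth (Abs_fps w ^ Suc N) k\<bar> \<le> (\<Sum>l=0..k. \<bar>w l * fps_nth (Abs_fps w ^ N) (k - l)\<bar>)"
    by (simp add: fps_mult_nth sum_abs)
  also have "\<dots> \<le> (\<Sum>l=0..k. D ^ l * ((2 * D) ^ (k - l) * 2 ^ N))"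
    unfolding abs_mult by (intro sum_mono mult_mono w Suc) (use D in auto)
  also have "\<dots> = (\<Sum>l=0..k. (2 * D) ^ k * 2 ^ N * (1 / 2) ^ l)"
  proof (rule sum.cong[OF refl])
    fix l assume "l \<in> {0..k}"
    then have 1: "(2 * D) ^ l * (2 * D) ^ (k - l) = (2 * D) ^ k" by (subst power_add[symmetric]) simp
    have 2: "D ^ l = (2 * D) ^ l * (1 / 2) ^ l" by (subst power_mult_distrib[symmetric]) simp
    show "D ^ l * ((2 * D) ^ (k - l) * 2 ^ N) = (2 * D) ^ k * 2 ^ N * (1 / 2) ^ l"
      unfolding 1[symmetric] by (subst 2) (simp only: mult_ac)
  qed
  also have "\<dots> = (2 * D) ^ k * 2 ^ N * (\<Sum>l=0..k. (1 / 2) ^ l)" by (simp add: sum_distrib_left)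
  also have "\<dots> \<le> (2 * D) ^ k * 2 ^ N * 2"
    by (intro mult_left_mono) (use D in \<open>auto simp: atLeast0AtMost sum_gp0\<close>)
  finally show ?case by simp
qed

section \<open>Convergence in distribution from moments\<close>

definition clamp_at :: "real \<Rightarrow> real \<Rightarrow> real" where
  "clamp_at R x = max (- R) (min R x)"

lemma clamp_at_bound: "R \<ge> 0 \<Longrightarrow> \<bar>clamp_at R x\<bar> \<le> R" "R \<ge> 0 \<Longrightarrow> \<bar>clamp_at R x\<bar> \<le> \<bar>x\<bar>"
  by (auto simp: clamp_at_def)

lemma isCont_clamp_at_power: "isCont (\<lambda>x. clamp_at R x ^ k) x"
  unfolding clamp_at_def by (intro continuous_intros)

lemma borel_clamp_at_power [measurable]: "(\<lambda>x. clamp_at R x ^ k) \<in> borel_measurable borel"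
  by (intro borel_measurable_continuous_onI continuous_at_imp_continuous_on) (simp add: isCont_clamp_at_power)

text \<open>Beyond R one has R^k <= |x|^k, so a moment of twice the order, divided by R^k, pays for
  the truncation.\<close>

lemma clamp_at_power_diff:
  assumes R: "R > 0"
  shows "\<bar>x ^ k - clamp_at R x ^ k\<bar> \<le> 2 * x ^ (2 * k) / R ^ k"
proof (cases "\<bar>x\<bar> \<le> R")
  case True
  then have "clamp_at R x = x" by (auto simp: clamp_at_def)
  then show ?thesis using R by (simp add: power_mult)
next
  case False
  have "\<bar>x ^ k - clamp_at R x ^ k\<bar> \<le> \<bar>x\<bar> ^ k + \<bar>clamp_at R x\<bar> ^ k"
    using abs_triangle_ineq4[of "x ^ k" "clamp_at R x ^ k"] by (simp add: power_abs)
  also have "\<bar>clamp_at R x\<bar> ^ k \<le> \<bar>x\<bar> ^ k"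
    using R by (intro power_mono clamp_at_bound) auto
  finally have "\<bar>x ^ k - clamp_at R x ^ k\<bar> \<le> 2 * \<bar>x\<bar> ^ k" by simp
  also have "\<dots> * R ^ k \<le> 2 * \<bar>x\<bar> ^ k * \<bar>x\<bar> ^ k"
    using False R by (intro mult_left_mono power_mono) auto
  then have "2 * \<bar>x\<bar> ^ k \<le> 2 * \<bar>x\<bar> ^ k * \<bar>x\<bar> ^ k / R ^ k"
    using R by (simp add: field_simps)
  also have "2 * \<bar>x\<bar> ^ k * \<bar>x\<bar> ^ k = 2 * x ^ (2 * k)"
    by (simp add: power_mult power2_eq_square mult.assoc flip: power_mult_distrib)
  finally show ?thesis by simp
qed

lemma abs_le_one_plus_square: "\<bar>z\<bar> \<le> 1 + z\<^sup>2" for z :: real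
proof -
  have "0 \<le> (\<bar>z\<bar> - 1)\<^sup>2" by simp
  then show ?thesis unfolding power2_diff by simp
qed

text \<open>Powers are unbounded, so weak convergence applies only to their clamped versions. The
  convergent moments of order 2k make the truncation error of order R^(-k) uniformly along the
  sequence.\<close>

lemma weak_limit_moments:
  fixes \<mu> :: "nat \<Rightarrow> real measure" and \<nu> :: "real measure"
  assumes \<mu>: "\<And>n. real_distribution (\<mu> n)" and \<nu>: "real_distribution \<nu>" and conv: "weak_conv_m \<mu> \<nu>"
    and int: "\<And>n k. integrable (\<mu> n) (\<lambda>x. x ^ k)"
    and lim: "\<And>k. (\<lambda>n. \<integral>x. x ^ k \<partial>\<mu> n) \<longlonglongrightarrow> L k"
  shows "integrable \<nu> (\<lambda>x. x ^ k)" "(\<integral>x. x ^ k \<partial>\<nu>) = L k"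
proof -
  interpret \<nu>: real_distribution \<nu> by fact
  have int_clamp: "integrable N (\<lambda>x. clamp_at R x ^ j)" if "R \<ge> 0" "real_distribution N" for R j N
  proof -
    interpret N: real_distribution N by fact
    show ?thesis
      using that clamp_at_bound(1)[of R] by (intro N.integrable_const_bound[where B = "R ^ j"])
        (auto simp: power_abs intro!: power_mono)
  qed
  have clamp_lim: "(\<lambda>n. \<integral>x. clamp_at R x ^ j \<partial>\<mu> n) \<longlonglongrightarrow> (\<integral>x. clamp_at R x ^ j \<partial>\<nu>)" if "R \<ge> 0" for R j
    using that clamp_at_bound(1)[of R]
    by (intro weak_conv_imp_integral_bdd_continuous_conv[OF \<mu> \<nu> conv, where B = "R ^ j"] isCont_clamp_at_power)
      (auto simp: power_abs intro!: power_mono)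
  have even_le: "(\<integral>x. clamp_at R x ^ (2 * j) \<partial>\<nu>) \<le> L (2 * j)" if R: "R \<ge> 0" for R j
  proof (rule LIMSEQ_le[OF clamp_lim[OF R] lim], intro exI allI impI integral_mono int_clamp R \<mu> int)
    show "clamp_at R x ^ (2 * j) \<le> x ^ (2 * j)" for x
      using power_mono[OF clamp_at_bound(2)[OF R, of x], of "2 * j"] by (simp add: power_even_abs)
  qed
  \<comment> \<open>Fatou's lemma along growing truncation levels; even powers keep the clamped
    integrands nonnegative, and all their integrals stay below \<open>L (2 * j)\<close>.\<close>
  have even_int: "integrable \<nu> (\<lambda>x. x ^ (2 * j))" for j
  proof (rule integrableI_bounded)
    have "(\<integral>\<^sup>+x. ennreal (norm (x ^ (2 * j))) \<partial>\<nu>) = (\<integral>\<^sup>+x. liminf (\<lambda>n. ennreal (clamp_at (real n) x ^ (2 * j))) \<partial>\<nu>)"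
    proof (rule nn_integral_cong)
      fix x :: real
      obtain N :: nat where N: "\<bar>x\<bar> \<le> real N" using real_arch_simple by blast
      have "clamp_at (real n) x = x" if "n \<ge> N" for n
        using N that by (auto simp: clamp_at_def)
      then have "\<forall>\<^sub>F n in sequentially. ennreal (clamp_at (real n) x ^ (2 * j)) = ennreal (x ^ (2 * j))"
        by (intro eventually_sequentiallyI[of N]) simp
      then have "(\<lambda>n. ennreal (clamp_at (real n) x ^ (2 * j))) \<longlonglongrightarrow> ennreal (x ^ (2 * j))"
        by (rule tendsto_eventually)
      then show "ennreal (norm (x ^ (2 * j))) = liminf (\<lambda>n. ennreal (clamp_at (real n) x ^ (2 * j)))"
        by (subst lim_imp_Liminf) (auto simp: power_even_abs power_abs)
    qed
    also have "\<dots> \<le> liminf (\<lambda>n. \<integral>\<^sup>+x. ennreal (clamp_at (real n) x ^ (2 * j)) \<partial>\<nu>)"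
      by (rule nn_integral_liminf) auto
    also have "\<dots> = liminf (\<lambda>n. ennreal (\<integral>x. clamp_at (real n) x ^ (2 * j) \<partial>\<nu>))"
      by (simp add: nn_integral_eq_integral int_clamp \<nu> zero_le_power_eq)
    also have "\<dots> \<le> liminf (\<lambda>n. ennreal (L (2 * j)))"
      by (intro Liminf_mono always_eventually allI ennreal_leI even_le) auto
    also have "\<dots> = ennreal (L (2 * j))" by (simp add: Liminf_const)
    finally show "(\<integral>\<^sup>+x. ennreal (norm (x ^ (2 * j))) \<partial>\<nu>) < \<infinity>"
      by (rule order.strict_trans1) simp
  qed simp
  show int_\<nu>: "integrable \<nu> (\<lambda>x. x ^ k)" for k
  proof (rule Bochner_Integration.integrable_bound)
    show "integrable \<nu> (\<lambda>x. 1 + x ^ (2 * k))" using even_int[of k] by auto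
    show "AE x in \<nu>. norm (x ^ k) \<le> norm (1 + x ^ (2 * k))"
    proof (rule AE_I2)
      fix x :: real
      have "x ^ (2 * k) = (x ^ k)\<^sup>2" by (simp add: power_mult[symmetric] mult.commute)
      then show "norm (x ^ k) \<le> norm (1 + x ^ (2 * k))"
        using abs_le_one_plus_square[of "x ^ k"] by (simp only: real_norm_def)
    qed
  qed simp
  have trunc: "\<bar>(\<integral>x. x ^ k \<partial>N) - (\<integral>x. clamp_at R x ^ k \<partial>N)\<bar> \<le> 2 * (\<integral>x. x ^ (2 * k) \<partial>N) / R ^ k"
    if R: "R > 0" and N: "real_distribution N" and i: "\<And>k. integrable N (\<lambda>x. x ^ k)" for R N k
  proof -
    have "\<bar>(\<integral>x. x ^ k \<partial>N) - (\<integral>x. clamp_at R x ^ k \<partial>N)\<bar> = \<bar>\<integral>x. x ^ k - clamp_at R x ^ k \<partial>N\<bar>"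
      using R by (simp add: Bochner_Integration.integral_diff i int_clamp N)
    also have "\<dots> \<le> (\<integral>x. \<bar>x ^ k - clamp_at R x ^ k\<bar> \<partial>N)" by (rule integral_abs_bound)
    also have "\<dots> \<le> (\<integral>x. 2 * x ^ (2 * k) / R ^ k \<partial>N)"
      using R by (intro integral_mono clamp_at_power_diff) (auto simp: i int_clamp N)
    finally show ?thesis by simp
  qed
  show "(\<integral>x. x ^ k \<partial>\<nu>) = L k"
  \<comment> \<open>For k = 0 the factor R^k does not grow, so the total mass is treated
    separately.\<close>
  proof (cases "k = 0")
    case True
    have "(\<lambda>n. \<integral>x. x ^ 0 \<partial>\<mu> n) \<longlonglongrightarrow> 1"
      using \<mu> by (simp add: prob_space.prob_space real_distribution.axioms(1))
    then have "L 0 = 1" using lim[of 0] LIMSEQ_unique by blast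
    then show ?thesis using True \<nu>.prob_space by simp
  next
    case False
    define C where "C = 2 * L (2 * k) + 2 * (\<integral>x. x ^ (2 * k) \<partial>\<nu>)"
    have bound: "\<bar>L k - (\<integral>x. x ^ k \<partial>\<nu>)\<bar> \<le> C / R ^ k" if R: "R > 0" for R
    proof -
      have 1: "(\<lambda>n. \<bar>(\<integral>x. x ^ k \<partial>\<mu> n) - (\<integral>x. clamp_at R x ^ k \<partial>\<mu> n)\<bar>) \<longlonglongrightarrow> \<bar>L k - (\<integral>x. clamp_at R x ^ k \<partial>\<nu>)\<bar>"
        using R by (intro tendsto_intros lim clamp_lim) auto
      have 2: "(\<lambda>n. 2 * (\<integral>x. x ^ (2 * k) \<partial>\<mu> n) / R ^ k) \<longlonglongrightarrow> 2 * L (2 * k) / R ^ k"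
        using R by (intro tendsto_intros lim) auto
      have "\<bar>L k - (\<integral>x. clamp_at R x ^ k \<partial>\<nu>)\<bar> \<le> 2 * L (2 * k) / R ^ k"
        by (rule LIMSEQ_le[OF 1 2]) (use trunc[OF R \<mu> int] in auto)
      moreover have "\<bar>(\<integral>x. x ^ k \<partial>\<nu>) - (\<integral>x. clamp_at R x ^ k \<partial>\<nu>)\<bar> \<le> 2 * (\<integral>x. x ^ (2 * k) \<partial>\<nu>) / R ^ k"
        by (rule trunc[OF R \<nu> int_\<nu>])
      ultimately show ?thesis by (simp add: C_def add_divide_distrib)
    qed
    have "(\<lambda>n. C / real (Suc n) ^ k) \<longlonglongrightarrow> 0"
      using False by (intro tendsto_divide_0[OF tendsto_const] filterlim_at_top_imp_at_infinity filterlim_pow_at_top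
          filterlim_compose[OF filterlim_real_sequentially filterlim_Suc]) auto
    then have "\<bar>L k - (\<integral>x. x ^ k \<partial>\<nu>)\<bar> \<le> 0"
      by (rule LIMSEQ_le_const) (auto intro!: exI[of _ 0] bound simp del: of_nat_Suc)
    then show ?thesis by simp
  qed
qed

text \<open>The Taylor expansion of a characteristic function stopped at an even order 2n has an
  error of order (|t| C)^(2n) / (2n)!, because the absolute moment of even order is the moment
  itself. Both characteristic functions are thus close to the same partial sums.\<close>

lemma real_distribution_eqI_moments:
  assumes \<mu>: "real_distribution \<mu>" and \<nu>: "real_distribution \<nu>"
    and int: "\<And>k. integrable \<mu> (\<lambda>x. x ^ k)" "\<And>k. integrable \<nu> (\<lambda>x. x ^ k)"
    and eq: "\<And>k. (\<integral>x. x ^ k \<partial>\<mu>) = L k" "\<And>k. (\<integral>x. x ^ k \<partial>\<nu>) = L k"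
    and C: "\<And>k. \<bar>L k\<bar> \<le> B * C ^ k" and C0: "C \<ge> 0"
  shows "\<mu> = \<nu>"
proof (rule Levy_uniqueness[OF \<mu> \<nu>])
  show "char \<mu> = char \<nu>"
  proof
    fix t
    have approx: "cmod (char N t - (\<Sum>k\<le>2 * n. (\<i> * t) ^ k / fact k * L k)) \<le> 2 * B * ((\<bar>t\<bar> * C) ^ (2 * n) / fact (2 * n))"
      if "real_distribution N" "\<And>k. integrable N (\<lambda>x. x ^ k)" "\<And>k. (\<integral>x. x ^ k \<partial>N) = L k" for N n
    proof -
      interpret N: real_distribution N by fact
      have "cmod (char N t - (\<Sum>k\<le>2 * n. (\<i> * t) ^ k / fact k * L k)) \<le> (2 * \<bar>t\<bar> ^ (2 * n) / fact (2 * n)) * L (2 * n)"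
        using N.char_approx1[of "2 * n" t, OF that(2)] by (simp add: that(3) power_even_abs)
      also have "\<dots> \<le> (2 * \<bar>t\<bar> ^ (2 * n) / fact (2 * n)) * (B * C ^ (2 * n))"
        by (intro mult_left_mono order.trans[OF abs_ge_self C]) auto
      finally show ?thesis by (simp add: power_mult_distrib field_simps)
    qed
    have "(\<lambda>n. 4 * B * ((\<bar>t\<bar> * C) ^ n / fact n)) \<longlonglongrightarrow> 4 * B * 0"
      by (intro tendsto_mult tendsto_const summable_LIMSEQ_zero) (use summable_exp[of "\<bar>t\<bar> * C"] in \<open>simp add: field_simps\<close>)
    then have "((\<lambda>n. 4 * B * ((\<bar>t\<bar> * C) ^ n / fact n)) \<circ> (\<lambda>n. 2 * n)) \<longlonglongrightarrow> 4 * B * 0"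
      by (rule LIMSEQ_subseq_LIMSEQ) (auto simp: strict_mono_def)
    moreover have "cmod (char \<mu> t - char \<nu> t) \<le> ((\<lambda>n. 4 * B * ((\<bar>t\<bar> * C) ^ n / fact n)) \<circ> (\<lambda>n. 2 * n)) n" for n
      using approx[OF \<mu> int(1) eq(1), of n] approx[OF \<nu> int(2) eq(2), of n]
        norm_triangle_ineq4[of "char \<mu> t - (\<Sum>k\<le>2 * n. (\<i> * t) ^ k / fact k * L k)" "char \<nu> t - (\<Sum>k\<le>2 * n. (\<i> * t) ^ k / fact k * L k)"]
      by simp
    ultimately have "cmod (char \<mu> t - char \<nu> t) \<le> 4 * B * 0"
      by (intro LIMSEQ_le_const[of "(\<lambda>n. 4 * B * ((\<bar>t\<bar> * C) ^ n / fact n)) \<circ> (\<lambda>n. 2 * n)"]) blast+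
    then show "char \<mu> t = char \<nu> t" by simp
  qed
qed

text \<open>Bounded second moments give tightness, every subsequential limit inherits the moments
  \<open>L k\<close>, and the geometric bound on them leaves room for only one such limit.\<close>

theorem method_of_moments:
  fixes \<mu> :: "nat \<Rightarrow> real measure"
  assumes \<mu>: "\<And>n. real_distribution (\<mu> n)"
    and int: "\<And>n k. integrable (\<mu> n) (\<lambda>x. x ^ k)"
    and lim: "\<And>k. (\<lambda>n. \<integral>x. x ^ k \<partial>\<mu> n) \<longlonglongrightarrow> L k"
    and C: "\<And>k. \<bar>L k\<bar> \<le> B * C ^ k" and C0: "C \<ge> 0"
  shows "\<exists>\<nu>. real_distribution \<nu> \<and> weak_conv_m \<mu> \<nu> \<and> (\<forall>k. integrable \<nu> (\<lambda>x. x ^ k) \<and> (\<integral>x. x ^ k \<partial>\<nu>) = L k)"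
proof -
  have "Bseq (\<lambda>n. \<integral>x. x ^ 2 \<partial>\<mu> n)" using lim[of 2] by (auto intro: convergent_imp_Bseq convergentI)
  then obtain K where K: "K > 0" "\<And>n. \<bar>\<integral>x. x ^ 2 \<partial>\<mu> n\<bar> \<le> K" by (auto elim!: BseqE)
  have tight: "tight \<mu>"
    unfolding tight_def
  proof (intro conjI allI impI \<mu>)
    fix \<epsilon> :: real assume \<epsilon>: "\<epsilon> > 0"
    \<comment> \<open>Markov's inequality for x^2 at this level bounds the tail by K / c =
      \<epsilon> / 2.\<close>
    define c where "c = 2 * K / \<epsilon>"
    define R where "R = sqrt c"
    have c: "c > 0" using K \<epsilon> by (simp add: c_def)
    show "\<exists>a b. a < b \<and> (\<forall>n. 1 - \<epsilon> < measure (\<mu> n) {a<..b})"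
    proof (rule exI[of _ "- R"], rule exI[of _ R], intro conjI allI)
      show "- R < R" using c by (simp add: R_def)
      fix n
      interpret \<mu>: real_distribution "\<mu> n" by (rule \<mu>)
      have "measure (\<mu> n) {x \<in> space (\<mu> n). x ^ 2 \<ge> c} \<le> (\<integral>x. x ^ 2 \<partial>\<mu> n) / c"
        by (rule integral_Markov_inequality_measure[where A = "{}"]) (use int[of n 2] c in auto)
      also have "\<dots> \<le> K / c" using K(2)[of n] c by (intro divide_right_mono) auto
      also have "\<dots> < \<epsilon>" using K \<epsilon> by (simp add: c_def)
      finally have 1: "measure (\<mu> n) {x. x ^ 2 \<ge> c} < \<epsilon>" by simp
      have sub: "- {x. x ^ 2 \<ge> c} \<subseteq> {- R<..R}"
      proof
        fix x assume "x \<in> - {x. x ^ 2 \<ge> c}"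
        then have "sqrt (x ^ 2) < sqrt c" by (simp only: real_sqrt_less_iff Compl_iff mem_Collect_eq not_le)
        then show "x \<in> {- R<..R}" by (auto simp: R_def)
      qed
      have "1 - measure (\<mu> n) {x. x ^ 2 \<ge> c} = measure (\<mu> n) (- {x. x ^ 2 \<ge> c})"
        using \<mu>.prob_compl[of "{x. x ^ 2 \<ge> c}"] by (simp add: Compl_eq_Diff_UNIV)
      also have "\<dots> \<le> measure (\<mu> n) {- R<..R}" by (intro \<mu>.finite_measure_mono sub) auto
      finally show "1 - \<epsilon> < measure (\<mu> n) {- R<..R}" using 1 by linarith
    qed
  qed
  have sub: "integrable \<nu> (\<lambda>x. x ^ k) \<and> (\<integral>x. x ^ k \<partial>\<nu>) = L k"
    if "strict_mono s" "real_distribution \<nu>" "weak_conv_m (\<mu> \<circ> s) \<nu>" for s :: "nat \<Rightarrow> nat" and \<nu> k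
    using weak_limit_moments[of "\<mu> \<circ> s" \<nu> L k] that \<mu> int LIMSEQ_subseq_LIMSEQ[OF lim that(1)]
    by (auto simp: o_def)
  obtain r \<nu> where r: "strict_mono (r :: nat \<Rightarrow> nat)" and \<nu>: "real_distribution \<nu>" and conv: "weak_conv_m (\<mu> \<circ> r) \<nu>"
    using tight_imp_convergent_subsubsequence[OF tight, of id] by (auto simp: strict_mono_def)
  have "weak_conv_m \<mu> \<nu>"
  proof (rule tight_subseq_weak_converge[OF \<mu> \<nu> tight])
    fix s \<nu>' assume s: "strict_mono s" "real_distribution \<nu>'" "weak_conv_m (\<mu> \<circ> s) \<nu>'"
    have "\<nu>' = \<nu>"
      using sub[OF s] sub[OF r \<nu> conv] by (intro real_distribution_eqI_moments[OF s(2) \<nu> _ _ _ _ C C0]) auto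
    with s show "weak_conv_m (\<mu> \<circ> s) \<nu>" by simp
  qed
  with \<nu> sub[OF r \<nu> conv] show ?thesis by blast
qed

section \<open>Spectral distributions of symmetric matrices\<close>

lemma real_eigenvalue_of_symmetric:
  fixes A :: "real mat"
  assumes A: "A \<in> carrier_mat n n" and sym: "A\<^sup>T = A"
    and ev: "eigenvalue (map_mat complex_of_real A) a"
  shows "a \<in> \<real>"
proof -
  let ?B = "map_mat complex_of_real A"
  have B: "?B \<in> carrier_mat n n" using A by simp
  obtain v where v: "v \<in> carrier_vec n" "v \<noteq> 0\<^sub>v n" and eq: "?B *\<^sub>v v = a \<cdot>\<^sub>v v"
    using ev A unfolding eigenvalue_def eigenvector_def by auto
  have sym': "A $$ (i, j) = A $$ (j, i)" if "i < n" "j < n" for i j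
    using that A by (metis carrier_matD index_transpose_mat(1) sym)
  have row: "(\<Sum>j<n. A $$ (i, j) * v $ j) = a * v $ i" if "i < n" for i
  proof -
    have "(?B *\<^sub>v v) $ i = (\<Sum>j<n. A $$ (i, j) * v $ j)"
      using that A v by (simp add: scalar_prod_def atLeast0LessThan)
    with eq show ?thesis using that v by simp
  qed
  let ?N = "\<Sum>i<n. v $ i * cnj (v $ i)"
  have "a * ?N = (\<Sum>i<n. \<Sum>j<n. A $$ (i, j) * v $ j * cnj (v $ i))"
    by (simp add: sum_distrib_left sum_distrib_right row[symmetric] mult.assoc[symmetric])
  also have "\<dots> = (\<Sum>j<n. \<Sum>i<n. A $$ (j, i) * v $ j * cnj (v $ i))"
    by (subst sum.swap) (auto intro!: sum.cong simp: sym')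
  also have "\<dots> = (\<Sum>j<n. v $ j * cnj (\<Sum>i<n. A $$ (j, i) * v $ i))"
    by (simp add: sum_distrib_left mult_ac)
  also have "\<dots> = (\<Sum>j<n. v $ j * cnj (a * v $ j))"
    by (intro sum.cong refl) (simp only: row lessThan_iff)
  also have "\<dots> = cnj a * ?N"
    by (simp add: sum_distrib_left mult_ac)
  finally have "a * ?N = cnj a * ?N" .
  moreover have "?N \<noteq> 0"
  proof
    assume 0: "?N = 0"
    have "?N = complex_of_real (\<Sum>i<n. (cmod (v $ i))\<^sup>2)" by (simp only: of_real_sum complex_norm_square)
    with 0 have "(\<Sum>i<n. (cmod (v $ i))\<^sup>2) = 0" by (simp only: of_real_eq_0_iff)
    then have "v $ i = 0" if "i < n" for i using that by (subst (asm) sum_nonneg_eq_0_iff) auto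
    with v show False by (auto simp: vec_eq_iff)
  qed
  ultimately show ?thesis by (simp add: Reals_cnj_iff)
qed

text \<open>\<open>esd\<close> is built from the real roots of the characteristic polynomial; only
  this splitting over the reals guarantees that all n eigenvalues are among them.\<close>

lemma char_poly_symmetric_factorized:
  fixes A :: "real mat"
  assumes A: "A \<in> carrier_mat n n" and sym: "A\<^sup>T = A"
  obtains es where "char_poly A = (\<Prod>e\<leftarrow>es. [:- e, 1:])" "length es = n"
proof -
  let ?B = "map_mat complex_of_real A"
  interpret of_real_poly: map_poly_comm_ring_hom complex_of_real ..
  have B: "?B \<in> carrier_mat n n" using A by simp
  obtain as where as: "char_poly ?B = (\<Prod>a\<leftarrow>as. [:- a, 1:])" "length as = n"
    using char_poly_factorized[OF B] by blast
  have real: "a \<in> \<real>" if "a \<in> set as" for a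
  proof -
    have "poly (char_poly ?B) a = 0" using that unfolding as(1) by (induction as) auto
    then show ?thesis using real_eigenvalue_of_symmetric[OF A sym] eigenvalue_root_char_poly[OF B] by blast
  qed
  define es where "es = map Re as"
  have "map complex_of_real es = as" using real unfolding es_def by (induction as) auto
  then have "map_poly complex_of_real (char_poly A) = (\<Prod>a\<leftarrow>map complex_of_real es. [:- a, 1:])"
    using as(1) of_real_hom.char_poly_hom[OF A, where 'a = complex] by simp
  also have "\<dots> = map_poly complex_of_real (\<Prod>e\<leftarrow>es. [:- e, 1:])"
    by (induction es) (simp_all add: of_real_poly.hom_mult hom_distribs del: mult_pCons_left)
  finally have eq: "map_poly complex_of_real (char_poly A) = map_poly complex_of_real (\<Prod>e\<leftarrow>es. [:- e, 1:])" .
  have "char_poly A = (\<Prod>e\<leftarrow>es. [:- e, 1:])"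
    using arg_cong[OF eq, of "\<lambda>p. coeff p _"] by (intro poly_eqI) (simp add: coeff_map_poly)
  then show ?thesis using that[of es] as(2) by (simp only: es_def length_map)
qed

lemma mat_trace_mult_commute:
  assumes "A \<in> carrier_mat n m" "B \<in> carrier_mat m n"
  shows "mat_trace (A * B) = mat_trace (B * A)"
proof -
  have "mat_trace (A * B) = (\<Sum>i<n. \<Sum>j<m. A $$ (i, j) * B $$ (j, i))"
    using assms by (simp add: mat_trace_def scalar_prod_def atLeast0LessThan)
  also have "\<dots> = mat_trace (B * A)"
    using assms by (subst sum.swap) (simp add: mat_trace_def scalar_prod_def atLeast0LessThan mult.commute)
  finally show ?thesis .
qed

lemma upper_triangular_mult_diag:
  fixes B C :: "real mat"
  assumes B: "B \<in> carrier_mat n n" "upper_triangular B" and C: "C \<in> carrier_mat n n" "upper_triangular C"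
  shows "upper_triangular (B * C)" "\<And>i. i < n \<Longrightarrow> (B * C) $$ (i, i) = B $$ (i, i) * C $$ (i, i)"
proof -
  have entry: "(B * C) $$ (i, j) = (\<Sum>l<n. B $$ (i, l) * C $$ (l, j))" if "i < n" "j < n" for i j
    using that assms by (simp add: scalar_prod_def atLeast0LessThan)
  have zero: "B $$ (i, l) * C $$ (l, j) = 0" if "l < n" "i < n" "j < n" "l < i \<or> j < l" for i j l
    using that upper_triangularD[OF B(2), of l i] upper_triangularD[OF C(2), of j l] B C by auto
  show "upper_triangular (B * C)"
  proof (rule upper_triangularI)
    fix i j assume "j < i" "i < dim_row (B * C)"
    then have ij: "j < i" "i < n" "j < n" using B by auto
    have "(\<Sum>l<n. B $$ (i, l) * C $$ (l, j)) = 0"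
      by (intro sum.neutral ballI zero) (use ij in auto)
    then show "(B * C) $$ (i, j) = 0" using ij by (simp only: entry)
  qed
  fix i assume i: "i < n"
  have "(\<Sum>l<n. B $$ (i, l) * C $$ (l, i)) = (\<Sum>l\<in>{i}. B $$ (i, l) * C $$ (l, i))"
    by (rule sum.mono_neutral_right) (use i zero[of _ i i] linorder_neqE_nat in \<open>auto\<close>)
  then show "(B * C) $$ (i, i) = B $$ (i, i) * C $$ (i, i)" using i by (simp add: entry)
qed

text \<open>A Schur decomposition asks only for a split characteristic polynomial. The triangular
  factor carries \<open>es\<close> on its diagonal, its powers carry the powers of
  \<open>es\<close>, and the trace is invariant under similarity.\<close>

lemma sum_list_powers_eq_trace:
  fixes A :: "real mat"
  assumes A: "A \<in> carrier_mat n n" and cp: "char_poly A = (\<Prod>e\<leftarrow>es. [:- e, 1:])"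
  shows "(\<Sum>e\<leftarrow>es. e ^ k) = mat_trace (A ^\<^sub>m k)"
proof -
  obtain B P Q where s: "schur_decomposition A es = (B, P, Q)" by (cases "schur_decomposition A es") auto
  from schur_decomposition[OF A cp s] have wit: "similar_mat_wit A B P Q" and ut: "upper_triangular B" and diag: "diag_mat B = es"
    by auto
  note w = similar_mat_witD2[OF A wit]
  have pow: "A ^\<^sub>m k = P * B ^\<^sub>m k * Q" using similar_mat_wit_pow_id[OF wit] .
  have Bk: "B ^\<^sub>m k \<in> carrier_mat n n" using w by auto
  have utk: "upper_triangular (B ^\<^sub>m k) \<and> (\<forall>i<n. (B ^\<^sub>m k) $$ (i, i) = (B $$ (i, i)) ^ k)" for k
  proof (induction k)
    case 0
    then show ?case using w by auto
  next
    case (Suc k)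
    have "B ^\<^sub>m k \<in> carrier_mat n n" using w by auto
    from upper_triangular_mult_diag[OF this _ w(5) ut] Suc show ?case by (simp add: mult.commute)
  qed
  have "mat_trace (A ^\<^sub>m k) = mat_trace (P * (B ^\<^sub>m k * Q))" using pow w Bk by (simp add: assoc_mult_mat[of _ n n _ n _ n])
  also have "\<dots> = mat_trace ((B ^\<^sub>m k * Q) * P)" using w Bk by (intro mat_trace_mult_commute[of _ n n]) auto
  also have "(B ^\<^sub>m k * Q) * P = B ^\<^sub>m k" using w Bk by (simp add: assoc_mult_mat[of _ n n _ n _ n])
  also have "mat_trace (B ^\<^sub>m k) = (\<Sum>i<n. (B $$ (i, i)) ^ k)" using utk[of k] w by (simp add: mat_trace_def)
  also have "\<dots> = (\<Sum>e\<leftarrow>es. e ^ k)"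
    unfolding diag[symmetric] diag_mat_def using w
    by (simp add: o_def interv_sum_list_conv_sum_set_nat atLeast0LessThan)
  finally show ?thesis ..
qed

lemma proots_linear_factors: "proots (\<Prod>e\<leftarrow>es. [:- e, 1:]) = mset (es :: real list)"
proof (induction es)
  case (Cons e es)
  have "(\<Prod>e\<leftarrow>es. [:- e, 1:]) \<noteq> 0" by (auto simp: prod_list_zero_iff)
  with Cons show ?case by (simp add: proots_mult del: mult_pCons_left)
qed simp

lemma sum_list_count_set: "(\<Sum>x\<in>set xs. real (count (mset xs) x) * f x) = (\<Sum>x\<leftarrow>xs. f x)"
proof (induction xs)
  case (Cons a xs)
  have "(\<Sum>x\<in>set (a # xs). real (count (mset (a # xs)) x) * f x)
      = (\<Sum>x\<in>insert a (set xs). real (count (mset xs) x) * f x + (if x = a then f x else 0))"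
    unfolding list.set(2) by (rule sum.cong) (auto simp: algebra_simps)
  also have "\<dots> = (\<Sum>x\<in>insert a (set xs). real (count (mset xs) x) * f x) + f a"
    by (subst sum.distrib) simp
  also have "(\<Sum>x\<in>insert a (set xs). real (count (mset xs) x) * f x) = (\<Sum>x\<in>set xs. real (count (mset xs) x) * f x)"
    by (rule sum.mono_neutral_right) (auto simp: count_eq_zero_iff)
  finally show ?case using Cons by simp
qed simp

lemma prob_space_esd: "prob_space (esd A)"
  unfolding esd_def by (intro prob_space.prob_space_distr prob_space_measure_pmf) simp

lemma sets_esd [simp, measurable_cong]: "sets (esd A) = sets borel"
  by (simp add: esd_def)

text \<open>With n > 0 the multiset of roots is nonempty, as \<open>pmf_of_multiset\<close> demands;
  its finite support makes every measurable f integrable.\<close>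

lemma esd_integral:
  fixes A :: "real mat" and f :: "real \<Rightarrow> real"
  assumes A: "A \<in> carrier_mat n n" and n: "n > 0" and cp: "char_poly A = (\<Prod>e\<leftarrow>es. [:- e, 1:])" "length es = n"
    and f [measurable]: "f \<in> borel_measurable borel"
  shows "integrable (esd A) f" "(\<integral>x. f x \<partial>esd A) = (\<Sum>e\<leftarrow>es. f e) / n"
proof -
  have ne: "mset es \<noteq> {#}" using cp n by auto
  define p where "p = pmf_of_multiset (mset es)"
  have esd: "esd A = distr (measure_pmf p) borel (\<lambda>x. x)"
    unfolding esd_def cp(1) proots_linear_factors p_def ..
  have sp: "set_pmf p = set es" using ne by (simp add: p_def)
  show "integrable (esd A) f"
    unfolding esd by (subst integrable_distr_eq) (auto intro!: integrable_measure_pmf_finite simp: sp)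
  have "(\<integral>x. f x \<partial>esd A) = measure_pmf.expectation p f"
    unfolding esd by (subst integral_distr) auto
  also have "\<dots> = (\<Sum>x\<in>set es. f x * pmf p x)"
    by (subst integral_measure_pmf[of "set es"]) (auto simp: sp mult.commute)
  also have "\<dots> = (\<Sum>x\<in>set es. real (count (mset es) x) * f x) / n"
    using ne cp(2) by (simp add: p_def sum_divide_distrib mult.commute)
  finally show "(\<integral>x. f x \<partial>esd A) = (\<Sum>e\<leftarrow>es. f e) / n" by (simp only: sum_list_count_set)
qed

lemma esd_integral_polynomial:
  fixes A :: "real mat" and c :: "nat \<Rightarrow> real"
  assumes A: "A \<in> carrier_mat n n" "A\<^sup>T = A" and n: "n > 0"
  shows "integrable (esd A) (\<lambda>x. \<Sum>k\<le>N. c k * x ^ k)"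
    and "(\<integral>x. (\<Sum>k\<le>N. c k * x ^ k) \<partial>esd A) = (\<Sum>k\<le>N. c k * (mat_trace (A ^\<^sub>m k) / n))"
proof -
  obtain es where es: "char_poly A = (\<Prod>e\<leftarrow>es. [:- e, 1:])" "length es = n"
    using char_poly_symmetric_factorized[OF A] .
  have int: "integrable (esd A) (\<lambda>x. c k * x ^ k)" for k
    by (rule esd_integral[OF A(1) n es]) simp
  show "integrable (esd A) (\<lambda>x. \<Sum>k\<le>N. c k * x ^ k)" by (rule Bochner_Integration.integrable_sum) (rule int)
  have "(\<integral>x. c k * x ^ k \<partial>esd A) = c k * (mat_trace (A ^\<^sub>m k) / n)" for k
    by (subst esd_integral[OF A(1) n es]) (simp_all add: sum_list_const_mult sum_list_powers_eq_trace[OF A(1) es(1)])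
  then show "(\<integral>x. (\<Sum>k\<le>N. c k * x ^ k) \<partial>esd A) = (\<Sum>k\<le>N. c k * (mat_trace (A ^\<^sub>m k) / n))"
    by (simp only: Bochner_Integration.integral_sum int)
qed

section \<open>Measurability and mean of the random spectral distribution\<close>

lemma polynomials_tendsto_indicator_atMost:
  fixes t :: real
  obtains c :: "nat \<Rightarrow> nat \<Rightarrow> real" and N :: "nat \<Rightarrow> nat"
  where "\<And>x. (\<lambda>n. \<Sum>k\<le>N n. c n k * x ^ k) \<longlonglongrightarrow> indicator {..t} x"
proof -
  \<comment> \<open>Continuous steps that fall from 1 to 0 just to the right of t. Approximating the
    n-th one on the growing interval [-n, n] makes the polynomials converge at every real
    point.\<close>
  define g where "g = (\<lambda>n x. cts_step t (t + 1 / real (Suc n)) x)"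
  have cont: "continuous_on S (g n)" for n S
    unfolding g_def by (rule continuous_on_subset[OF uniformly_continuous_imp_continuous[OF cts_step_uniformly_continuous]]) auto
  have "\<exists>p. real_polynomial_function p \<and> (\<forall>x\<in>{- real n..real n}. \<bar>g n x - p x\<bar> < 1 / real (Suc n))" for n
    using Stone_Weierstrass_real_polynomial_function[of "{- real n..real n}" "g n" "1 / real (Suc n)"] cont
    by (metis compact_Icc of_nat_0_less_iff zero_less_Suc zero_less_divide_1_iff)
  then obtain p where p: "\<And>n. real_polynomial_function (p n)" "\<And>n x. x \<in> {- real n..real n} \<Longrightarrow> \<bar>g n x - p n x\<bar> < 1 / real (Suc n)"
    by metis
  from p(1) have "\<exists>a N. p n = (\<lambda>x. \<Sum>i\<le>N. a i * x ^ i)" for n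
    by (intro real_polynomial_function_imp_sum) 
  then obtain c N where c: "\<And>n. p n = (\<lambda>x. \<Sum>i\<le>N n. c n i * x ^ i)" by metis
  have "(\<lambda>n. p n x) \<longlonglongrightarrow> indicator {..t} x" for x
  proof -
    have "(\<lambda>n. g n x - p n x) \<longlonglongrightarrow> 0"
    proof (rule Lim_null_comparison)
      obtain M :: nat where M: "\<bar>x\<bar> \<le> real M" using real_arch_simple by blast
      show "\<forall>\<^sub>F n in sequentially. norm (g n x - p n x) \<le> 1 / real (Suc n)"
      proof (rule eventually_sequentiallyI[of M])
        fix n assume "M \<le> n"
        then have "x \<in> {- real n..real n}" using M by auto
        then show "norm (g n x - p n x) \<le> 1 / real (Suc n)" using p(2)[of x n] by simp
      qed
      show "(\<lambda>n. 1 / real (Suc n)) \<longlonglongrightarrow> 0" by real_asymp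
    qed
    moreover have "(\<lambda>n. g n x) \<longlonglongrightarrow> indicator {..t} x"
    proof (cases "x \<le> t")
      case True
      then show ?thesis by (simp add: g_def cts_step_def)
    next
      case False
      have "(\<lambda>n. 1 / real (Suc n)) \<longlonglongrightarrow> 0" by real_asymp
      then have "\<forall>\<^sub>F n in sequentially. 1 / real (Suc n) < x - t" using False by (intro order_tendstoD) auto
      then have "\<forall>\<^sub>F n in sequentially. g n x = indicator {..t} x"
        by eventually_elim (use False in \<open>auto simp: g_def cts_step_def\<close>)
      then show ?thesis by (rule tendsto_eventually)
    qed
    ultimately have "(\<lambda>n. g n x - (g n x - p n x)) \<longlonglongrightarrow> indicator {..t} x - 0" by (intro tendsto_diff)
    then show ?thesis by simp
  qed
  with that[of c N] show ?thesis unfolding c by blast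
qed

text \<open>No eigenvalue has to be selected measurably: the distribution function of
  \<open>esd\<close> at t is a pointwise limit of linear combinations of traces of powers, and the
  half-lines form an intersection-stable generator.\<close>

lemma measurable_esd:
  fixes A :: "'w \<Rightarrow> real mat"
  assumes A: "\<And>\<omega>. A \<omega> \<in> carrier_mat n n" "\<And>\<omega>. (A \<omega>)\<^sup>T = A \<omega>" and n: "n > 0"
    and meas [measurable]: "\<And>k. (\<lambda>\<omega>. mat_trace (A \<omega> ^\<^sub>m k)) \<in> borel_measurable M"
  shows "(\<lambda>\<omega>. esd (A \<omega>)) \<in> M \<rightarrow>\<^sub>M prob_algebra borel"
proof (rule measurable_prob_algebra_generated[where \<Omega> = UNIV and G = "range atMost"])
  show "sets borel = sigma_sets UNIV (range (atMost :: real \<Rightarrow> real set))"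
    by (simp add: borel_eq_atMost)
  show "Int_stable (range (atMost :: real \<Rightarrow> real set))"
    by (auto simp: Int_stable_def)
  fix B assume "B \<in> range (atMost :: real \<Rightarrow> real set)"
  then obtain t where B: "B = {..t}" by auto
  obtain c N where c: "\<And>x. (\<lambda>n. \<Sum>k\<le>N n. c n k * x ^ k) \<longlonglongrightarrow> (indicator {..t} x :: real)"
    using polynomials_tendsto_indicator_atMost[of t] by blast
  have lim: "(\<lambda>j. \<Sum>k\<le>N j. c j k * (mat_trace (A \<omega> ^\<^sub>m k) / n)) \<longlonglongrightarrow> measure (esd (A \<omega>)) {..t}" for \<omega>
  proof -
    interpret E: prob_space "esd (A \<omega>)" by (rule prob_space_esd)
    obtain es where es: "char_poly (A \<omega>) = (\<Prod>e\<leftarrow>es. [:- e, 1:])" "length es = n"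
      using char_poly_symmetric_factorized[OF A] .
    have "(\<lambda>j. \<Sum>k\<le>N j. c j k * (mat_trace (A \<omega> ^\<^sub>m k) / n)) = (\<lambda>j. (\<Sum>e\<leftarrow>es. \<Sum>k\<le>N j. c j k * e ^ k) / n)"
      by (rule ext) (subst esd_integral_polynomial(2)[OF A n, symmetric], rule esd_integral(2)[OF A(1) n es], measurable)
    moreover have "(\<lambda>j. (\<Sum>e\<leftarrow>es. \<Sum>k\<le>N j. c j k * e ^ k) / n) \<longlonglongrightarrow> (\<Sum>e\<leftarrow>es. indicator {..t} e) / n"
    proof (intro tendsto_divide tendsto_const)
      show "(\<lambda>j. \<Sum>e\<leftarrow>es. \<Sum>k\<le>N j. c j k * e ^ k) \<longlonglongrightarrow> (\<Sum>e\<leftarrow>es. indicator {..t} e)"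
        by (induction es) (auto intro!: tendsto_add c)
    qed (use n in simp)
    moreover have "(\<Sum>e\<leftarrow>es. indicator {..t} e) / n = measure (esd (A \<omega>)) {..t}"
      using esd_integral(2)[OF A(1) n es, of "indicator {..t}"] sets_eq_imp_space_eq[OF sets_esd[of "A \<omega>"]] by simp
    ultimately show ?thesis by simp
  qed
  have "(\<lambda>\<omega>. measure (esd (A \<omega>)) {..t}) \<in> borel_measurable M"
    by (rule borel_measurable_LIMSEQ_real[OF lim]) measurable
  moreover have "emeasure (esd (A \<omega>)) {..t} = ennreal (measure (esd (A \<omega>)) {..t})" for \<omega>
  proof -
    interpret E: prob_space "esd (A \<omega>)" by (rule prob_space_esd)
    show ?thesis by (rule E.emeasure_eq_measure)
  qed
  ultimately show "(\<lambda>\<omega>. emeasure (esd (A \<omega>)) B) \<in> borel_measurable M" by (simp add: B)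
qed (simp_all add: prob_space_esd)

text \<open>Integrals against a mixture are computed for nonnegative integrands, hence for
  nonnegative polynomials; a power of x is then a difference of two of these.\<close>

lemma expected_esd:
  fixes A :: "'w \<Rightarrow> real mat"
  assumes M: "prob_space M"
    and A: "\<And>\<omega>. A \<omega> \<in> carrier_mat n n" "\<And>\<omega>. (A \<omega>)\<^sup>T = A \<omega>" and n: "n > 0"
    and int: "\<And>k. integrable M (\<lambda>\<omega>. mat_trace (A \<omega> ^\<^sub>m k))"
  shows "real_distribution (M \<bind> (\<lambda>\<omega>. esd (A \<omega>)))"
    and "integrable (M \<bind> (\<lambda>\<omega>. esd (A \<omega>))) (\<lambda>x. x ^ k)"
    and "(\<integral>x. x ^ k \<partial>(M \<bind> (\<lambda>\<omega>. esd (A \<omega>)))) = (\<integral>\<omega>. mat_trace (A \<omega> ^\<^sub>m k) \<partial>M) / n"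
proof -
  interpret prob_space M by fact
  let ?N = "M \<bind> (\<lambda>\<omega>. esd (A \<omega>))"
  have K: "(\<lambda>\<omega>. esd (A \<omega>)) \<in> M \<rightarrow>\<^sub>M prob_algebra borel"
    by (rule measurable_esd[OF A n]) (use int in auto)
  then have K': "(\<lambda>\<omega>. esd (A \<omega>)) \<in> M \<rightarrow>\<^sub>M subprob_algebra borel" by (rule measurable_prob_algebraD)
  have sets: "sets ?N = sets borel" using not_empty by (rule sets_bind[rotated]) simp
  have "prob_space ?N"
    using K' by (intro prob_space_bind) (auto simp: prob_space_esd)
  moreover have "space ?N = UNIV" using sets_eq_imp_space_eq[OF sets] by simp
  ultimately show "real_distribution ?N"
    by (simp only: real_distribution_def real_distribution_axioms_def sets)
  have poly: "integrable ?N (\<lambda>x. \<Sum>k\<le>d. c k * x ^ k) \<and> (\<integral>x. (\<Sum>k\<le>d. c k * x ^ k) \<partial>?N) = (\<Sum>k\<le>d. c k * ((\<integral>\<omega>. mat_trace (A \<omega> ^\<^sub>m k) \<partial>M) / n))"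
    if nonneg: "\<And>x. (\<Sum>k\<le>d. c k * x ^ k) \<ge> 0" for d and c :: "nat \<Rightarrow> real"
  proof -
    let ?p = "\<lambda>x. \<Sum>k\<le>d. c k * x ^ k"
    let ?q = "\<lambda>\<omega>. \<Sum>k\<le>d. c k * (mat_trace (A \<omega> ^\<^sub>m k) / n)"
    have "(\<integral>\<^sup>+x. ennreal (?p x) \<partial>?N) = (\<integral>\<^sup>+\<omega>. \<integral>\<^sup>+x. ennreal (?p x) \<partial>esd (A \<omega>) \<partial>M)"
      by (rule nn_integral_bind[OF _ K']) measurable
    also have "\<dots> = (\<integral>\<^sup>+\<omega>. ennreal (?q \<omega>) \<partial>M)"
      using esd_integral_polynomial[OF A n] by (intro nn_integral_cong) (simp add: nn_integral_eq_integral nonneg)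
    also have "\<dots> = ennreal (\<integral>\<omega>. ?q \<omega> \<partial>M)"
    proof (rule nn_integral_eq_integral)
      show "integrable M ?q" using int by auto
      show "AE \<omega> in M. 0 \<le> ?q \<omega>"
        unfolding esd_integral_polynomial(2)[OF A n, symmetric] by (intro AE_I2 integral_nonneg_AE) (simp add: nonneg)
    qed
    also have "(\<integral>\<omega>. ?q \<omega> \<partial>M) = (\<Sum>k\<le>d. c k * ((\<integral>\<omega>. mat_trace (A \<omega> ^\<^sub>m k) \<partial>M) / n))"
      using int by simp
    finally have eq: "(\<integral>\<^sup>+x. ennreal (?p x) \<partial>?N) = ennreal (\<Sum>k\<le>d. c k * ((\<integral>\<omega>. mat_trace (A \<omega> ^\<^sub>m k) \<partial>M) / n))" .
    have ge: "0 \<le> (\<Sum>k\<le>d. c k * ((\<integral>\<omega>. mat_trace (A \<omega> ^\<^sub>m k) \<partial>M) / n))"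
    proof -
      have "0 \<le> (\<integral>\<omega>. ?q \<omega> \<partial>M)"
        unfolding esd_integral_polynomial(2)[OF A n, symmetric] by (intro integral_nonneg_AE AE_I2) (simp add: nonneg)
      then show ?thesis using int by simp
    qed
    have meas: "?p \<in> borel_measurable ?N" using sets by (simp cong: measurable_cong_sets)
    have "integrable ?N ?p"
      by (rule integrableI_nn_integral_finite[OF meas _ eq]) (simp add: nonneg)
    moreover have "(\<integral>x. ?p x \<partial>?N) = (\<Sum>k\<le>d. c k * ((\<integral>\<omega>. mat_trace (A \<omega> ^\<^sub>m k) \<partial>M) / n))"
      by (rule integral_eq_nn_integral[OF meas, THEN trans]) (simp_all only: nonneg eq ge enn2real_ennreal AE_I2)
    ultimately show ?thesis by blast
  qed
  \<comment> \<open>The decomposition is x^k = (1 + x^k + x^(2k)) - (1 + x^(2k)). The coefficients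
    are sums of indicators so that exponents which coincide, as for k = 0, are counted with
    multiplicity.\<close>
  define c1 where "c1 = (\<lambda>i::nat. (if i = 0 then 1 else 0) + (if i = k then 1 else 0) + (if i = 2 * k then 1 else 0) :: real)"
  define c2 where "c2 = (\<lambda>i::nat. (if i = 0 then 1 else 0) + (if i = 2 * k then 1 else 0) :: real)"
  have s: "(\<Sum>i\<le>2 * k. c1 i * h i) = h 0 + h k + h (2 * k)" "(\<Sum>i\<le>2 * k. c2 i * h i) = h 0 + h (2 * k)" for h :: "nat \<Rightarrow> real"
    by (simp_all add: c1_def c2_def ring_distribs sum.distrib if_distrib[of "\<lambda>x. x * _"] cong: if_cong)
  have sq: "x ^ (2 * k) = (x ^ k)\<^sup>2" for x :: real by (simp add: power_mult[symmetric] mult.commute)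
  have nn1: "(\<Sum>i\<le>2 * k. c1 i * x ^ i) \<ge> 0" for x
  proof -
    \<comment> \<open>With u = x^k the right-hand side is twice 1 + u + u^2.\<close>
    have "0 \<le> (x ^ k + 1)\<^sup>2 + (x ^ k)\<^sup>2 + 1" by simp
    then show ?thesis unfolding s sq power2_sum by simp
  qed
  have nn2: "(\<Sum>i\<le>2 * k. c2 i * x ^ i) \<ge> 0" for x
    unfolding s sq by simp
  note p1 = poly[OF nn1, unfolded s] and p2 = poly[OF nn2, unfolded s]
  have x: "(\<lambda>x. x ^ k) = (\<lambda>x :: real. (x ^ 0 + x ^ k + x ^ (2 * k)) - (x ^ 0 + x ^ (2 * k)))"
    by auto
  show "integrable ?N (\<lambda>x. x ^ k)"
    by (subst x, rule Bochner_Integration.integrable_diff) (rule p1[THEN conjunct1], rule p2[THEN conjunct1])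
  show "(\<integral>x. x ^ k \<partial>?N) = (\<integral>\<omega>. mat_trace (A \<omega> ^\<^sub>m k) \<partial>M) / n"
    unfolding arg_cong[OF x, of "integral\<^sup>L ?N"] Bochner_Integration.integral_diff[OF p1[THEN conjunct1] p2[THEN conjunct1]]
      p1[THEN conjunct2] p2[THEN conjunct2]
    by (simp add: algebra_simps)
qed

section \<open>Operators on finitely many coordinates\<close>

definition ip :: "nat \<Rightarrow> (nat \<Rightarrow> real) \<Rightarrow> (nat \<Rightarrow> real) \<Rightarrow> real" where
  "ip m f g = (\<Sum>i<m. f i * g i)"

definition unit_fun :: "nat \<Rightarrow> nat \<Rightarrow> real" where
  "unit_fun l = (\<lambda>i. if i = l then 1 else 0)"

text \<open>This is s times the sum of x_j x_j^T over j in J. With s = 1/n and J = {..<n} it is W_n;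
  the separate parameter J lets a column be removed while the scale s stays.\<close>

definition gram_op :: "nat \<Rightarrow> real \<Rightarrow> (nat \<Rightarrow> nat \<Rightarrow> real) \<Rightarrow> nat set \<Rightarrow> (nat \<Rightarrow> real) \<Rightarrow> nat \<Rightarrow> real" where
  "gram_op m s x J f = (\<lambda>i. \<Sum>j\<in>J. s * x j i * ip m (x j) f)"

definition kernel_op :: "nat \<Rightarrow> (nat \<Rightarrow> nat \<Rightarrow> real) \<Rightarrow> (nat \<Rightarrow> real) \<Rightarrow> nat \<Rightarrow> real" where
  "kernel_op m t f = (\<lambda>i. \<Sum>l<m. t i l * f l)"

definition op_trace :: "nat \<Rightarrow> ((nat \<Rightarrow> real) \<Rightarrow> nat \<Rightarrow> real) \<Rightarrow> real" where
  "op_trace m P = (\<Sum>i<m. P (unit_fun i) i)"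

text \<open>Operators act on functions on all of nat; the second conjunct says that the first m coordinates of the
  image depend only on the first m coordinates of the argument.\<close>

definition linear_op :: "nat \<Rightarrow> ((nat \<Rightarrow> real) \<Rightarrow> nat \<Rightarrow> real) \<Rightarrow> bool" where
  "linear_op m P \<longleftrightarrow> (\<forall>f g c. P (\<lambda>i. f i + c * g i) = (\<lambda>i. P f i + c * P g i)) \<and>
    (\<forall>g i. i < m \<longrightarrow> P g i = (\<Sum>l<m. g l * P (unit_fun l) i))"

definition sym_op :: "nat \<Rightarrow> ((nat \<Rightarrow> real) \<Rightarrow> nat \<Rightarrow> real) \<Rightarrow> bool" where
  "sym_op m P \<longleftrightarrow> (\<forall>f g. ip m f (P g) = ip m (P f) g)"

lemma linear_opD: "linear_op m P \<Longrightarrow> P (\<lambda>i. f i + c * g i) = (\<lambda>i. P f i + c * P g i)"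
  and linear_op_expand: "linear_op m P \<Longrightarrow> i < m \<Longrightarrow> P g i = (\<Sum>l<m. g l * P (unit_fun l) i)"
  unfolding linear_op_def by blast+

lemma ip_commute: "ip m f g = ip m g f"
  by (simp add: ip_def mult.commute)

lemma ip_add_scaled: "ip m h (\<lambda>i. f i + c * g i) = ip m h f + c * ip m h g"
  by (simp add: ip_def algebra_simps sum.distrib sum_distrib_left)

lemma ip_unit_fun: "i < m \<Longrightarrow> ip m f (unit_fun i) = f i"
  by (simp add: ip_def unit_fun_def if_distrib[of "\<lambda>x. _ * x"] cong: if_cong)

lemma ip_self_nonneg: "0 \<le> ip m f f"
  by (simp add: ip_def sum_nonneg)

lemma linear_op_id: "linear_op m (\<lambda>f. f)"
  by (simp add: linear_op_def unit_fun_def if_distrib[of "\<lambda>x. _ * x"] cong: if_cong)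

lemma linear_op_comp:
  assumes P: "linear_op m P" and Q: "linear_op m Q"
  shows "linear_op m (\<lambda>f. P (Q f))"
  unfolding linear_op_def
proof (intro conjI allI impI)
  fix f g c show "P (Q (\<lambda>i. f i + c * g i)) = (\<lambda>i. P (Q f) i + c * P (Q g) i)"
    by (simp only: linear_opD[OF Q] linear_opD[OF P])
next
  fix g i assume i: "i < m"
  have "P (Q g) i = (\<Sum>l<m. Q g l * P (unit_fun l) i)" using P i by (rule linear_op_expand)
  also have "\<dots> = (\<Sum>l<m. \<Sum>r<m. g r * (Q (unit_fun r) l * P (unit_fun l) i))"
    by (rule sum.cong[OF refl]) (simp add: linear_op_expand[OF Q, of _ g] sum_distrib_right mult.assoc)
  also have "\<dots> = (\<Sum>r<m. g r * (\<Sum>l<m. Q (unit_fun r) l * P (unit_fun l) i))"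
    by (subst sum.swap) (simp add: sum_distrib_left)
  also have "\<dots> = (\<Sum>r<m. g r * P (Q (unit_fun r)) i)"
    using i by (simp add: linear_op_expand[OF P, of i "Q _"])
  finally show "P (Q g) i = (\<Sum>r<m. g r * P (Q (unit_fun r)) i)" .
qed

lemma linear_op_funpow: "linear_op m P \<Longrightarrow> linear_op m (P ^^ k)"
proof (induction k)
  case 0
  then show ?case using linear_op_id by (simp add: id_def)
next
  case (Suc k)
  then show ?case using linear_op_comp[of m P "P ^^ k"] by (simp add: o_def)
qed

lemma sym_op_funpow: "sym_op m P \<Longrightarrow> ip m f ((P ^^ k) g) = ip m ((P ^^ k) f) g"
proof (induction k arbitrary: f g)
  case (Suc k)
  have "ip m f ((P ^^ Suc k) g) = ip m (P f) ((P ^^ k) g)" using Suc.prems by (simp add: sym_op_def)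
  also have "\<dots> = ip m ((P ^^ k) (P f)) g" by (rule Suc.IH[OF Suc.prems])
  finally show ?case by (simp add: funpow_swap1)
qed simp

lemma ip_unit_fun_sum: "(\<Sum>l<m. g l * ip m h (unit_fun l)) = ip m g h"
  unfolding ip_def[of m g h] by (rule sum.cong) (simp_all add: ip_unit_fun)

lemma linear_op_kernel_op: "linear_op m (kernel_op m t)"
proof -
  have "kernel_op m t (unit_fun l) i = t i l" if "l < m" for i l
    using that by (simp add: kernel_op_def unit_fun_def if_distrib[of "\<lambda>x. _ * x"] cong: if_cong)
  then show ?thesis
    by (simp add: linear_op_def kernel_op_def algebra_simps sum.distrib sum_distrib_left)
qed

lemma kernel_op_unit_fun: "l < m \<Longrightarrow> kernel_op m t (unit_fun l) i = t i l"
  by (simp add: kernel_op_def unit_fun_def if_distrib[of "\<lambda>x. _ * x"] cong: if_cong)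

lemma linear_op_gram_op: "linear_op m (gram_op m s x J)"
  unfolding linear_op_def
proof (intro conjI allI impI)
  fix f g c show "gram_op m s x J (\<lambda>i. f i + c * g i) = (\<lambda>i. gram_op m s x J f i + c * gram_op m s x J g i)"
    by (simp add: gram_op_def ip_add_scaled algebra_simps sum.distrib sum_distrib_left)
next
  fix g i assume "i < m"
  have "(\<Sum>l<m. g l * gram_op m s x J (unit_fun l) i) = (\<Sum>j\<in>J. \<Sum>l<m. s * x j i * (g l * ip m (x j) (unit_fun l)))"
    unfolding gram_op_def sum_distrib_left by (subst sum.swap) (simp add: mult_ac)
  also have "\<dots> = gram_op m s x J g i"
    by (simp add: gram_op_def sum_distrib_left[symmetric] ip_unit_fun_sum ip_commute[of m g])
  finally show "gram_op m s x J g i = (\<Sum>l<m. g l * gram_op m s x J (unit_fun l) i)" ..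
qed

lemma sym_op_kernel_op:
  assumes "\<And>i l. t i l = t l i"
  shows "sym_op m (kernel_op m t)"
proof -
  have "ip m f (kernel_op m t g) = ip m (kernel_op m t f) g" for f g
  proof -
    have "ip m f (kernel_op m t g) = (\<Sum>i<m. \<Sum>l<m. f i * (t i l * g l))"
      by (simp add: ip_def kernel_op_def sum_distrib_left)
    also have "\<dots> = (\<Sum>l<m. \<Sum>i<m. t l i * f i * g l)"
      by (subst sum.swap) (simp add: assms mult_ac)
    finally show ?thesis by (simp add: ip_def kernel_op_def sum_distrib_right)
  qed
  then show ?thesis by (simp add: sym_op_def)
qed

lemma ip_gram_op: "ip m f (gram_op m s x J g) = (\<Sum>j\<in>J. s * ip m f (x j) * ip m (x j) g)"
proof -
  have "ip m f (gram_op m s x J g) = (\<Sum>i<m. \<Sum>j\<in>J. s * (f i * x j i) * ip m (x j) g)"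
    by (simp add: ip_def[of m f] gram_op_def sum_distrib_left mult_ac)
  also have "\<dots> = (\<Sum>j\<in>J. s * (\<Sum>i<m. f i * x j i) * ip m (x j) g)"
    by (subst sum.swap) (simp add: sum_distrib_left sum_distrib_right)
  finally show ?thesis by (simp add: ip_def[of m f])
qed

lemma sym_op_gram_op: "sym_op m (gram_op m s x J)"
  unfolding sym_op_def by (subst (2) ip_commute) (simp add: ip_gram_op ip_commute mult_ac)

lemma gram_op_insert:
  assumes "finite J" "j \<notin> J"
  shows "gram_op m s x (insert j J) f = (\<lambda>i. gram_op m s x J f i + (s * ip m (x j) f) * x j i)"
  using assms by (simp add: gram_op_def fun_eq_iff)

text \<open>Apply the rank-one update W f = A f + s <x_j, f> x_j to the innermost factor. The factor
  that depends on f then involves only A, which is free of x_j, while all that still contains W is a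
  form in x_j alone of smaller order, to which the identity applies again.\<close>

lemma gram_op_funpow_insert:
  fixes m s x j J
  defines "W \<equiv> gram_op m s x (insert j J)" and "A \<equiv> gram_op m s x J"
  assumes J: "finite J" "j \<notin> J"
  shows "s * ip m (x j) ((W ^^ k) f) = s * ip m (x j) ((A ^^ k) f) +
    (\<Sum>q<k. s * ip m (x j) ((A ^^ q) f) * (s * ip m (x j) ((W ^^ (k - 1 - q)) (x j))))"
proof (induction k arbitrary: f)
  case (Suc k)
  have lin: "linear_op m (W ^^ k)" unfolding W_def by (intro linear_op_funpow linear_op_gram_op)
  have "(W ^^ Suc k) f = (W ^^ k) (\<lambda>i. A f i + (s * ip m (x j) f) * x j i)"
    unfolding funpow_Suc_right o_def W_def A_def gram_op_insert[OF J] ..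
  also have "\<dots> = (\<lambda>i. (W ^^ k) (A f) i + (s * ip m (x j) f) * (W ^^ k) (x j) i)"
    by (rule linear_opD[OF lin])
  finally have "(W ^^ Suc k) f = (\<lambda>i. (W ^^ k) (A f) i + (s * ip m (x j) f) * (W ^^ k) (x j) i)" .
  then have "s * ip m (x j) ((W ^^ Suc k) f) = s * ip m (x j) ((W ^^ k) (A f))
      + (s * ip m (x j) f) * (s * ip m (x j) ((W ^^ k) (x j)))"
    by (simp only: ip_add_scaled) (simp add: algebra_simps)
  also have "s * ip m (x j) ((W ^^ k) (A f)) = s * ip m (x j) ((A ^^ Suc k) f) +
    (\<Sum>q<k. s * ip m (x j) ((A ^^ Suc q) f) * (s * ip m (x j) ((W ^^ (k - 1 - q)) (x j))))"
    by (simp only: Suc.IH funpow_Suc_right o_def)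
  finally show ?case by (simp add: sum.lessThan_Suc_shift del: funpow.simps sum.lessThan_Suc)
qed simp

text \<open>Only the outermost factor is expanded; the symmetry of both operators moves the
  remaining ones onto x_j.\<close>

lemma op_trace_gram_op_Suc:
  assumes T: "sym_op m T"
  shows "op_trace m (\<lambda>f. (gram_op m s x J ^^ Suc k) ((T ^^ p) f)) =
    (\<Sum>j\<in>J. s * ip m (x j) ((gram_op m s x J ^^ k) ((T ^^ p) (x j))))"
proof -
  let ?W = "gram_op m s x J"
  have *: "ip m (x j) ((?W ^^ k) ((T ^^ p) (unit_fun i))) = (T ^^ p) ((?W ^^ k) (x j)) i" if "i < m" for i j
    using that by (simp add: sym_op_funpow[OF sym_op_gram_op] sym_op_funpow[OF T] ip_unit_fun)
  have "op_trace m (\<lambda>f. (?W ^^ Suc k) ((T ^^ p) f)) = (\<Sum>i<m. \<Sum>j\<in>J. s * (x j i * (T ^^ p) ((?W ^^ k) (x j)) i))"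
    by (simp add: op_trace_def gram_op_def[of m s x J "_ _"] * mult.assoc)
  also have "\<dots> = (\<Sum>j\<in>J. s * ip m (x j) ((T ^^ p) ((?W ^^ k) (x j))))"
    by (subst sum.swap) (simp add: ip_def sum_distrib_left)
  also have "\<dots> = (\<Sum>j\<in>J. s * ip m (x j) ((?W ^^ k) ((T ^^ p) (x j))))"
    by (subst ip_commute) (simp add: sym_op_funpow[OF sym_op_gram_op] sym_op_funpow[OF T])
  finally show ?thesis .
qed

lemma ip_linear_op:
  assumes "linear_op m P"
  shows "ip m f (P g) = (\<Sum>i<m. \<Sum>l<m. f i * g l * P (unit_fun l) i)"
  unfolding ip_def by (simp add: linear_op_expand[OF assms, of _ g] sum_distrib_left mult_ac)

lemma op_trace_kernel_op:
  assumes "linear_op m P"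
  shows "op_trace m (\<lambda>f. P (kernel_op m t f)) = (\<Sum>i<m. \<Sum>l<m. t l i * P (unit_fun l) i)"
  unfolding op_trace_def
  by (intro sum.cong refl) (simp add: linear_op_expand[OF assms, of _ "kernel_op _ _ _"] kernel_op_unit_fun)

section \<open>Schur test and Hilbert-Schmidt norm\<close>

definition hs_norm_sq :: "nat \<Rightarrow> ((nat \<Rightarrow> real) \<Rightarrow> nat \<Rightarrow> real) \<Rightarrow> real" where
  "hs_norm_sq m P = (\<Sum>i<m. \<Sum>l<m. (P (unit_fun l) i)\<^sup>2)"

text \<open>Schur test: |t i l| is split into two square roots before Cauchy-Schwarz. One factor is
  a row sum, the other becomes a column sum after the summations are exchanged, and by symmetry K
  bounds both.\<close>

lemma kernel_op_norm_le:
  assumes sym: "\<And>i l. t i l = t l i" and K: "\<And>i. (\<Sum>l<m. \<bar>t i l\<bar>) \<le> K"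
  shows "ip m (kernel_op m t f) (kernel_op m t f) \<le> K\<^sup>2 * ip m f f"
proof -
  have K0: "K \<ge> 0" using order_trans[OF sum_nonneg K] by force
  have "(kernel_op m t f i)\<^sup>2 \<le> K * (\<Sum>l<m. \<bar>t i l\<bar> * (f l)\<^sup>2)" for i
  proof -
    have "\<bar>kernel_op m t f i\<bar> \<le> (\<Sum>l<m. sqrt \<bar>t i l\<bar> * (sqrt \<bar>t i l\<bar> * \<bar>f l\<bar>))"
      unfolding kernel_op_def by (rule order_trans[OF sum_abs]) (simp add: abs_mult mult.assoc[symmetric])
    then have "(kernel_op m t f i)\<^sup>2 \<le> (\<Sum>l<m. sqrt \<bar>t i l\<bar> * (sqrt \<bar>t i l\<bar> * \<bar>f l\<bar>))\<^sup>2"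
      using power_mono[of "\<bar>kernel_op m t f i\<bar>" _ 2] by simp
    also have "\<dots> \<le> (\<Sum>l<m. (sqrt \<bar>t i l\<bar>)\<^sup>2) * (\<Sum>l<m. (sqrt \<bar>t i l\<bar> * \<bar>f l\<bar>)\<^sup>2)"
      by (rule Cauchy_Schwarz_ineq_sum)
    also have "\<dots> = (\<Sum>l<m. \<bar>t i l\<bar>) * (\<Sum>l<m. \<bar>t i l\<bar> * (f l)\<^sup>2)"
      by (simp add: power_mult_distrib)
    also have "\<dots> \<le> K * (\<Sum>l<m. \<bar>t i l\<bar> * (f l)\<^sup>2)"
      by (intro mult_right_mono K sum_nonneg) auto
    finally show ?thesis .
  qed
  then have "ip m (kernel_op m t f) (kernel_op m t f) \<le> (\<Sum>i<m. K * (\<Sum>l<m. \<bar>t i l\<bar> * (f l)\<^sup>2))"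
    unfolding ip_def by (intro sum_mono) (simp add: power2_eq_square)
  also have "\<dots> = K * (\<Sum>l<m. (\<Sum>i<m. \<bar>t l i\<bar>) * (f l)\<^sup>2)"
    unfolding sum_distrib_left[symmetric] sum_distrib_right by (subst sum.swap) (simp add: sym)
  also have "\<dots> \<le> K * (\<Sum>l<m. K * (f l)\<^sup>2)"
    by (intro mult_left_mono sum_mono mult_right_mono K K0) auto
  also have "\<dots> = K\<^sup>2 * ip m f f" by (simp add: ip_def sum_distrib_left power2_eq_square mult_ac)
  finally show ?thesis .
qed

lemma kernel_op_funpow_norm_le:
  assumes sym: "\<And>i l. t i l = t l i" and K: "\<And>i. (\<Sum>l<m. \<bar>t i l\<bar>) \<le> K"
  shows "ip m ((kernel_op m t ^^ p) f) ((kernel_op m t ^^ p) f) \<le> K ^ (2 * p) * ip m f f"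
proof (induction p)
  case (Suc p)
  have "ip m ((kernel_op m t ^^ Suc p) f) ((kernel_op m t ^^ Suc p) f) \<le> K\<^sup>2 * (K ^ (2 * p) * ip m f f)"
    using kernel_op_norm_le[of t m K "(kernel_op m t ^^ p) f", OF sym K] mult_left_mono[OF Suc, of "K\<^sup>2"] by simp
  then show ?case by (simp add: power2_eq_square mult_ac)
qed simp

text \<open>By the symmetry of t, row i of the composed operator is the kernel applied to row i of
  P, so the norm bound works row by row.\<close>

lemma hs_norm_sq_kernel_op_le:
  assumes sym: "\<And>i l. t i l = t l i" and K: "\<And>i. (\<Sum>l<m. \<bar>t i l\<bar>) \<le> K" and P: "linear_op m P"
  shows "hs_norm_sq m (\<lambda>f. P (kernel_op m t f)) \<le> K\<^sup>2 * hs_norm_sq m P"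
proof -
  have "(\<Sum>l<m. (P (kernel_op m t (unit_fun l)) i)\<^sup>2) \<le> K\<^sup>2 * (\<Sum>l<m. (P (unit_fun l) i)\<^sup>2)" if i: "i < m" for i
  proof -
    have "P (kernel_op m t (unit_fun l)) i = kernel_op m t (\<lambda>r. P (unit_fun r) i) l" if "l < m" for l
      by (simp add: linear_op_expand[OF P i, of "kernel_op _ _ _"] kernel_op_unit_fun[OF that]) (simp add: kernel_op_def sym)
    then have "(\<Sum>l<m. (P (kernel_op m t (unit_fun l)) i)\<^sup>2)
        = ip m (kernel_op m t (\<lambda>r. P (unit_fun r) i)) (kernel_op m t (\<lambda>r. P (unit_fun r) i))"
      by (simp add: ip_def power2_eq_square)
    also have "\<dots> \<le> K\<^sup>2 * ip m (\<lambda>r. P (unit_fun r) i) (\<lambda>r. P (unit_fun r) i)"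
      by (rule kernel_op_norm_le[OF sym K])
    finally show ?thesis by (simp add: ip_def power2_eq_square)
  qed
  then have "hs_norm_sq m (\<lambda>f. P (kernel_op m t f)) \<le> (\<Sum>i<m. K\<^sup>2 * (\<Sum>l<m. (P (unit_fun l) i)\<^sup>2))"
    unfolding hs_norm_sq_def by (intro sum_mono) simp
  then show ?thesis by (simp only: hs_norm_sq_def sum_distrib_left)
qed

lemma hs_norm_sq_kernel_op_funpow_le:
  assumes sym: "\<And>i l. t i l = t l i" and K: "\<And>i. (\<Sum>l<m. \<bar>t i l\<bar>) \<le> K" and P: "linear_op m P"
  shows "hs_norm_sq m (\<lambda>f. P ((kernel_op m t ^^ p) f)) \<le> K ^ (2 * p) * hs_norm_sq m P"
proof (induction p)
  case (Suc p)
  have "linear_op m (\<lambda>f. P ((kernel_op m t ^^ p) f))"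
    by (rule linear_op_comp[OF P linear_op_funpow[OF linear_op_kernel_op]])
  from hs_norm_sq_kernel_op_le[OF sym K this]
  have "hs_norm_sq m (\<lambda>f. P ((kernel_op m t ^^ Suc p) f)) \<le> K\<^sup>2 * (K ^ (2 * p) * hs_norm_sq m P)"
    using mult_left_mono[OF Suc, of "K\<^sup>2"] unfolding funpow_Suc_right o_def by simp
  then show ?case by (simp add: power2_eq_square mult_ac)
qed simp

text \<open>Turns the Hilbert-Schmidt norm, in which variances are estimated, into a trace, for
  which moment bounds are available.\<close>

lemma hs_norm_sq_sym_funpow:
  assumes "sym_op m P"
  shows "hs_norm_sq m (P ^^ q) = op_trace m (P ^^ (2 * q))"
proof -
  have "hs_norm_sq m (P ^^ q) = (\<Sum>l<m. ip m ((P ^^ q) (unit_fun l)) ((P ^^ q) (unit_fun l)))"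
    unfolding hs_norm_sq_def ip_def by (subst sum.swap) (simp add: power2_eq_square)
  also have "\<dots> = (\<Sum>l<m. ip m ((P ^^ q) ((P ^^ q) (unit_fun l))) (unit_fun l))"
    by (simp add: sym_op_funpow[OF assms])
  also have "\<dots> = op_trace m (P ^^ (2 * q))"
    by (simp add: op_trace_def ip_unit_fun mult_2 funpow_add)
  finally show ?thesis .
qed

section \<open>Positive semidefinite operators\<close>

lemma gram_op_funpow_psd:
  assumes "s \<ge> 0"
  shows "0 \<le> ip m f ((gram_op m s x J ^^ q) f)"
proof -
  let ?W = "gram_op m s x J"
  \<comment> \<open>By symmetry half of the factors go to either side; for odd q one factor stays in
    the middle and gives a sum of squares itself.\<close>
  define r where "r = q div 2"
  define g where "g = (?W ^^ r) f"
  show ?thesis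
  proof (cases "even q")
    case True
    then have "(?W ^^ q) f = (?W ^^ r) g" by (auto simp: g_def r_def mult_2 funpow_add elim!: evenE)
    then have "ip m f ((?W ^^ q) f) = ip m g g"
      by (simp add: sym_op_funpow[OF sym_op_gram_op, of m f] g_def)
    then show ?thesis by (simp add: ip_self_nonneg)
  next
    case False
    then have q: "q = r + Suc r" by (auto simp: r_def elim!: oddE)
    have "(?W ^^ q) f = (?W ^^ r) (?W g)" unfolding q funpow_add by (simp add: g_def)
    then have "ip m f ((?W ^^ q) f) = ip m g (?W g)"
      by (simp add: sym_op_funpow[OF sym_op_gram_op, of m f] g_def)
    also have "\<dots> = (\<Sum>j\<in>J. s * (ip m g (x j))\<^sup>2)"
      unfolding ip_gram_op by (simp add: ip_commute power2_eq_square mult_ac)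
    finally show ?thesis using assms by (simp add: sum_nonneg)
  qed
qed

lemma psd_cauchy_schwarz:
  assumes P: "linear_op m P" "sym_op m P" and psd: "\<And>f. 0 \<le> ip m f (P f)"
  shows "(ip m f (P g))\<^sup>2 \<le> ip m f (P f) * ip m g (P g)"
proof -
  define a b c where "a = ip m f (P f)" "b = ip m f (P g)" "c = ip m g (P g)"
  have q: "0 \<le> a + 2 * z * b + z\<^sup>2 * c" for z
  proof -
    have ba: "ip m g (P f) = b" using P(2) by (simp add: sym_op_def a_b_c_def ip_commute)
    have "0 \<le> ip m (\<lambda>i. f i + z * g i) (P (\<lambda>i. f i + z * g i))" by (rule psd)
    also have "\<dots> = a + z * b + z * (b + z * c)"
      by (simp only: linear_opD[OF P(1)] ip_add_scaled ip_commute[of m "\<lambda>i. f i + z * g i"])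
        (simp add: ip_commute[of m "P _"] ba a_b_c_def[symmetric] algebra_simps)
    finally show ?thesis by (simp add: algebra_simps power2_eq_square)
  qed
  have c0: "0 \<le> c" and a0: "0 \<le> a" by (simp_all add: a_b_c_def psd)
  have "b\<^sup>2 \<le> a * c"
  proof (cases "c = 0")
    case True
    have "b = 0"
    proof (rule ccontr)
      assume "b \<noteq> 0"
      \<comment> \<open>With c = 0 the form is affine in z, and this z makes it equal to -1.\<close>
      then have "a + 2 * (- (a + 1) / (2 * b)) * b = - 1" by (simp add: field_simps)
      then show False using q[of "- (a + 1) / (2 * b)"] True by simp
    qed
    then show ?thesis using a0 c0 by simp
  next
    case False
    \<comment> \<open>Evaluation at the minimiser z = -b / c.\<close>
    then have "0 \<le> a - b\<^sup>2 / c" using q[of "- b / c"] by (simp add: power2_eq_square field_simps)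
    then show ?thesis using False c0 by (simp add: field_simps)
  qed
  then show ?thesis by (simp add: a_b_c_def)
qed

lemma psd_entry_le:
  assumes P: "linear_op m P" "sym_op m P" and psd: "\<And>f. 0 \<le> ip m f (P f)" and "i < m" "l < m"
  shows "\<bar>P (unit_fun l) i\<bar> \<le> sqrt (P (unit_fun i) i) * sqrt (P (unit_fun l) l)" "0 \<le> P (unit_fun i) i"
proof -
  have e: "ip m (unit_fun r) (P (unit_fun q)) = P (unit_fun q) r" if "r < m" for q r
    using ip_unit_fun[OF that, of "P (unit_fun q)"] by (simp add: ip_commute)
  have "(P (unit_fun l) i)\<^sup>2 \<le> P (unit_fun i) i * P (unit_fun l) l"
    using psd_cauchy_schwarz[OF P psd, of "unit_fun i" "unit_fun l"] assms(4,5) by (simp add: e)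
  from real_sqrt_le_mono[OF this]
  show "\<bar>P (unit_fun l) i\<bar> \<le> sqrt (P (unit_fun i) i) * sqrt (P (unit_fun l) l)"
    by (simp add: real_sqrt_mult)
  show "0 \<le> P (unit_fun i) i" using psd[of "unit_fun i"] e assms(4) by simp
qed

lemma op_trace_funpow_eq_mat_trace:
  assumes M: "M \<in> carrier_mat m m" and P: "linear_op m P"
    and entry: "\<And>i l. i < m \<Longrightarrow> l < m \<Longrightarrow> P (unit_fun l) i = M $$ (i, l)"
  shows "op_trace m (P ^^ k) = mat_trace (M ^\<^sub>m k)"
proof -
  have "(P ^^ k) (unit_fun l) i = (M ^\<^sub>m k) $$ (i, l)" if "i < m" "l < m" for i l
    using that
  proof (induction k arbitrary: i l)
    case 0
    then show ?case using M by (simp add: unit_fun_def)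
  next
    case (Suc k)
    have "(P ^^ Suc k) (unit_fun l) i = (P ^^ k) (P (unit_fun l)) i" by (simp add: funpow_swap1)
    also have "\<dots> = (\<Sum>r<m. P (unit_fun l) r * (P ^^ k) (unit_fun r) i)"
      using linear_op_funpow[OF P] Suc.prems by (intro linear_op_expand) auto
    also have "\<dots> = (\<Sum>r<m. (M ^\<^sub>m k) $$ (i, r) * M $$ (r, l))"
      using Suc by (intro sum.cong refl) (simp add: entry)
    also have "\<dots> = (M ^\<^sub>m Suc k) $$ (i, l)"
      using Suc.prems M by (simp add: scalar_prod_def atLeast0LessThan)
    finally show ?case .
  qed
  then show ?thesis using M by (simp add: op_trace_def mat_trace_def)
qed

section \<open>Sums over pairings\<close>

lemma sum_PiE_insert:
  assumes "x \<notin> S"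
  shows "(\<Sum>f\<in>Pi\<^sub>E (insert x S) T. h f) = (\<Sum>y\<in>T x. \<Sum>g\<in>Pi\<^sub>E S T. h (g(x := y)))"
proof -
  have "(\<Sum>f\<in>Pi\<^sub>E (insert x S) T. h f) = (\<Sum>(y, g)\<in>T x \<times> Pi\<^sub>E S T. h (g(x := y)))"
    unfolding PiE_insert_eq using inj_combinator[OF assms, of T]
    by (subst sum.reindex) (auto simp: o_def case_prod_unfold)
  then show ?thesis by (simp add: sum.cartesian_product)
qed

lemma prod_pairs:
  fixes v :: "nat \<Rightarrow> real"
  shows "(\<Prod>p=1..2*r. v p) = (\<Prod>l=1..r. v (2 * l - 1) * v (2 * l))"
  by (induction r) (simp_all add: mult.assoc)

lemma sum_PiE_pairs:
  fixes F :: "nat \<Rightarrow> nat \<Rightarrow> real"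
  shows "(\<Sum>ix\<in>{1..2*r} \<rightarrow>\<^sub>E {..<m}. \<Prod>l=1..r. F (ix (2 * l - 1)) (ix (2 * l))) = (\<Sum>i<m. \<Sum>l<m. F i l) ^ r"
proof (induction r)
  case (Suc r)
  have ins: "{1..2 * Suc r} = insert (2 * r + 1) (insert (2 * r + 2) {1..2 * r})" by auto
  let ?R = "\<lambda>ix. \<Prod>l=1..r. F (ix (2 * l - 1)) (ix (2 * l))"
  have "(\<Sum>ix\<in>{1..2 * Suc r} \<rightarrow>\<^sub>E {..<m}. \<Prod>l=1..Suc r. F (ix (2 * l - 1)) (ix (2 * l))) =
    (\<Sum>i<m. \<Sum>l<m. \<Sum>ix\<in>{1..2 * r} \<rightarrow>\<^sub>E {..<m}. ?R ix * F i l)"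
    unfolding ins
  proof (subst sum_PiE_insert; (subst sum_PiE_insert)?)
    show "(\<Sum>y<m. \<Sum>ya<m. \<Sum>g\<in>{1..2 * r} \<rightarrow>\<^sub>E {..<m}. \<Prod>l=1..Suc r. F ((g(2 * r + 2 := ya, 2 * r + 1 := y)) (2 * l - 1)) ((g(2 * r + 2 := ya, 2 * r + 1 := y)) (2 * l)))
      = (\<Sum>i<m. \<Sum>l<m. \<Sum>ix\<in>{1..2 * r} \<rightarrow>\<^sub>E {..<m}. ?R ix * F i l)"
    proof (intro sum.cong refl)
      fix i l g
      have "?R (g(2 * r + 2 := l, 2 * r + 1 := i)) = ?R g"
        by (rule prod.cong) auto
      then show "(\<Prod>k=1..Suc r. F ((g(2 * r + 2 := l, 2 * r + 1 := i)) (2 * k - 1)) ((g(2 * r + 2 := l, 2 * r + 1 := i)) (2 * k))) = ?R g * F i l"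
        by (simp add: prod.nat_ivl_Suc' del: fun_upd_apply) simp
    qed
  qed auto
  also have "\<dots> = (\<Sum>i<m. \<Sum>l<m. (\<Sum>i<m. \<Sum>l<m. F i l) ^ r * F i l)"
    by (simp only: Suc sum_distrib_right[symmetric])
  also have "\<dots> = (\<Sum>i<m. \<Sum>l<m. F i l) ^ Suc r"
    by (simp add: sum_distrib_left sum_distrib_right mult.commute)
  finally show ?case .
qed simp

lemma sum_PiE_permute:
  assumes \<sigma>: "\<sigma> permutes I"
  shows "(\<Sum>ix\<in>I \<rightarrow>\<^sub>E S. h (ix \<circ> \<sigma>)) = (\<Sum>ix\<in>I \<rightarrow>\<^sub>E S. h ix)"
proof (rule sum.reindex_bij_witness[where i = "\<lambda>ix. ix \<circ> inv_into UNIV \<sigma>" and j = "\<lambda>ix. ix \<circ> \<sigma>"])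
  have in_PiE: "ix \<circ> \<tau> \<in> I \<rightarrow>\<^sub>E S" if "ix \<in> I \<rightarrow>\<^sub>E S" "\<tau> permutes I" for ix \<tau>
    using that permutes_in_image[OF that(2)] by (auto simp: PiE_iff extensional_def)
  show "ix \<circ> \<sigma> \<in> I \<rightarrow>\<^sub>E S" if "ix \<in> I \<rightarrow>\<^sub>E S" for ix using in_PiE[OF that \<sigma>] .
  show "ix \<circ> inv_into UNIV \<sigma> \<in> I \<rightarrow>\<^sub>E S" if "ix \<in> I \<rightarrow>\<^sub>E S" for ix using in_PiE[OF that permutes_inv[OF \<sigma>]] .
  show "ix \<circ> \<sigma> \<circ> inv_into UNIV \<sigma> = ix" "ix \<circ> inv_into UNIV \<sigma> \<circ> \<sigma> = ix" if "ix \<in> I \<rightarrow>\<^sub>E S" for ix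
    using permutes_inv_o[OF \<sigma>] by (simp_all add: o_assoc[symmetric])
qed simp

text \<open>The weight is a product over all positions, hence invariant under permuting them. Every
  \<sigma> can therefore be undone by reindexing the tuples, and each of the (2r)! permutations
  contributes the same r-th power.\<close>

lemma sum_PiE_pairing_bound:
  fixes v :: "nat \<Rightarrow> real" and G :: "nat \<Rightarrow> nat \<Rightarrow> real"
  assumes v: "\<And>i. 0 \<le> v i" and E: "\<And>ix. \<bar>E ix\<bar> \<le> c * (\<Sum>\<sigma> | \<sigma> permutes {1..2*r}. \<Prod>l=1..r. G (ix (\<sigma> (2 * l - 1))) (ix (\<sigma> (2 * l))))"
  shows "(\<Sum>ix\<in>{1..2*r} \<rightarrow>\<^sub>E {..<m}. (\<Prod>p=1..2*r. v (ix p)) * \<bar>E ix\<bar>)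
    \<le> c * fact (2 * r) * (\<Sum>i<m. \<Sum>l<m. v i * v l * G i l) ^ r"
proof -
  let ?I = "{1..2*r}"
  have "(\<Sum>ix\<in>?I \<rightarrow>\<^sub>E {..<m}. (\<Prod>p=1..2*r. v (ix p)) * \<bar>E ix\<bar>)
     \<le> (\<Sum>ix\<in>?I \<rightarrow>\<^sub>E {..<m}. (\<Prod>p=1..2*r. v (ix p)) * (c * (\<Sum>\<sigma> | \<sigma> permutes ?I. \<Prod>l=1..r. G (ix (\<sigma> (2 * l - 1))) (ix (\<sigma> (2 * l))))))"
    by (intro sum_mono mult_left_mono E prod_nonneg v)
  also have "\<dots> = c * (\<Sum>\<sigma> | \<sigma> permutes ?I. \<Sum>ix\<in>?I \<rightarrow>\<^sub>E {..<m}. (\<Prod>p=1..2*r. v (ix p)) * (\<Prod>l=1..r. G (ix (\<sigma> (2 * l - 1))) (ix (\<sigma> (2 * l)))))"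
    by (subst sum.swap) (simp add: sum_distrib_left mult_ac)
  also have "\<dots> = c * (\<Sum>\<sigma> | \<sigma> permutes ?I. (\<Sum>i<m. \<Sum>l<m. v i * v l * G i l) ^ r)"
  proof (intro arg_cong[of _ _ "\<lambda>x. c * x"] sum.cong refl)
    fix \<sigma> assume "\<sigma> \<in> {\<sigma>. \<sigma> permutes ?I}"
    then have \<sigma>: "\<sigma> permutes ?I" by simp
    let ?h = "\<lambda>ix :: nat \<Rightarrow> nat. (\<Prod>p=1..2*r. v (ix p)) * (\<Prod>l=1..r. G (ix (2 * l - 1)) (ix (2 * l)))"
    have "(\<Prod>p=1..2*r. v (ix p)) = (\<Prod>p=1..2*r. v ((ix \<circ> \<sigma>) p))" for ix
      using prod.permute[OF \<sigma>, of "\<lambda>p. v (ix p)"] by (simp add: o_def)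
    then have "(\<Sum>ix\<in>?I \<rightarrow>\<^sub>E {..<m}. (\<Prod>p=1..2*r. v (ix p)) * (\<Prod>l=1..r. G (ix (\<sigma> (2 * l - 1))) (ix (\<sigma> (2 * l)))))
      = (\<Sum>ix\<in>?I \<rightarrow>\<^sub>E {..<m}. ?h (ix \<circ> \<sigma>))"
      by (simp only: o_def)
    also have "\<dots> = (\<Sum>ix\<in>?I \<rightarrow>\<^sub>E {..<m}. ?h ix)" by (rule sum_PiE_permute[OF \<sigma>])
    also have "\<dots> = (\<Sum>ix\<in>?I \<rightarrow>\<^sub>E {..<m}. \<Prod>l=1..r. v (ix (2 * l - 1)) * v (ix (2 * l)) * G (ix (2 * l - 1)) (ix (2 * l)))"
    proof (intro sum.cong refl)
      fix ix :: "nat \<Rightarrow> nat"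
      show "?h ix = (\<Prod>l=1..r. v (ix (2 * l - 1)) * v (ix (2 * l)) * G (ix (2 * l - 1)) (ix (2 * l)))"
        unfolding prod_pairs[of "\<lambda>p. v (ix p)"] by (simp only: prod.distrib)
    qed
    also have "\<dots> = (\<Sum>i<m. \<Sum>l<m. v i * v l * G i l) ^ r" by (rule sum_PiE_pairs)
    finally show "(\<Sum>ix\<in>?I \<rightarrow>\<^sub>E {..<m}. (\<Prod>p=1..2*r. v (ix p)) * (\<Prod>l=1..r. G (ix (\<sigma> (2 * l - 1))) (ix (\<sigma> (2 * l)))))
      = (\<Sum>i<m. \<Sum>l<m. v i * v l * G i l) ^ r" .
  qed
  also have "\<dots> = c * fact (2 * r) * (\<Sum>i<m. \<Sum>l<m. v i * v l * G i l) ^ r"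
    using card_permutations[of ?I "2 * r"] by (simp del: One_nat_def)
  finally show ?thesis .
qed

text \<open>(A2) speaks of nondecreasing tuples; sorting makes it available for all of them.\<close>

lemma sorting_permutation:
  fixes ix :: "nat \<Rightarrow> nat"
  obtains \<sigma> where "\<sigma> permutes {1..n}" "mono_on {1..n} (ix \<circ> \<sigma>)"
proof -
  define xs where "xs = map ix [1..<Suc n]"
  have len: "length xs = n" by (simp add: xs_def)
  obtain p where p: "p permutes {..<length xs}" "permute_list p xs = sort xs"
    using mset_eq_permutation[of "sort xs" xs] by auto
  have p': "p permutes {..<n}" using p(1) len by simp
  \<comment> \<open>\<open>permute_list\<close> acts on positions counted from 0, while tuples are
    indexed from 1; \<sigma> is \<open>p\<close> conjugated by the shift and the identity
    elsewhere.\<close>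
  define \<sigma> where "\<sigma> = (\<lambda>i. if i \<in> {1..n} then Suc (p (i - 1)) else i)"
  have "\<sigma> permutes {1..n}"
  proof (rule bij_imp_permutes)
    have "bij_betw (Suc \<circ> p \<circ> (\<lambda>i. i - 1)) {1..n} {1..n}"
    proof (intro bij_betw_trans)
      show "bij_betw (\<lambda>i. i - 1) {1..n} {..<n}"
        by (rule bij_betw_byWitness[where f' = Suc]) auto
      show "bij_betw p {..<n} {..<n}" using p' by (rule permutes_imp_bij)
      show "bij_betw Suc {..<n} {1..n}"
        by (rule bij_betw_byWitness[where f' = "\<lambda>i. i - 1"]) auto
    qed
    then show "bij_betw \<sigma> {1..n} {1..n}"
      by (subst bij_betw_cong[of _ _ "Suc \<circ> p \<circ> (\<lambda>i. i - 1)"]) (auto simp: \<sigma>_def)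
  qed (auto simp: \<sigma>_def)
  moreover have "mono_on {1..n} (ix \<circ> \<sigma>)"
  proof (rule mono_onI)
    fix r s assume rs: "r \<in> {1..n}" "s \<in> {1..n}" "r \<le> s"
    have val: "(ix \<circ> \<sigma>) r = sort xs ! (r - 1)" if "r \<in> {1..n}" for r
    proof -
      have r: "r - 1 < n" using that by auto
      then have "p (r - 1) < n" using permutes_in_image[OF p', of "r - 1"] by auto
      then have "xs ! p (r - 1) = ix (Suc (p (r - 1)))"
        unfolding xs_def by (simp del: upt_Suc)
      moreover have "sort xs ! (r - 1) = xs ! p (r - 1)"
        using permute_list_nth[OF p(1), of "r - 1"] p(2) r len by simp
      ultimately show ?thesis using that by (simp add: \<sigma>_def)
    qed
    have "sort xs ! (r - 1) \<le> sort xs ! (s - 1)"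
      using rs len by (intro sorted_nth_mono) auto
    then show "(ix \<circ> \<sigma>) r \<le> (ix \<circ> \<sigma>) s" using rs val by simp
  qed
  ultimately show ?thesis by (rule that)
qed

section \<open>Kernels decaying geometrically with the distance\<close>

definition ndist :: "nat \<Rightarrow> nat \<Rightarrow> nat" where
  "ndist i l = nat \<bar>int i - int l\<bar>"

lemma ndist_commute: "ndist i l = ndist l i"
  by (auto simp: ndist_def)

lemma ndist_le: "i \<le> l \<Longrightarrow> ndist i l = l - i"
  by (auto simp: ndist_def)

lemma ndist_ge: "l \<le> i \<Longrightarrow> ndist i l = i - l"
  by (auto simp: ndist_def)

text \<open>The range is first enlarged so that it contains i; each side of i is then part of a
  geometric series.\<close>

lemma sum_power_ndist_le:
  fixes g :: real
  assumes "0 \<le> g" "g < 1"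
  shows "(\<Sum>l<m. g ^ ndist i l) \<le> 2 / (1 - g)"
proof -
  have "(\<Sum>l<m. g ^ ndist i l) \<le> (\<Sum>l<max m (Suc i). g ^ ndist i l)"
    using assms by (intro sum_mono2) auto
  also have "{..<max m (Suc i)} = {..i} \<union> {Suc i..<max m (Suc i)}" by auto
  also have "(\<Sum>l\<in>{..i} \<union> {Suc i..<max m (Suc i)}. g ^ ndist i l) = (\<Sum>l\<le>i. g ^ ndist i l) + (\<Sum>l=Suc i..<max m (Suc i). g ^ ndist i l)"
    by (rule sum.union_disjoint) auto
  also have "(\<Sum>l\<le>i. g ^ ndist i l) = (\<Sum>d\<le>i. g ^ d)"
    by (rule sum.reindex_bij_witness[where i = "\<lambda>d. i - d" and j = "\<lambda>l. i - l"]) (auto simp: ndist_ge)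
  also have "(\<Sum>d\<le>i. g ^ d) \<le> 1 / (1 - g)"
    using assms sum_le_suminf[of "\<lambda>d. g ^ d" "{..i}"] by (simp add: suminf_geometric summable_geometric)
  also have "(\<Sum>l=Suc i..<max m (Suc i). g ^ ndist i l) = (\<Sum>d\<in>{1..<max m (Suc i) - i}. g ^ d)"
    by (rule sum.reindex_bij_witness[where i = "\<lambda>d. d + i" and j = "\<lambda>l. l - i"]) (auto simp: ndist_le)
  also have "\<dots> \<le> 1 / (1 - g)"
    using assms sum_le_suminf[of "\<lambda>d. g ^ d" "{1..<max m (Suc i) - i}"] by (simp add: suminf_geometric summable_geometric)
  finally show ?thesis by simp
qed

text \<open>From 2 v i v l <= (v i)^2 + (v l)^2 the double sum reduces to row sums, the two halves
  being equal by symmetry of the kernel.\<close>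

lemma symmetric_kernel_bound:
  fixes G :: "nat \<Rightarrow> nat \<Rightarrow> real"
  assumes G: "\<And>i l. 0 \<le> G i l" "\<And>i l. G i l = G l i" and C: "\<And>i. (\<Sum>l<m. G i l) \<le> C"
  shows "(\<Sum>i<m. \<Sum>l<m. v i * v l * G i l) \<le> C * (\<Sum>i<m. (v i)\<^sup>2)"
proof -
  have "v i * v l * G i l \<le> (v i)\<^sup>2 * G i l / 2 + (v l)\<^sup>2 * G i l / 2" for i l
  proof -
    have "v i * v l \<le> ((v i)\<^sup>2 + (v l)\<^sup>2) / 2" using sum_squares_bound[of "v i" "v l"] by simp
    from mult_right_mono[OF this G(1)] show ?thesis by (simp add: algebra_simps add_divide_distrib)
  qed
  then have "(\<Sum>i<m. \<Sum>l<m. v i * v l * G i l) \<le> (\<Sum>i<m. \<Sum>l<m. (v i)\<^sup>2 * G i l / 2 + (v l)\<^sup>2 * G i l / 2)"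
    by (intro sum_mono)
  also have "\<dots> = (\<Sum>i<m. \<Sum>l<m. (v i)\<^sup>2 * G i l / 2) + (\<Sum>i<m. \<Sum>l<m. (v l)\<^sup>2 * G i l / 2)"
    by (simp only: sum.distrib)
  also have "(\<Sum>i<m. \<Sum>l<m. (v l)\<^sup>2 * G i l / 2) = (\<Sum>i<m. \<Sum>l<m. (v i)\<^sup>2 * G i l / 2)"
    by (subst sum.swap) (intro sum.cong refl, metis G(2))
  also have "(\<Sum>i<m. \<Sum>l<m. (v i)\<^sup>2 * G i l / 2) + (\<Sum>i<m. \<Sum>l<m. (v i)\<^sup>2 * G i l / 2) = (\<Sum>i<m. (v i)\<^sup>2 * (\<Sum>l<m. G i l))"
    unfolding sum_distrib_left sum.distrib[symmetric] by (intro sum.cong refl) simp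
  also have "\<dots> \<le> (\<Sum>i<m. (v i)\<^sup>2 * C)" by (intro sum_mono mult_left_mono C) auto
  finally show ?thesis by (simp add: sum_distrib_left mult.commute)
qed

lemma sum_swap_pairs:
  fixes h :: "'a \<Rightarrow> 'a \<Rightarrow> 'a \<Rightarrow> 'a \<Rightarrow> real"
  shows "(\<Sum>i\<in>A. \<Sum>k\<in>A. \<Sum>l\<in>A. \<Sum>r\<in>A. h l r i k) = (\<Sum>i\<in>A. \<Sum>k\<in>A. \<Sum>l\<in>A. \<Sum>r\<in>A. h i k l r)"
proof -
  have pair: "(\<Sum>i\<in>A. \<Sum>k\<in>A. g i k) = (\<Sum>z\<in>A \<times> A. g (fst z) (snd z))" for g :: "'a \<Rightarrow> 'a \<Rightarrow> real"
    by (simp only: sum.cartesian_product case_prod_unfold)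
  show ?thesis unfolding pair by (rule sum.swap)
qed

text \<open>The estimate behind the variance bound for quadratic forms: in both Wick pairings that link the
  two factors, the product kernel acts as a bounded operator on matrices.\<close>

lemma four_index_kernel_bound:
  fixes G b :: "nat \<Rightarrow> nat \<Rightarrow> real"
  assumes G: "\<And>i l. 0 \<le> G i l" "\<And>i l. G i l = G l i" and C: "\<And>i. (\<Sum>l<m. G i l) \<le> C"
  shows "(\<Sum>i<m. \<Sum>k<m. \<Sum>l<m. \<Sum>r<m. \<bar>b i k\<bar> * \<bar>b l r\<bar> * (G i l * G k r + G i r * G k l)) \<le> 2 * C\<^sup>2 * (\<Sum>i<m. \<Sum>k<m. (b i k)\<^sup>2)"
proof -
  let ?S = "\<Sum>i<m. \<Sum>k<m. (b i k)\<^sup>2"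
  have C0: "C \<ge> 0" using order_trans[OF sum_nonneg C] G(1) by force
  have pt: "\<bar>b i k\<bar> * \<bar>b l r\<bar> * (G i l * G k r + G i r * G k l) \<le>
      ((b i k)\<^sup>2 / 2) * (G i l * G k r + G i r * G k l) + ((b l r)\<^sup>2 / 2) * (G l i * G r k + G l k * G r i)" for i k l r
  proof -
    have "\<bar>b i k\<bar> * \<bar>b l r\<bar> \<le> (b i k)\<^sup>2 / 2 + (b l r)\<^sup>2 / 2" using sum_squares_bound[of "\<bar>b i k\<bar>" "\<bar>b l r\<bar>"] by simp
    then have "\<bar>b i k\<bar> * \<bar>b l r\<bar> * (G i l * G k r + G i r * G k l) \<le> ((b i k)\<^sup>2 / 2 + (b l r)\<^sup>2 / 2) * (G i l * G k r + G i r * G k l)"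
      by (intro mult_right_mono) (auto simp: G(1))
    also have "\<dots> = ((b i k)\<^sup>2 / 2) * (G i l * G k r + G i r * G k l) + ((b l r)\<^sup>2 / 2) * (G l i * G r k + G l k * G r i)"
      by (simp add: G(2)[of l i] G(2)[of r k] G(2)[of l k] G(2)[of r i] algebra_simps)
    finally show ?thesis .
  qed
  have inner: "(\<Sum>l<m. \<Sum>r<m. G i l * G k r + G i r * G k l) \<le> 2 * C\<^sup>2" for i k
  proof -
    have "(\<Sum>l<m. \<Sum>r<m. G i l * G k r + G i r * G k l) = 2 * ((\<Sum>l<m. G i l) * (\<Sum>r<m. G k r))"
      by (simp add: sum.distrib sum_product[symmetric] mult.commute sum_distrib_left[symmetric] sum_distrib_right[symmetric])
    also have "\<dots> \<le> 2 * (C * C)" by (intro mult_left_mono mult_mono C C0 sum_nonneg G) auto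
    finally show ?thesis by (simp add: power2_eq_square)
  qed
  let ?h = "\<lambda>i k l r. ((b i k)\<^sup>2 / 2) * (G i l * G k r + G i r * G k l)"
  have "(\<Sum>i<m. \<Sum>k<m. \<Sum>l<m. \<Sum>r<m. \<bar>b i k\<bar> * \<bar>b l r\<bar> * (G i l * G k r + G i r * G k l))
     \<le> (\<Sum>i<m. \<Sum>k<m. \<Sum>l<m. \<Sum>r<m. ?h i k l r + ?h l r i k)"
    by (intro sum_mono pt)
  also have "\<dots> = (\<Sum>i<m. \<Sum>k<m. \<Sum>l<m. \<Sum>r<m. ?h i k l r) + (\<Sum>i<m. \<Sum>k<m. \<Sum>l<m. \<Sum>r<m. ?h l r i k)"
    by (simp only: sum.distrib)
  also have "(\<Sum>i<m. \<Sum>k<m. \<Sum>l<m. \<Sum>r<m. ?h l r i k) = (\<Sum>i<m. \<Sum>k<m. \<Sum>l<m. \<Sum>r<m. ?h i k l r)"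
    by (rule sum_swap_pairs)
  also have "(\<Sum>i<m. \<Sum>k<m. \<Sum>l<m. \<Sum>r<m. ?h i k l r) + (\<Sum>i<m. \<Sum>k<m. \<Sum>l<m. \<Sum>r<m. ?h i k l r)
      = (\<Sum>i<m. \<Sum>k<m. (b i k)\<^sup>2 * (\<Sum>l<m. \<Sum>r<m. G i l * G k r + G i r * G k l))"
    unfolding sum_distrib_left sum.distrib[symmetric] by (intro sum.cong refl) (simp add: field_simps)
  also have "\<dots> \<le> (\<Sum>i<m. \<Sum>k<m. (b i k)\<^sup>2 * (2 * C\<^sup>2))"
    by (intro sum_mono mult_left_mono inner) auto
  finally show ?thesis by (simp add: sum_distrib_left mult_ac)
qed

section \<open>Quadratic forms in weakly dependent columns\<close>

text \<open>Instantiated with Borel measurability on the space of columns as well as with finiteness of all moments.\<close>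

definition closed_ring :: "(('z \<Rightarrow> real) \<Rightarrow> bool) \<Rightarrow> bool" where
  "closed_ring cl \<longleftrightarrow> (\<forall>c. cl (\<lambda>_. c)) \<and> (\<forall>f g. cl f \<longrightarrow> cl g \<longrightarrow> cl (\<lambda>z. f z + g z)) \<and>
    (\<forall>f g. cl f \<longrightarrow> cl g \<longrightarrow> cl (\<lambda>z. f z * g z))"

lemma closed_ringD:
  assumes "closed_ring cl"
  shows "cl (\<lambda>_. c)" "cl f \<Longrightarrow> cl g \<Longrightarrow> cl (\<lambda>z. f z + g z)" "cl f \<Longrightarrow> cl g \<Longrightarrow> cl (\<lambda>z. f z * g z)"
  using assms by (simp_all add: closed_ring_def)

lemma closed_ring_sum:
  assumes "closed_ring cl" "\<And>x. x \<in> A \<Longrightarrow> cl (f x)"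
  shows "cl (\<lambda>z. \<Sum>x\<in>A. f x z)"
proof (cases "finite A")
  case True
  then show ?thesis using assms(2)
    by (induction A rule: finite_induct) (auto intro: closed_ringD[OF assms(1)])
qed (use closed_ringD(1)[OF assms(1)] in auto)

lemma closed_ring_prod:
  assumes "closed_ring cl" "\<And>x. x \<in> A \<Longrightarrow> cl (f x)"
  shows "cl (\<lambda>z. \<Prod>x\<in>A. f x z)"
proof (cases "finite A")
  case True
  then show ?thesis using assms(2)
    by (induction A rule: finite_induct) (auto intro: closed_ringD[OF assms(1)])
qed (use closed_ringD(1)[OF assms(1)] in auto)

lemma closed_ring_diff:
  assumes "closed_ring cl" "cl f" "cl g"
  shows "cl (\<lambda>z. f z - g z)"
proof -
  note R = closed_ringD[OF assms(1)]
  have "cl (\<lambda>z. (- 1) * g z)" by (intro R(3) R(1) assms(3))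
  then have "cl (\<lambda>z. f z + (- 1) * g z)" by (rule R(2)[OF assms(2)])
  then show ?thesis by simp
qed

lemma closed_ring_ip:
  assumes "closed_ring cl" "\<And>i. cl (\<lambda>z. F z i)" "\<And>i. cl (\<lambda>z. F' z i)"
  shows "cl (\<lambda>z. ip m (F z) (F' z))"
  unfolding ip_def
proof (rule closed_ring_sum[OF assms(1)])
  note R = closed_ringD[OF assms(1)]
  fix i show "cl (\<lambda>z. F z i * F' z i)" by (rule R(3)[OF assms(2,3)])
qed

lemma closed_ring_gram_op:
  assumes cl: "closed_ring cl" and Y: "\<And>j i. j \<in> J \<Longrightarrow> cl (\<lambda>z. Y z j i)" and F: "\<And>i. cl (\<lambda>z. F z i)"
  shows "cl (\<lambda>z. (gram_op m s (Y z) J ^^ q) (F z) i)"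
proof (induction q arbitrary: i)
  case (Suc q)
  show ?case
    unfolding funpow.simps o_def gram_op_def[of _ _ _ _ "_ _"]
    by (intro closed_ring_sum[OF cl] closed_ringD(3)[OF cl] closed_ringD(1)[OF cl] closed_ring_ip[OF cl] Y Suc)
qed (simp add: F)

lemma closed_ring_kernel_op:
  assumes cl: "closed_ring cl" and F: "\<And>i. cl (\<lambda>z. F z i)"
  shows "cl (\<lambda>z. (kernel_op m t ^^ q) (F z) i)"
proof (induction q arbitrary: i)
  case (Suc q)
  show ?case
    unfolding funpow.simps o_def kernel_op_def[of _ _ "_ _"]
    by (intro closed_ring_sum[OF cl] closed_ringD(3)[OF cl] closed_ringD(1)[OF cl] Suc)
qed (simp add: F)

lemma closed_ring_op_trace:
  assumes cl: "closed_ring cl" and Y: "\<And>j i. j \<in> J \<Longrightarrow> cl (\<lambda>z. Y z j i)"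
  shows "cl (\<lambda>z. op_trace m (\<lambda>f. (gram_op m s (Y z) J ^^ q) ((kernel_op m t ^^ p) f)))"
  unfolding op_trace_def
proof (rule closed_ring_sum[OF cl])
  fix i show "cl (\<lambda>z. (gram_op m s (Y z) J ^^ q) ((kernel_op m t ^^ p) (unit_fun i)) i)"
    by (rule closed_ring_gram_op[OF cl]) (erule Y, rule closed_ringD(1)[OF cl])
qed

lemma gram_op_cong:
  assumes "\<And>j. j \<in> J \<Longrightarrow> Y j = Y' j"
  shows "gram_op m s Y J = gram_op m s Y' J"
proof (intro ext)
  fix f i show "gram_op m s Y J f i = gram_op m s Y' J f i"
    unfolding gram_op_def by (rule sum.cong[OF refl]) (simp only: assms)
qed

lemma closed_ring_borel_measurable: "closed_ring (\<lambda>f. f \<in> borel_measurable N)"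
  by (simp add: closed_ring_def)

section \<open>Random variables with finite moments of every order\<close>

definition all_moments :: "'w measure \<Rightarrow> ('w \<Rightarrow> real) \<Rightarrow> bool" where
  "all_moments M Z \<longleftrightarrow> Z \<in> borel_measurable M \<and> (\<forall>k. integrable M (\<lambda>\<omega>. Z \<omega> ^ k))"

lemma all_momentsD:
  assumes "all_moments M Z"
  shows "Z \<in> borel_measurable M" "integrable M Z" "integrable M (\<lambda>\<omega>. Z \<omega> ^ k)" "integrable M (\<lambda>\<omega>. \<bar>Z \<omega>\<bar> ^ k)"
proof -
  show "Z \<in> borel_measurable M" and k: "integrable M (\<lambda>\<omega>. Z \<omega> ^ k)" for k
    using assms by (simp_all add: all_moments_def)
  show "integrable M Z" using k[of 1] by simp
  show "integrable M (\<lambda>\<omega>. \<bar>Z \<omega>\<bar> ^ k)" using integrable_abs[OF k, of k] by (simp add: power_abs)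
qed

lemma closed_ring_all_moments:
  assumes "prob_space M"
  shows "closed_ring (all_moments M)"
  unfolding closed_ring_def
proof (intro conjI allI impI)
  interpret prob_space M by fact
  fix c show "all_moments M (\<lambda>_. c)" by (simp add: all_moments_def)
next
  fix f g assume f: "all_moments M f" and g: "all_moments M g"
  note [measurable] = all_momentsD(1)[OF f] all_momentsD(1)[OF g]
  show "all_moments M (\<lambda>z. f z + g z)"
    unfolding all_moments_def
  proof (intro conjI allI)
    fix k
    show "integrable M (\<lambda>\<omega>. (f \<omega> + g \<omega>) ^ k)"
    proof (rule Bochner_Integration.integrable_bound)
      show "integrable M (\<lambda>\<omega>. 2 ^ k * (\<bar>f \<omega>\<bar> ^ k + \<bar>g \<omega>\<bar> ^ k))"
        using all_momentsD(4)[OF f] all_momentsD(4)[OF g] by auto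
      show "AE \<omega> in M. norm ((f \<omega> + g \<omega>) ^ k) \<le> norm (2 ^ k * (\<bar>f \<omega>\<bar> ^ k + \<bar>g \<omega>\<bar> ^ k))"
      proof (rule AE_I2)
        fix \<omega>
        have "\<bar>f \<omega> + g \<omega>\<bar> ^ k \<le> (2 * max \<bar>f \<omega>\<bar> \<bar>g \<omega>\<bar>) ^ k" by (intro power_mono) auto
        also have "\<dots> = 2 ^ k * max \<bar>f \<omega>\<bar> \<bar>g \<omega>\<bar> ^ k" by (rule power_mult_distrib)
        also have "\<dots> \<le> 2 ^ k * (\<bar>f \<omega>\<bar> ^ k + \<bar>g \<omega>\<bar> ^ k)"
          by (intro mult_left_mono) (auto simp: max_def)
        finally show "norm ((f \<omega> + g \<omega>) ^ k) \<le> norm (2 ^ k * (\<bar>f \<omega>\<bar> ^ k + \<bar>g \<omega>\<bar> ^ k))"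
          by (simp add: power_abs abs_mult)
      qed
    qed measurable
  qed measurable
  show "all_moments M (\<lambda>z. f z * g z)"
    unfolding all_moments_def
  proof (intro conjI allI)
    fix k
    show "integrable M (\<lambda>\<omega>. (f \<omega> * g \<omega>) ^ k)"
    proof (rule Bochner_Integration.integrable_bound)
      show "integrable M (\<lambda>\<omega>. f \<omega> ^ (2 * k) + g \<omega> ^ (2 * k))"
        using all_momentsD(3)[OF f] all_momentsD(3)[OF g] by auto
      show "AE \<omega> in M. norm ((f \<omega> * g \<omega>) ^ k) \<le> norm (f \<omega> ^ (2 * k) + g \<omega> ^ (2 * k))"
      proof (rule AE_I2)
        fix \<omega>
        have sq: "x ^ (2 * k) = (x ^ k)\<^sup>2" for x :: real by (simp add: power_mult[symmetric] mult.commute)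
        have "2 * \<bar>f \<omega> ^ k * g \<omega> ^ k\<bar> \<le> (f \<omega> ^ k)\<^sup>2 + (g \<omega> ^ k)\<^sup>2"
          using sum_squares_bound[of "\<bar>f \<omega> ^ k\<bar>" "\<bar>g \<omega> ^ k\<bar>"] by (simp add: abs_mult)
        then show "norm ((f \<omega> * g \<omega>) ^ k) \<le> norm (f \<omega> ^ (2 * k) + g \<omega> ^ (2 * k))"
          unfolding sq power_mult_distrib real_norm_def by simp
      qed
    qed measurable
  qed measurable
qed

lemma integral_sum4:
  fixes f :: "'i \<Rightarrow> 'i \<Rightarrow> 'i \<Rightarrow> 'i \<Rightarrow> 'w \<Rightarrow> real"
  assumes "\<And>i k l r. integrable M (f i k l r)"
  shows "(\<integral>\<omega>. (\<Sum>i\<in>A. \<Sum>k\<in>A. \<Sum>l\<in>A. \<Sum>r\<in>A. f i k l r \<omega>) \<partial>M)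
    = (\<Sum>i\<in>A. \<Sum>k\<in>A. \<Sum>l\<in>A. \<Sum>r\<in>A. \<integral>\<omega>. f i k l r \<omega> \<partial>M)"
proof -
  have 1: "integrable M (\<lambda>\<omega>. \<Sum>r\<in>A. f i k l r \<omega>)" for i k l
    by (rule Bochner_Integration.integrable_sum) (rule assms)
  have 2: "integrable M (\<lambda>\<omega>. \<Sum>l\<in>A. \<Sum>r\<in>A. f i k l r \<omega>)" for i k
    by (rule Bochner_Integration.integrable_sum) (rule 1)
  have 3: "integrable M (\<lambda>\<omega>. \<Sum>k\<in>A. \<Sum>l\<in>A. \<Sum>r\<in>A. f i k l r \<omega>)" for i
    by (rule Bochner_Integration.integrable_sum) (rule 2)
  show ?thesis
    by (simp only: Bochner_Integration.integral_sum 1 2 3 assms)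
qed

text \<open>The moment conditions in a form free of any ordering of the indices and uniform over the
  columns j. The two products in \<open>fourth\<close> are the pairings that link (i, k) with (l,
  r); the sum over all permutations in \<open>even_moments\<close> contains the one that sorts the
  tuple.\<close>

locale covariance_decay = prob_space M for M :: "'w measure" +
  fixes a :: "nat \<Rightarrow> nat \<Rightarrow> 'w \<Rightarrow> real" and t :: "nat \<Rightarrow> nat \<Rightarrow> real"
    and g K :: real and c :: "nat \<Rightarrow> real"
  assumes am: "\<And>i j. all_moments M (a i j)"
    and indep: "indep_vars (\<lambda>j. Pi\<^sub>M UNIV (\<lambda>i. borel)) (\<lambda>j \<omega>. \<lambda>i. a i j \<omega>) UNIV"
    and g: "0 \<le> g" "g < 1" and K: "0 \<le> K" and c: "\<And>r. 0 \<le> c r"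
    and t_sym: "\<And>i l. t i l = t l i" and t_le: "\<And>i l. \<bar>t i l\<bar> \<le> K * g ^ ndist i l"
    and second: "\<And>i l j. expectation (\<lambda>\<omega>. a i j \<omega> * a l j \<omega>) = t i l"
    and fourth: "\<And>i k l r j. \<bar>expectation (\<lambda>\<omega>. a i j \<omega> * a k j \<omega> * (a l j \<omega> * a r j \<omega>)) - t i k * t l r\<bar>
        \<le> K * (g ^ ndist i l * g ^ ndist k r + g ^ ndist i r * g ^ ndist k l)"
    and even_moments: "\<And>r ix j. \<bar>expectation (\<lambda>\<omega>. \<Prod>p=1..2*r. a (ix p) j \<omega>)\<bar>
        \<le> c r * (\<Sum>\<sigma> | \<sigma> permutes {1..2*r}. \<Prod>l=1..r. g ^ ndist (ix (\<sigma> (2 * l - 1))) (ix (\<sigma> (2 * l))))"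
begin

abbreviation X :: "'w \<Rightarrow> nat \<Rightarrow> nat \<Rightarrow> real" where
  "X \<omega> \<equiv> (\<lambda>j i. a i j \<omega>)"

lemmas am_ring = closed_ring_all_moments[OF prob_space_axioms]

definition C_g :: real where "C_g = 2 / (1 - g)"

lemma C_g: "(\<Sum>l<m. g ^ ndist i l) \<le> C_g" "0 \<le> C_g"
  using sum_power_ndist_le[OF g] g by (simp_all add: C_g_def)

lemma g_nonneg: "0 \<le> g ^ n"
  using g by simp

lemma t_row_le: "(\<Sum>l<m. \<bar>t i l\<bar>) \<le> K * C_g"
proof -
  have "(\<Sum>l<m. \<bar>t i l\<bar>) \<le> K * (\<Sum>l<m. g ^ ndist i l)"
    unfolding sum_distrib_left by (intro sum_mono t_le)
  also have "\<dots> \<le> K * C_g" by (intro mult_left_mono C_g K)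
  finally show ?thesis .
qed

text \<open>Positivity gives |P_il| <= v_i v_l with v_i the root of the diagonal entry, so after
  expanding the r-th power the operator enters only through a product weight. The pairing bound
  leaves the r-th power of sum v_i v_l g^|i-l|, which is at most C_g times sum v_i^2, that is, C_g
  times the trace.\<close>

lemma quadratic_form_moment:
  assumes P: "linear_op m P" "sym_op m P" and psd: "\<And>f. 0 \<le> ip m f (P f)"
  shows "expectation (\<lambda>\<omega>. ip m (X \<omega> j) (P (X \<omega> j)) ^ r) \<le> c r * fact (2 * r) * C_g ^ r * op_trace m P ^ r"
proof -
  \<comment> \<open>The value 0 beyond m makes \<open>v\<close> nonnegative everywhere, as the
    pairing bound requires.\<close>
  define v where "v = (\<lambda>i. if i < m then sqrt (P (unit_fun i) i) else 0)"
  have diag: "0 \<le> P (unit_fun i) i" if "i < m" for i using psd_entry_le(2)[OF P psd that that] .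
  have v: "0 \<le> v i" for i using diag by (simp add: v_def)
  have entry: "\<bar>P (unit_fun l) i\<bar> \<le> v i * v l" if "i < m" "l < m" for i l
    using psd_entry_le(1)[OF P psd that] that by (simp add: v_def)
  let ?I = "{1..2*r} \<rightarrow>\<^sub>E {..<m}"
  let ?E = "\<lambda>ix. expectation (\<lambda>\<omega>. \<Prod>p=1..2*r. a (ix p) j \<omega>)"
  let ?B = "\<lambda>ix. \<Prod>l=1..r. P (unit_fun (ix (2 * l))) (ix (2 * l - 1))"
  have am_prod: "all_moments M (\<lambda>\<omega>. \<Prod>p=1..2*r. a (ix p) j \<omega>)" for ix
    by (intro closed_ring_prod[OF am_ring] am)
  have expand: "ip m (X \<omega> j) (P (X \<omega> j)) ^ r = (\<Sum>ix\<in>?I. ?B ix * (\<Prod>p=1..2*r. a (ix p) j \<omega>))" for \<omega>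
  proof -
    have "ip m (X \<omega> j) (P (X \<omega> j)) ^ r = (\<Sum>ix\<in>?I. \<Prod>l=1..r. a (ix (2*l-1)) j \<omega> * a (ix (2*l)) j \<omega> * P (unit_fun (ix (2 * l))) (ix (2 * l - 1)))"
      unfolding ip_linear_op[OF P(1)]
      by (rule sum_PiE_pairs[symmetric, of "\<lambda>i l. a i j \<omega> * a l j \<omega> * P (unit_fun l) i"])
    also have "\<dots> = (\<Sum>ix\<in>?I. ?B ix * (\<Prod>p=1..2*r. a (ix p) j \<omega>))"
      unfolding prod_pairs[of "\<lambda>p. a (_ p) j \<omega>"] prod.distrib by (simp only: mult.commute)
    finally show ?thesis .
  qed
  have "expectation (\<lambda>\<omega>. ip m (X \<omega> j) (P (X \<omega> j)) ^ r) = (\<Sum>ix\<in>?I. ?B ix * ?E ix)"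
    unfolding expand using all_momentsD(2)[OF am_prod] by (subst Bochner_Integration.integral_sum) auto
  also have "\<dots> \<le> (\<Sum>ix\<in>?I. (\<Prod>p=1..2*r. v (ix p)) * \<bar>?E ix\<bar>)"
  proof (intro sum_mono)
    fix ix assume ix: "ix \<in> ?I"
    have lt: "ix (2 * l - 1) < m" "ix (2 * l) < m" if "l \<in> {1..r}" for l
    proof -
      have "2 * l - 1 \<in> {1..2*r}" "2 * l \<in> {1..2*r}" using that by auto
      then show "ix (2 * l - 1) < m" "ix (2 * l) < m" using ix by (blast dest: PiE_mem)+
    qed
    have "\<bar>?B ix\<bar> = (\<Prod>l=1..r. \<bar>P (unit_fun (ix (2 * l))) (ix (2 * l - 1))\<bar>)" by (rule abs_prod)
    also have "\<dots> \<le> (\<Prod>l=1..r. v (ix (2 * l - 1)) * v (ix (2 * l)))"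
      by (intro prod_mono conjI abs_ge_zero entry lt)
    also have "\<dots> = (\<Prod>p=1..2*r. v (ix p))" by (rule prod_pairs[of "\<lambda>p. v (ix p)", symmetric])
    finally have "\<bar>?B ix\<bar> * \<bar>?E ix\<bar> \<le> (\<Prod>p=1..2*r. v (ix p)) * \<bar>?E ix\<bar>"
      by (rule mult_right_mono[OF _ abs_ge_zero])
    moreover have "?B ix * ?E ix \<le> \<bar>?B ix\<bar> * \<bar>?E ix\<bar>"
      unfolding abs_mult[symmetric] by (rule abs_ge_self)
    ultimately show "?B ix * ?E ix \<le> (\<Prod>p=1..2*r. v (ix p)) * \<bar>?E ix\<bar>"
      by (rule order.trans[rotated])
  qed
  also have "\<dots> \<le> c r * fact (2 * r) * (\<Sum>i<m. \<Sum>l<m. v i * v l * g ^ ndist i l) ^ r"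
    by (rule sum_PiE_pairing_bound[OF v even_moments])
  also have "\<dots> \<le> c r * fact (2 * r) * (C_g * (\<Sum>i<m. (v i)\<^sup>2)) ^ r"
  proof (intro mult_left_mono power_mono)
    show "(\<Sum>i<m. \<Sum>l<m. v i * v l * g ^ ndist i l) \<le> C_g * (\<Sum>i<m. (v i)\<^sup>2)"
      by (rule symmetric_kernel_bound) (auto simp: g_nonneg C_g ndist_commute)
    show "0 \<le> (\<Sum>i<m. \<Sum>l<m. v i * v l * g ^ ndist i l)"
      by (intro sum_nonneg mult_nonneg_nonneg v g_nonneg)
    show "0 \<le> c r * fact (2 * r)" using c by simp
  qed
  also have "(\<Sum>i<m. (v i)\<^sup>2) = op_trace m P"
    unfolding op_trace_def by (rule sum.cong) (auto simp: v_def diag)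
  finally show ?thesis by (simp add: power_mult_distrib mult_ac)
qed

text \<open>The centred products \<open>d\<close> have covariances dominated by a kernel that links
  the two index pairs, and such a kernel acts boundedly on matrices. The variance is thus measured
  by the Hilbert-Schmidt norm and not by a squared trace, which is why it becomes negligible after
  division by n^2.\<close>

lemma quadratic_form_variance:
  assumes P: "linear_op m P"
  shows "expectation (\<lambda>\<omega>. (ip m (X \<omega> j) (P (X \<omega> j)) - op_trace m (\<lambda>f. P (kernel_op m t f)))\<^sup>2) \<le> K * (2 * C_g\<^sup>2) * hs_norm_sq m P"
proof -
  define b where "b = (\<lambda>i l. P (unit_fun l) i)"
  define d where "d = (\<lambda>\<omega> i l. a i j \<omega> * a l j \<omega> - t i l)"
  have am_d: "all_moments M (\<lambda>\<omega>. d \<omega> i l)" for i l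
    unfolding d_def by (intro closed_ring_diff[OF am_ring] closed_ringD[OF am_ring] am)
  have Ed: "expectation (\<lambda>\<omega>. d \<omega> i k * d \<omega> l r) = expectation (\<lambda>\<omega>. a i j \<omega> * a k j \<omega> * (a l j \<omega> * a r j \<omega>)) - t i k * t l r" for i k l r
  proof -
    have am2: "all_moments M (\<lambda>\<omega>. a i j \<omega> * a k j \<omega>)" for i k by (intro closed_ringD[OF am_ring] am)
    have am4: "all_moments M (\<lambda>\<omega>. a i j \<omega> * a k j \<omega> * (a l j \<omega> * a r j \<omega>))" by (intro closed_ringD[OF am_ring] am)
    have "d \<omega> i k * d \<omega> l r = a i j \<omega> * a k j \<omega> * (a l j \<omega> * a r j \<omega>) - t l r * (a i j \<omega> * a k j \<omega>) - t i k * (a l j \<omega> * a r j \<omega>) + t i k * t l r" for \<omega>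
      by (simp add: d_def algebra_simps)
    then show ?thesis
      using all_momentsD(2)[OF am2] all_momentsD(2)[OF am4] by (simp add: second prob_space mult.commute)
  qed
  have expand: "ip m (X \<omega> j) (P (X \<omega> j)) - op_trace m (\<lambda>f. P (kernel_op m t f)) = (\<Sum>i<m. \<Sum>k<m. b i k * d \<omega> i k)" for \<omega>
    unfolding ip_linear_op[OF P] op_trace_kernel_op[OF P] sum_subtractf[symmetric]
    by (intro sum.cong refl) (simp only: b_def d_def, subst t_sym, simp add: algebra_simps)
  have sq: "(\<Sum>i<m. \<Sum>k<m. b i k * d \<omega> i k)\<^sup>2 = (\<Sum>i<m. \<Sum>k<m. \<Sum>l<m. \<Sum>r<m. b i k * b l r * (d \<omega> i k * d \<omega> l r))" for \<omega>
    unfolding power2_eq_square sum_distrib_right unfolding sum_distrib_left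
    by (intro sum.cong refl) (simp only: mult_ac)
  have int: "integrable M (\<lambda>\<omega>. b i k * b l r * (d \<omega> i k * d \<omega> l r))" for i k l r
  proof -
    have "all_moments M (\<lambda>\<omega>. b i k * b l r * (d \<omega> i k * d \<omega> l r))"
      by (intro closed_ringD[OF am_ring] am_d)
    then show ?thesis by (rule all_momentsD(2))
  qed
  have "expectation (\<lambda>\<omega>. (ip m (X \<omega> j) (P (X \<omega> j)) - op_trace m (\<lambda>f. P (kernel_op m t f)))\<^sup>2)
    = (\<Sum>i<m. \<Sum>k<m. \<Sum>l<m. \<Sum>r<m. b i k * b l r * expectation (\<lambda>\<omega>. d \<omega> i k * d \<omega> l r))"
    unfolding expand sq by (subst integral_sum4[OF int]) simp
  also have "\<dots> \<le> (\<Sum>i<m. \<Sum>k<m. \<Sum>l<m. \<Sum>r<m. K * (\<bar>b i k\<bar> * \<bar>b l r\<bar> * (g ^ ndist i l * g ^ ndist k r + g ^ ndist i r * g ^ ndist k l)))"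
  proof (rule sum_mono)+
    fix i k l r
    have "b i k * b l r * expectation (\<lambda>\<omega>. d \<omega> i k * d \<omega> l r) \<le> \<bar>b i k * b l r\<bar> * \<bar>expectation (\<lambda>\<omega>. d \<omega> i k * d \<omega> l r)\<bar>"
      unfolding abs_mult[symmetric] by (rule abs_ge_self)
    also have "\<dots> \<le> \<bar>b i k * b l r\<bar> * (K * (g ^ ndist i l * g ^ ndist k r + g ^ ndist i r * g ^ ndist k l))"
      unfolding Ed by (intro mult_left_mono fourth) simp
    finally show "b i k * b l r * expectation (\<lambda>\<omega>. d \<omega> i k * d \<omega> l r) \<le> K * (\<bar>b i k\<bar> * \<bar>b l r\<bar> * (g ^ ndist i l * g ^ ndist k r + g ^ ndist i r * g ^ ndist k l))"
      by (simp add: abs_mult mult_ac)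
  qed
  also have "\<dots> = K * (\<Sum>i<m. \<Sum>k<m. \<Sum>l<m. \<Sum>r<m. \<bar>b i k\<bar> * \<bar>b l r\<bar> * (g ^ ndist i l * g ^ ndist k r + g ^ ndist i r * g ^ ndist k l))"
    by (simp only: sum_distrib_left)
  also have "\<dots> \<le> K * (2 * C_g\<^sup>2 * (\<Sum>i<m. \<Sum>k<m. (b i k)\<^sup>2))"
    by (intro mult_left_mono K four_index_kernel_bound) (auto simp: g_nonneg C_g ndist_commute)
  finally show ?thesis by (simp add: hs_norm_sq_def b_def mult.assoc)
qed

text \<open>Tonelli in place of conditional expectations: column j and the columns in J have a
  product law, so the inequality may be checked with Y frozen. The conditions on
  \<open>restrict\<close> say that only the columns in J matter, and nonnegativity spares
  integrability on the product space.\<close>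

lemma column_conditional_bound:
  fixes \<Phi> :: "(nat \<Rightarrow> real) \<Rightarrow> (nat \<Rightarrow> nat \<Rightarrow> real) \<Rightarrow> real" and \<Psi> :: "(nat \<Rightarrow> nat \<Rightarrow> real) \<Rightarrow> real"
  defines "B \<equiv> Pi\<^sub>M UNIV (\<lambda>i::nat. borel :: real measure)"
  assumes j: "j \<notin> J"
    and \<Phi> [measurable]: "(\<lambda>z. \<Phi> (fst z) (snd z)) \<in> borel_measurable (B \<Otimes>\<^sub>M Pi\<^sub>M J (\<lambda>_. B))"
    and \<Psi> [measurable]: "\<Psi> \<in> borel_measurable (Pi\<^sub>M J (\<lambda>_. B))"
    and nonneg: "\<And>x Y. 0 \<le> \<Phi> x Y" "\<And>Y. 0 \<le> \<Psi> Y"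
    and restr: "\<And>x Y. \<Phi> x (restrict Y J) = \<Phi> x Y" "\<And>Y. \<Psi> (restrict Y J) = \<Psi> Y"
    and int: "\<And>Y. integrable M (\<lambda>\<omega>. \<Phi> (X \<omega> j) Y)" "integrable M (\<lambda>\<omega>. \<Phi> (X \<omega> j) (X \<omega>))" "integrable M (\<lambda>\<omega>. \<Psi> (X \<omega>))"
    and le: "\<And>Y. expectation (\<lambda>\<omega>. \<Phi> (X \<omega> j) Y) \<le> \<Psi> Y"
  shows "expectation (\<lambda>\<omega>. \<Phi> (X \<omega> j) (X \<omega>)) \<le> expectation (\<lambda>\<omega>. \<Psi> (X \<omega>))"
proof -
  let ?S = "Pi\<^sub>M {j} (\<lambda>_. B)" and ?T = "Pi\<^sub>M J (\<lambda>_. B)"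
  let ?x = "\<lambda>\<omega>. restrict (X \<omega>) {j}" and ?Y = "\<lambda>\<omega>. restrict (X \<omega>) J"
  have "indep_var ?S ?x ?T ?Y"
    using indep_var_restrict[OF indep, of "{j}" J] j by (simp add: B_def)
  then have rv: "?x \<in> M \<rightarrow>\<^sub>M ?S" "?Y \<in> M \<rightarrow>\<^sub>M ?T"
    and eq: "distr M ?S ?x \<Otimes>\<^sub>M distr M ?T ?Y = distr M (?S \<Otimes>\<^sub>M ?T) (\<lambda>\<omega>. (?x \<omega>, ?Y \<omega>))"
    unfolding indep_var_distribution_eq by blast+
  note rv[measurable]
  interpret S: prob_space "distr M ?S ?x" by (rule prob_space_distr) fact
  interpret T: prob_space "distr M ?T ?Y" by (rule prob_space_distr) fact
  interpret ST: pair_sigma_finite "distr M ?S ?x" "distr M ?T ?Y" ..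
  let ?F = "\<lambda>z. ennreal (\<Phi> (fst z j) (snd z))"
  have [measurable]: "(\<lambda>z. \<Phi> (fst z j) (snd z)) \<in> borel_measurable (?S \<Otimes>\<^sub>M ?T)"
    using measurable_compose[of "\<lambda>z. (fst z j, snd z)" "?S \<Otimes>\<^sub>M ?T" "B \<Otimes>\<^sub>M ?T", OF _ \<Phi>] by simp
  have "ennreal (expectation (\<lambda>\<omega>. \<Phi> (X \<omega> j) (X \<omega>))) = (\<integral>\<^sup>+\<omega>. ?F (?x \<omega>, ?Y \<omega>) \<partial>M)"
    by (subst nn_integral_eq_integral[OF int(2), symmetric]) (auto simp: nonneg restr)
  also have "\<dots> = (\<integral>\<^sup>+z. ?F z \<partial>distr M (?S \<Otimes>\<^sub>M ?T) (\<lambda>\<omega>. (?x \<omega>, ?Y \<omega>)))"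
    by (subst nn_integral_distr) auto
  also have "\<dots> = (\<integral>\<^sup>+Y. \<integral>\<^sup>+x. ?F (x, Y) \<partial>distr M ?S ?x \<partial>distr M ?T ?Y)"
    unfolding eq[symmetric] by (rule ST.nn_integral_snd[symmetric]) simp
  also have "\<dots> \<le> (\<integral>\<^sup>+Y. ennreal (\<Psi> Y) \<partial>distr M ?T ?Y)"
  proof (rule nn_integral_mono)
    fix Y assume "Y \<in> space (distr M ?T ?Y)"
    then have Y: "Y \<in> space ?T" by simp
    have "(\<lambda>x. (x, Y)) \<in> ?S \<rightarrow>\<^sub>M ?S \<Otimes>\<^sub>M ?T" using Y by simp
    then have [measurable]: "(\<lambda>x. ennreal (\<Phi> (x j) Y)) \<in> borel_measurable ?S"
      using measurable_compose[of "\<lambda>x. (x, Y)" ?S "?S \<Otimes>\<^sub>M ?T" ?F borel] by simp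
    have "(\<integral>\<^sup>+x. ?F (x, Y) \<partial>distr M ?S ?x) = (\<integral>\<^sup>+\<omega>. ?F (?x \<omega>, Y) \<partial>M)"
      by (subst nn_integral_distr) auto
    also have "\<dots> = ennreal (expectation (\<lambda>\<omega>. \<Phi> (X \<omega> j) Y))"
      by (subst nn_integral_eq_integral[OF int(1), symmetric]) (auto simp: nonneg)
    also have "\<dots> \<le> ennreal (\<Psi> Y)" by (intro ennreal_leI le)
    finally show "(\<integral>\<^sup>+x. ?F (x, Y) \<partial>distr M ?S ?x) \<le> ennreal (\<Psi> Y)" .
  qed
  also have "\<dots> = (\<integral>\<^sup>+\<omega>. ennreal (\<Psi> (?Y \<omega>)) \<partial>M)" by (subst nn_integral_distr) auto
  also have "\<dots> = ennreal (expectation (\<lambda>\<omega>. \<Psi> (X \<omega>)))"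
    by (subst nn_integral_eq_integral[OF int(3), symmetric]) (auto simp: nonneg restr)
  finally show ?thesis by (simp add: nonneg)
qed

end

section \<open>Uniform moment bounds and convergence in L^2\<close>

definition (in prob_space) bounded_moments :: "'i set \<Rightarrow> ('i \<Rightarrow> 'a \<Rightarrow> real) \<Rightarrow> bool" where
  "bounded_moments I Z \<longleftrightarrow> (\<forall>i\<in>I. all_moments M (Z i)) \<and> (\<forall>r. \<exists>C. \<forall>i\<in>I. expectation (\<lambda>\<omega>. Z i \<omega> ^ (2 * r)) \<le> C)"

context prob_space
begin

lemma all_moments_ring: "closed_ring (all_moments M)"
  using prob_space_axioms by (rule closed_ring_all_moments)

lemma bounded_moments_dominated:
  assumes Y: "bounded_moments I Y" and Z: "\<And>i. i \<in> I \<Longrightarrow> all_moments M (Z i)"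
    and le: "\<And>i \<omega>. i \<in> I \<Longrightarrow> \<bar>Z i \<omega>\<bar> \<le> \<bar>Y i \<omega>\<bar>"
  shows "bounded_moments I Z"
  unfolding bounded_moments_def
proof (intro conjI ballI allI Z)
  fix r
  obtain C where C: "\<And>i. i \<in> I \<Longrightarrow> expectation (\<lambda>\<omega>. Y i \<omega> ^ (2 * r)) \<le> C"
    using Y unfolding bounded_moments_def by blast
  have "expectation (\<lambda>\<omega>. Z i \<omega> ^ (2 * r)) \<le> C" if i: "i \<in> I" for i
  proof (rule order_trans[OF integral_mono C[OF i]])
    show "integrable M (\<lambda>\<omega>. Z i \<omega> ^ (2 * r))" using Z[OF i] by (rule all_momentsD)
    show "integrable M (\<lambda>\<omega>. Y i \<omega> ^ (2 * r))"
      using Y i unfolding bounded_moments_def by (blast intro: all_momentsD)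
    show "Z i \<omega> ^ (2 * r) \<le> Y i \<omega> ^ (2 * r)" for \<omega>
      using power_mono[OF le[OF i, of \<omega>], of "2 * r"] by (simp add: power_even_abs)
  qed
  then show "\<exists>C. \<forall>i\<in>I. expectation (\<lambda>\<omega>. Z i \<omega> ^ (2 * r)) \<le> C" by blast
qed

text \<open>Pairing the index with the sample point gives a family the shape that
  \<open>closed_ring\<close> expects; the estimates are those for a single variable, with constants
  independent of i.\<close>

lemma closed_ring_bounded_moments:
  fixes I :: "'i set"
  shows "closed_ring (\<lambda>Z. bounded_moments I (\<lambda>i \<omega>. Z (i, \<omega>)))"
  unfolding closed_ring_def
proof (intro conjI allI impI)
  fix c :: real
  show "bounded_moments I (\<lambda>i \<omega>. c)"
    unfolding bounded_moments_def using closed_ringD(1)[OF all_moments_ring] by (auto simp: prob_space)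
next
  fix f g :: "'i \<times> 'a \<Rightarrow> real"
  assume f: "bounded_moments I (\<lambda>i \<omega>. f (i, \<omega>))" and g: "bounded_moments I (\<lambda>i \<omega>. g (i, \<omega>))"
  note R = closed_ringD[OF all_moments_ring]
  have am: "all_moments M (\<lambda>\<omega>. f (i, \<omega>))" "all_moments M (\<lambda>\<omega>. g (i, \<omega>))" if "i \<in> I" for i
    using f g that by (auto simp: bounded_moments_def)
  have even: "0 \<le> x ^ (2 * r)" for x :: real and r by simp
  show "bounded_moments I (\<lambda>i \<omega>. f (i, \<omega>) + g (i, \<omega>))"
    unfolding bounded_moments_def
  proof (intro conjI ballI allI R(2) am)
    fix r
    obtain C D where C: "\<And>i. i \<in> I \<Longrightarrow> expectation (\<lambda>\<omega>. f (i, \<omega>) ^ (2 * r)) \<le> C"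
      and D: "\<And>i. i \<in> I \<Longrightarrow> expectation (\<lambda>\<omega>. g (i, \<omega>) ^ (2 * r)) \<le> D"
      using f g unfolding bounded_moments_def by meson
    have "expectation (\<lambda>\<omega>. (f (i, \<omega>) + g (i, \<omega>)) ^ (2 * r)) \<le> 2 ^ (2 * r) * (C + D)" if i: "i \<in> I" for i
    proof -
      have "expectation (\<lambda>\<omega>. (f (i, \<omega>) + g (i, \<omega>)) ^ (2 * r)) \<le> expectation (\<lambda>\<omega>. 2 ^ (2 * r) * (f (i, \<omega>) ^ (2 * r) + g (i, \<omega>) ^ (2 * r)))"
      proof (rule integral_mono)
        show "integrable M (\<lambda>\<omega>. (f (i, \<omega>) + g (i, \<omega>)) ^ (2 * r))"
          using R(2)[OF am[OF i]] by (rule all_momentsD)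
        show "integrable M (\<lambda>\<omega>. 2 ^ (2 * r) * (f (i, \<omega>) ^ (2 * r) + g (i, \<omega>) ^ (2 * r)))"
          using all_momentsD(3)[OF am(1)[OF i], of "2 * r"] all_momentsD(3)[OF am(2)[OF i], of "2 * r"] by auto
        fix \<omega>
        let ?m = "max \<bar>f (i, \<omega>)\<bar> \<bar>g (i, \<omega>)\<bar>"
        have "(f (i, \<omega>) + g (i, \<omega>)) ^ (2 * r) = \<bar>f (i, \<omega>) + g (i, \<omega>)\<bar> ^ (2 * r)" by (simp add: power_even_abs)
        also have "\<dots> \<le> (2 * ?m) ^ (2 * r)" by (intro power_mono) auto
        also have "\<dots> = 2 ^ (2 * r) * ?m ^ (2 * r)" by (rule power_mult_distrib)
        also have "\<dots> \<le> 2 ^ (2 * r) * (f (i, \<omega>) ^ (2 * r) + g (i, \<omega>) ^ (2 * r))"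
          by (intro mult_left_mono) (auto simp: max_def power_even_abs even)
        finally show "(f (i, \<omega>) + g (i, \<omega>)) ^ (2 * r) \<le> 2 ^ (2 * r) * (f (i, \<omega>) ^ (2 * r) + g (i, \<omega>) ^ (2 * r))" .
      qed
      also have "\<dots> = 2 ^ (2 * r) * (expectation (\<lambda>\<omega>. f (i, \<omega>) ^ (2 * r)) + expectation (\<lambda>\<omega>. g (i, \<omega>) ^ (2 * r)))"
        using all_momentsD(3)[OF am(1)[OF i], of "2 * r"] all_momentsD(3)[OF am(2)[OF i], of "2 * r"] by simp
      also have "\<dots> \<le> 2 ^ (2 * r) * (C + D)" by (intro mult_left_mono add_mono C D i) auto
      finally show ?thesis .
    qed
    then show "\<exists>C. \<forall>i\<in>I. expectation (\<lambda>\<omega>. (f (i, \<omega>) + g (i, \<omega>)) ^ (2 * r)) \<le> C" by blast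
  qed
  show "bounded_moments I (\<lambda>i \<omega>. f (i, \<omega>) * g (i, \<omega>))"
    unfolding bounded_moments_def
  proof (intro conjI ballI allI R(3) am)
    fix r
    obtain C D where C: "\<And>i. i \<in> I \<Longrightarrow> expectation (\<lambda>\<omega>. f (i, \<omega>) ^ (2 * (2 * r))) \<le> C"
      and D: "\<And>i. i \<in> I \<Longrightarrow> expectation (\<lambda>\<omega>. g (i, \<omega>) ^ (2 * (2 * r))) \<le> D"
      using f g unfolding bounded_moments_def by meson
    have "expectation (\<lambda>\<omega>. (f (i, \<omega>) * g (i, \<omega>)) ^ (2 * r)) \<le> C + D" if i: "i \<in> I" for i
    proof -
      have "expectation (\<lambda>\<omega>. (f (i, \<omega>) * g (i, \<omega>)) ^ (2 * r)) \<le> expectation (\<lambda>\<omega>. f (i, \<omega>) ^ (2 * (2 * r)) + g (i, \<omega>) ^ (2 * (2 * r)))"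
      proof (rule integral_mono)
        show "integrable M (\<lambda>\<omega>. (f (i, \<omega>) * g (i, \<omega>)) ^ (2 * r))"
          using R(3)[OF am[OF i]] by (rule all_momentsD)
        show "integrable M (\<lambda>\<omega>. f (i, \<omega>) ^ (2 * (2 * r)) + g (i, \<omega>) ^ (2 * (2 * r)))"
          using all_momentsD(3)[OF am(1)[OF i]] all_momentsD(3)[OF am(2)[OF i]] by auto
        fix \<omega>
        have sq: "x ^ (2 * (2 * r)) = (x ^ (2 * r))\<^sup>2" for x :: real by (simp add: power_mult[symmetric] mult.commute)
        have "0 \<le> f (i, \<omega>) ^ (2 * r) * g (i, \<omega>) ^ (2 * r)" by simp
        then show "(f (i, \<omega>) * g (i, \<omega>)) ^ (2 * r) \<le> f (i, \<omega>) ^ (2 * (2 * r)) + g (i, \<omega>) ^ (2 * (2 * r))"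
          unfolding sq power_mult_distrib using sum_squares_bound[of "f (i, \<omega>) ^ (2 * r)" "g (i, \<omega>) ^ (2 * r)"] by linarith
      qed
      also have "\<dots> = expectation (\<lambda>\<omega>. f (i, \<omega>) ^ (2 * (2 * r))) + expectation (\<lambda>\<omega>. g (i, \<omega>) ^ (2 * (2 * r)))"
        by (intro Bochner_Integration.integral_add all_momentsD(3) am i)
      also have "\<dots> \<le> C + D" by (intro add_mono C D i)
      finally show ?thesis .
    qed
    then show "\<exists>C. \<forall>i\<in>I. expectation (\<lambda>\<omega>. (f (i, \<omega>) * g (i, \<omega>)) ^ (2 * r)) \<le> C" by blast
  qed
qed

lemma bounded_moments_add:
  assumes "bounded_moments I Z" "bounded_moments I Y"
  shows "bounded_moments I (\<lambda>i \<omega>. Z i \<omega> + Y i \<omega>)"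
proof -
  have "bounded_moments I (\<lambda>i \<omega>. (\<lambda>(i, \<omega>). Z i \<omega>) (i, \<omega>) + (\<lambda>(i, \<omega>). Y i \<omega>) (i, \<omega>))"
    by (rule closed_ringD(2)[where cl = "\<lambda>Z. bounded_moments I (\<lambda>i \<omega>. Z (i, \<omega>))", OF closed_ring_bounded_moments])
      (simp_all add: assms)
  then show ?thesis by simp
qed

lemma bounded_moments_mult:
  assumes "bounded_moments I Z" "bounded_moments I Y"
  shows "bounded_moments I (\<lambda>i \<omega>. Z i \<omega> * Y i \<omega>)"
proof -
  have "bounded_moments I (\<lambda>i \<omega>. (\<lambda>(i, \<omega>). Z i \<omega>) (i, \<omega>) * (\<lambda>(i, \<omega>). Y i \<omega>) (i, \<omega>))"
    by (rule closed_ringD(3)[where cl = "\<lambda>Z. bounded_moments I (\<lambda>i \<omega>. Z (i, \<omega>))", OF closed_ring_bounded_moments])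
      (simp_all add: assms)
  then show ?thesis by simp
qed

lemma bounded_moments_const: "bounded_moments I (\<lambda>i \<omega>. c)"
  by (rule closed_ringD(1)[where cl = "\<lambda>Z. bounded_moments I (\<lambda>i \<omega>. Z (i, \<omega>))", OF closed_ring_bounded_moments])

lemma bounded_moments_sum:
  assumes "finite A" "\<And>x. x \<in> A \<Longrightarrow> bounded_moments I (Z x)"
  shows "bounded_moments I (\<lambda>i \<omega>. \<Sum>x\<in>A. Z x i \<omega>)"
  using assms
proof (induction A rule: finite_induct)
  case empty
  then show ?case by (simp add: bounded_moments_const)
next
  case (insert x A)
  then have "bounded_moments I (\<lambda>i \<omega>. Z x i \<omega> + (\<Sum>x\<in>A. Z x i \<omega>))"
    by (intro bounded_moments_add) auto
  then show ?case using insert by simp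
qed

lemma bounded_moments_reindex:
  assumes Z: "bounded_moments I Z" and f: "\<And>k. k \<in> K \<Longrightarrow> f k \<in> I"
  shows "bounded_moments K (\<lambda>k. Z (f k))"
  unfolding bounded_moments_def
proof (intro conjI ballI allI)
  show "all_moments M (Z (f k))" if "k \<in> K" for k using Z f[OF that] by (simp add: bounded_moments_def)
  fix r
  obtain C where "\<forall>i\<in>I. expectation (\<lambda>\<omega>. Z i \<omega> ^ (2 * r)) \<le> C"
    using Z unfolding bounded_moments_def by meson
  then show "\<exists>C. \<forall>k\<in>K. expectation (\<lambda>\<omega>. Z (f k) \<omega> ^ (2 * r)) \<le> C"
    using f by (intro exI[of _ C]) simp
qed

text \<open>The moment bounds belong to the notion because convergence in L^2 alone is not stable
  under products.\<close>

definition L2_conv :: "(nat \<Rightarrow> 'a \<Rightarrow> real) \<Rightarrow> real \<Rightarrow> bool" where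
  "L2_conv Z c \<longleftrightarrow> bounded_moments UNIV Z \<and> (\<lambda>n. expectation (\<lambda>\<omega>. (Z n \<omega> - c)\<^sup>2)) \<longlonglongrightarrow> 0"

lemma L2_convD:
  assumes "L2_conv Z c"
  shows "bounded_moments UNIV Z" "all_moments M (Z n)" "(\<lambda>n. expectation (\<lambda>\<omega>. (Z n \<omega> - c)\<^sup>2)) \<longlonglongrightarrow> 0"
  using assms by (simp_all add: L2_conv_def bounded_moments_def)

lemma integrable_sq_diff:
  assumes "all_moments M Z" "all_moments M Y"
  shows "integrable M (\<lambda>\<omega>. (Z \<omega> - Y \<omega>)\<^sup>2)"
  by (rule all_momentsD(3)[OF closed_ring_diff[where cl = "all_moments M", OF all_moments_ring assms]])

lemma integrable_sq_diff_const:
  assumes "all_moments M Z"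
  shows "integrable M (\<lambda>\<omega>. (Z \<omega> - c)\<^sup>2)"
  using integrable_sq_diff[OF assms closed_ringD(1)[where cl = "all_moments M", OF all_moments_ring]] .

lemma L2_convI:
  assumes Z: "bounded_moments UNIV Z" and e: "e \<longlonglongrightarrow> 0"
    and le: "\<forall>\<^sub>F n in sequentially. expectation (\<lambda>\<omega>. (Z n \<omega> - c)\<^sup>2) \<le> e n"
  shows "L2_conv Z c"
  unfolding L2_conv_def
proof (intro conjI Z)
  show "(\<lambda>n. expectation (\<lambda>\<omega>. (Z n \<omega> - c)\<^sup>2)) \<longlonglongrightarrow> 0"
    by (rule tendsto_sandwich[OF _ le tendsto_const e]) simp
qed

lemma square_add_le: "(x + y)\<^sup>2 \<le> 2 * x\<^sup>2 + 2 * y\<^sup>2" for x y :: real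
  using sum_squares_bound[of x y] by (simp add: power2_sum)

lemma L2_conv_close:
  assumes Y: "L2_conv Y c" and Z: "bounded_moments UNIV Z"
    and close: "(\<lambda>n. expectation (\<lambda>\<omega>. (Z n \<omega> - Y n \<omega>)\<^sup>2)) \<longlonglongrightarrow> 0"
  shows "L2_conv Z c"
proof (rule L2_convI[OF Z])
  have am: "all_moments M (Z n)" for n using Z by (simp add: bounded_moments_def)
  note ints = integrable_sq_diff[OF am L2_convD(2)[OF Y]] integrable_sq_diff_const[OF L2_convD(2)[OF Y]] integrable_sq_diff_const[OF am]
  show "(\<lambda>n. 2 * expectation (\<lambda>\<omega>. (Z n \<omega> - Y n \<omega>)\<^sup>2) + 2 * expectation (\<lambda>\<omega>. (Y n \<omega> - c)\<^sup>2)) \<longlonglongrightarrow> 0"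
    using tendsto_add[OF tendsto_mult_left[OF close, of 2] tendsto_mult_left[OF L2_convD(3)[OF Y], of 2]] by simp
  show "\<forall>\<^sub>F n in sequentially. expectation (\<lambda>\<omega>. (Z n \<omega> - c)\<^sup>2) \<le> 2 * expectation (\<lambda>\<omega>. (Z n \<omega> - Y n \<omega>)\<^sup>2) + 2 * expectation (\<lambda>\<omega>. (Y n \<omega> - c)\<^sup>2)"
  proof (intro always_eventually allI)
    fix n
    have "expectation (\<lambda>\<omega>. (Z n \<omega> - c)\<^sup>2) \<le> expectation (\<lambda>\<omega>. 2 * (Z n \<omega> - Y n \<omega>)\<^sup>2 + 2 * (Y n \<omega> - c)\<^sup>2)"
    proof (rule integral_mono)
      fix \<omega> show "(Z n \<omega> - c)\<^sup>2 \<le> 2 * (Z n \<omega> - Y n \<omega>)\<^sup>2 + 2 * (Y n \<omega> - c)\<^sup>2"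
        using square_add_le[of "Z n \<omega> - Y n \<omega>" "Y n \<omega> - c"] by simp
    qed (use ints in auto)
    also have "\<dots> = 2 * expectation (\<lambda>\<omega>. (Z n \<omega> - Y n \<omega>)\<^sup>2) + 2 * expectation (\<lambda>\<omega>. (Y n \<omega> - c)\<^sup>2)"
      using ints by simp
    finally show "expectation (\<lambda>\<omega>. (Z n \<omega> - c)\<^sup>2) \<le> 2 * expectation (\<lambda>\<omega>. (Z n \<omega> - Y n \<omega>)\<^sup>2) + 2 * expectation (\<lambda>\<omega>. (Y n \<omega> - c)\<^sup>2)" .
  qed
qed

lemma L2_conv_const: "L2_conv (\<lambda>n \<omega>. c) c"
  unfolding L2_conv_def by (simp add: bounded_moments_const)

lemma L2_conv_deterministic:
  assumes z: "z \<longlonglongrightarrow> c"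
  shows "L2_conv (\<lambda>n \<omega>. z n) c"
  unfolding L2_conv_def
proof
  obtain B where B: "\<And>n. \<bar>z n\<bar> \<le> B" using convergent_imp_Bseq[OF convergentI[OF z]] unfolding Bseq_def real_norm_def by blast
  show "bounded_moments UNIV (\<lambda>n \<omega>. z n)"
    by (rule bounded_moments_dominated[OF bounded_moments_const[of _ B]])
      (use order_trans[OF B abs_ge_self] closed_ringD(1)[where cl = "all_moments M", OF all_moments_ring] in \<open>simp_all\<close>)
  have "(\<lambda>n. (z n - c)\<^sup>2) \<longlonglongrightarrow> (c - c)\<^sup>2" by (intro tendsto_intros z)
  then show "(\<lambda>n. expectation (\<lambda>\<omega>. (z n - c)\<^sup>2)) \<longlonglongrightarrow> 0" by (simp add: prob_space)
qed

lemma L2_conv_add: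
  assumes Z: "L2_conv Z c" and Y: "L2_conv Y d"
  shows "L2_conv (\<lambda>n \<omega>. Z n \<omega> + Y n \<omega>) (c + d)"
proof (rule L2_convI)
  show "bounded_moments UNIV (\<lambda>n \<omega>. Z n \<omega> + Y n \<omega>)" using Z Y by (intro bounded_moments_add L2_convD)
  note R = closed_ringD[OF all_moments_ring]
  note ints = integrable_sq_diff_const[OF L2_convD(2)[OF Y]] integrable_sq_diff_const[OF L2_convD(2)[OF Z]]
    integrable_sq_diff_const[OF R(2)[OF L2_convD(2)[OF Z] L2_convD(2)[OF Y]]]
  show "(\<lambda>n. 2 * expectation (\<lambda>\<omega>. (Z n \<omega> - c)\<^sup>2) + 2 * expectation (\<lambda>\<omega>. (Y n \<omega> - d)\<^sup>2)) \<longlonglongrightarrow> 0"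
    using tendsto_add[OF tendsto_mult_left[OF L2_convD(3)[OF Z], of 2] tendsto_mult_left[OF L2_convD(3)[OF Y], of 2]] by simp
  show "\<forall>\<^sub>F n in sequentially. expectation (\<lambda>\<omega>. (Z n \<omega> + Y n \<omega> - (c + d))\<^sup>2) \<le> 2 * expectation (\<lambda>\<omega>. (Z n \<omega> - c)\<^sup>2) + 2 * expectation (\<lambda>\<omega>. (Y n \<omega> - d)\<^sup>2)"
  proof (intro always_eventually allI)
    fix n
    have "expectation (\<lambda>\<omega>. (Z n \<omega> + Y n \<omega> - (c + d))\<^sup>2) \<le> expectation (\<lambda>\<omega>. 2 * (Z n \<omega> - c)\<^sup>2 + 2 * (Y n \<omega> - d)\<^sup>2)"
    proof (rule integral_mono)
      fix \<omega> show "(Z n \<omega> + Y n \<omega> - (c + d))\<^sup>2 \<le> 2 * (Z n \<omega> - c)\<^sup>2 + 2 * (Y n \<omega> - d)\<^sup>2"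
        using square_add_le[of "Z n \<omega> - c" "Y n \<omega> - d"] by (simp add: algebra_simps)
    qed (use ints in auto)
    also have "\<dots> = 2 * expectation (\<lambda>\<omega>. (Z n \<omega> - c)\<^sup>2) + 2 * expectation (\<lambda>\<omega>. (Y n \<omega> - d)\<^sup>2)"
      using ints by simp
    finally show "expectation (\<lambda>\<omega>. (Z n \<omega> + Y n \<omega> - (c + d))\<^sup>2) \<le> 2 * expectation (\<lambda>\<omega>. (Z n \<omega> - c)\<^sup>2) + 2 * expectation (\<lambda>\<omega>. (Y n \<omega> - d)\<^sup>2)" .
  qed
qed

lemma L2_conv_mult_zero:
  assumes Z: "L2_conv Z 0" and Y: "bounded_moments UNIV Y"
  shows "L2_conv (\<lambda>n \<omega>. Z n \<omega> * Y n \<omega>) 0"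
proof -
  note R = closed_ringD[OF all_moments_ring]
  have am: "all_moments M (Z n)" "all_moments M (Y n)" for n
    using L2_convD(2)[OF Z] Y by (simp_all add: bounded_moments_def)
  have bd: "bounded_moments UNIV (\<lambda>n \<omega>. Z n \<omega> * (Y n \<omega> * Y n \<omega>))"
    using L2_convD(1)[OF Z] Y by (intro bounded_moments_mult)
  then obtain C where C: "\<And>n. expectation (\<lambda>\<omega>. (Z n \<omega> * (Y n \<omega> * Y n \<omega>)) ^ (2 * 1)) \<le> C"
    unfolding bounded_moments_def by blast
  define B where "B = max C 1"
  have B: "B \<ge> 1" "\<And>n. expectation (\<lambda>\<omega>. (Z n \<omega> * (Y n \<omega> * Y n \<omega>))\<^sup>2) \<le> B"
    using C by (auto simp: B_def intro: max.coboundedI1)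
  have "(\<lambda>n. expectation (\<lambda>\<omega>. (Z n \<omega> * Y n \<omega> - 0)\<^sup>2)) \<longlonglongrightarrow> 0"
  proof (rule LIMSEQ_I)
    fix e :: real assume e: "e > 0"
    \<comment> \<open>With this weight the two parts of the estimate add up to at most e/2 +
      e/4.\<close>
    define \<delta> where "\<delta> = e / (2 * B)"
    have \<delta>: "\<delta> > 0" using e B by (simp add: \<delta>_def)
    have "\<forall>\<^sub>F n in sequentially. expectation (\<lambda>\<omega>. (Z n \<omega> - 0)\<^sup>2) < \<delta> * e"
      using L2_convD(3)[OF Z] \<delta> e by (intro order_tendstoD) auto
    then obtain N where N: "\<And>n. n \<ge> N \<Longrightarrow> expectation (\<lambda>\<omega>. (Z n \<omega>)\<^sup>2) < \<delta> * e"
      by (auto simp: eventually_sequentially)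
    have "expectation (\<lambda>\<omega>. (Z n \<omega> * Y n \<omega>)\<^sup>2) < e" if n: "n \<ge> N" for n
    proof -
      have ints: "integrable M (\<lambda>\<omega>. (Z n \<omega>)\<^sup>2)" "integrable M (\<lambda>\<omega>. (Z n \<omega> * (Y n \<omega> * Y n \<omega>))\<^sup>2)" "integrable M (\<lambda>\<omega>. (Z n \<omega> * Y n \<omega>)\<^sup>2)"
        by (rule all_momentsD(3)[OF am(1)] all_momentsD(3)[OF R(3)[OF am(1) R(3)[OF am(2) am(2)]]]
            all_momentsD(3)[OF R(3)[OF am]])+
      have "expectation (\<lambda>\<omega>. (Z n \<omega> * Y n \<omega>)\<^sup>2) \<le> expectation (\<lambda>\<omega>. (Z n \<omega>)\<^sup>2 / (2 * \<delta>) + \<delta> / 2 * (Z n \<omega> * (Y n \<omega> * Y n \<omega>))\<^sup>2)"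
      proof (rule integral_mono)
        fix \<omega>
        \<comment> \<open>AM-GM applied to $|Z| \cdot (|Z| Y^2)$ with weight $\delta$\<close>
        have "0 \<le> (Z n \<omega> - \<delta> * (Z n \<omega> * (Y n \<omega> * Y n \<omega>)))\<^sup>2 / (2 * \<delta>)" using \<delta> by simp
        also have "\<dots> = (Z n \<omega>)\<^sup>2 / (2 * \<delta>) + \<delta> / 2 * (Z n \<omega> * (Y n \<omega> * Y n \<omega>))\<^sup>2 - (Z n \<omega> * Y n \<omega>)\<^sup>2"
          using \<delta> by (simp add: power2_eq_square field_simps)
        finally show "(Z n \<omega> * Y n \<omega>)\<^sup>2 \<le> (Z n \<omega>)\<^sup>2 / (2 * \<delta>) + \<delta> / 2 * (Z n \<omega> * (Y n \<omega> * Y n \<omega>))\<^sup>2" by simp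
      qed (use ints in auto)
      also have "\<dots> = expectation (\<lambda>\<omega>. (Z n \<omega>)\<^sup>2) / (2 * \<delta>) + \<delta> / 2 * expectation (\<lambda>\<omega>. (Z n \<omega> * (Y n \<omega> * Y n \<omega>))\<^sup>2)"
        using ints by simp
      also have "\<dots> < \<delta> * e / (2 * \<delta>) + \<delta> / 2 * B"
        using N[OF n] \<delta> B by (intro add_less_le_mono divide_strict_right_mono mult_left_mono) auto
      also have "\<dots> \<le> e" using \<delta> B e by (simp add: \<delta>_def)
      finally show ?thesis .
    qed
    then show "\<exists>N. \<forall>n\<ge>N. norm (expectation (\<lambda>\<omega>. (Z n \<omega> * Y n \<omega> - 0)\<^sup>2) - 0) < e"
      by (intro exI[of _ N]) simp
  qed
  moreover have "bounded_moments UNIV (\<lambda>n \<omega>. Z n \<omega> * Y n \<omega>)"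
    using L2_convD(1)[OF Z] Y by (rule bounded_moments_mult)
  ultimately show ?thesis by (simp add: L2_conv_def)
qed

text \<open>Z Y = (Z - c) Y + c (Y - d) + c d, where each of the first two terms is a null sequence
  times a family with bounded moments.\<close>

lemma L2_conv_mult:
  assumes Z: "L2_conv Z c" and Y: "L2_conv Y d"
  shows "L2_conv (\<lambda>n \<omega>. Z n \<omega> * Y n \<omega>) (c * d)"
proof -
  have 1: "L2_conv (\<lambda>n \<omega>. (Z n \<omega> + (- c)) * Y n \<omega>) 0"
    using L2_conv_add[OF Z L2_conv_const[of "- c"]] L2_convD(1)[OF Y] by (intro L2_conv_mult_zero) auto
  have 2: "L2_conv (\<lambda>n \<omega>. (Y n \<omega> + (- d)) * c) 0"
    using L2_conv_add[OF Y L2_conv_const[of "- d"]] bounded_moments_const by (intro L2_conv_mult_zero) auto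
  have "L2_conv (\<lambda>n \<omega>. (Z n \<omega> + (- c)) * Y n \<omega> + (Y n \<omega> + (- d)) * c + c * d) (0 + 0 + c * d)"
    by (intro L2_conv_add 1 2 L2_conv_const)
  then show ?thesis by (simp add: algebra_simps)
qed

lemma L2_conv_sum:
  assumes "finite A" "\<And>x. x \<in> A \<Longrightarrow> L2_conv (Z x) (c x)"
  shows "L2_conv (\<lambda>n \<omega>. \<Sum>x\<in>A. Z x n \<omega>) (\<Sum>x\<in>A. c x)"
  using assms
proof (induction A rule: finite_induct)
  case empty
  then show ?case by (simp add: L2_conv_const)
next
  case (insert x A)
  then have "L2_conv (\<lambda>n \<omega>. Z x n \<omega> + (\<Sum>x\<in>A. Z x n \<omega>)) (c x + (\<Sum>x\<in>A. c x))"
    by (intro L2_conv_add) auto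
  then show ?case using insert by simp
qed

lemma L2_conv_expectation:
  assumes Z: "L2_conv Z c"
  shows "(\<lambda>n. expectation (Z n)) \<longlonglongrightarrow> c"
proof -
  have lim: "(\<lambda>n. sqrt (expectation (\<lambda>\<omega>. (Z n \<omega> - c)\<^sup>2))) \<longlonglongrightarrow> 0"
    using tendsto_real_sqrt[OF L2_convD(3)[OF Z]] by (simp only: real_sqrt_zero)
  have le: "\<bar>expectation (Z n) - c\<bar> \<le> sqrt (expectation (\<lambda>\<omega>. (Z n \<omega> - c)\<^sup>2))" for n
  proof -
    have i: "integrable M (\<lambda>\<omega>. Z n \<omega> - c)" "integrable M (\<lambda>\<omega>. (Z n \<omega> - c)\<^sup>2)"
      using all_momentsD(2)[OF L2_convD(2)[OF Z]] integrable_sq_diff_const[OF L2_convD(2)[OF Z]] by auto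
    \<comment> \<open>Jensen's inequality in the form that a variance is nonnegative.\<close>
    have "0 \<le> variance (\<lambda>\<omega>. Z n \<omega> - c)" by (rule variance_positive)
    also have "\<dots> = expectation (\<lambda>\<omega>. (Z n \<omega> - c)\<^sup>2) - (expectation (\<lambda>\<omega>. Z n \<omega> - c))\<^sup>2"
      using i by (rule variance_eq)
    finally have "(expectation (\<lambda>\<omega>. Z n \<omega> - c))\<^sup>2 \<le> expectation (\<lambda>\<omega>. (Z n \<omega> - c)\<^sup>2)" by simp
    from real_sqrt_le_mono[OF this] show ?thesis
      using all_momentsD(2)[OF L2_convD(2)[OF Z]] by (simp add: prob_space)
  qed
  have "(\<lambda>n. expectation (Z n) - c) \<longlonglongrightarrow> 0"
    by (rule Lim_null_comparison[OF _ lim], unfold real_norm_def, rule always_eventually, rule allI, rule le)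
  then show ?thesis by (rule LIM_zero_cancel)
qed

end

section \<open>The recursion for limiting traces\<close>

text \<open>Jensen's inequality for the true average over J. As the sum is divided by n and not by
  \<open>card J\<close>, a factor (N / n)^(2r) is left over; it is at most N / n, which is exactly
  what turns division by N into division by n.\<close>

lemma average_power_le:
  fixes u :: "'i \<Rightarrow> real"
  assumes J: "finite J" "card J \<le> n" and n: "n \<ge> 1" and r: "r \<ge> 1"
  shows "((\<Sum>j\<in>J. u j) / real n) ^ (2 * r) \<le> (\<Sum>j\<in>J. u j ^ (2 * r)) / real n"
proof (cases "J = {}")
  case True
  then show ?thesis using r by (simp add: power_0_left)
next
  case False
  define N where "N = real (card J)"
  have N: "N > 0" "N \<le> real n" using False J by (auto simp: N_def card_gt_0_iff)
  have "(\<Sum>j\<in>J. (1 / N) *\<^sub>R u j) ^ (2 * r) \<le> (\<Sum>j\<in>J. (1 / N) * u j ^ (2 * r))"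
  proof (rule convex_on_sum[OF J(1) False convex_power_even])
    show "(\<Sum>j\<in>J. 1 / N) = 1" using N by (simp add: N_def)
  qed (use N in auto)
  then have conv: "((\<Sum>j\<in>J. u j) / N) ^ (2 * r) \<le> (\<Sum>j\<in>J. u j ^ (2 * r)) / N"
    by (simp add: sum_divide_distrib)
  have S: "0 \<le> (\<Sum>j\<in>J. u j ^ (2 * r))" by (intro sum_nonneg) simp
  have "((\<Sum>j\<in>J. u j) / real n) ^ (2 * r) = ((\<Sum>j\<in>J. u j) / N) ^ (2 * r) * (N / real n) ^ (2 * r)"
    using N by (simp add: power_mult_distrib[symmetric])
  also have "\<dots> \<le> (\<Sum>j\<in>J. u j ^ (2 * r)) / N * (N / real n)"
  proof (intro mult_mono conv)
    show "(N / real n) ^ (2 * r) \<le> N / real n"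
      using power_decreasing[of 1 "2 * r" "N / real n"] N n r by simp
  qed (use S N in auto)
  also have "\<dots> = (\<Sum>j\<in>J. u j ^ (2 * r)) / real n" using N by simp
  finally show ?thesis .
qed

lemma abs_mult_le_squares: "\<bar>x * y\<bar> \<le> x * x + y * y" for x y :: real
proof -
  have "2 * (\<bar>x\<bar> * \<bar>y\<bar>) \<le> x * x + y * y"
    using sum_squares_bound[of "\<bar>x\<bar>" "\<bar>y\<bar>"] by (simp add: power2_eq_square)
  moreover have "0 \<le> \<bar>x\<bar> * \<bar>y\<bar>" by simp
  ultimately show ?thesis unfolding abs_mult by linarith
qed

text \<open>The limits of tr(W^k T^p) / n. The value 1 for q = k belongs to the plain term x_j^T A^k
  T^p x_j / n of the column splitting, which has no second factor; it differs from
  \<open>loop_limit w 0 0\<close>, which is w 0 and will be the limit of m / n.\<close>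

function loop_limit :: "(nat \<Rightarrow> real) \<Rightarrow> nat \<Rightarrow> nat \<Rightarrow> real" where
  "loop_limit w 0 p = w p"
| "loop_limit w (Suc k) p = (\<Sum>q\<le>k. loop_limit w q (Suc p) * (if q = k then 1 else loop_limit w (k - q) 0))"
  by pat_completeness auto
termination by (relation "Wellfounded.measure (\<lambda>(w, k, p). k)") auto

text \<open>The traces of T^p are divided by n rather than by m, to share the normalisation of the
  Gram operator.\<close>

locale sample_covariance = covariance_decay M a t g K c
  for M :: "'w measure" and a t g K c +
  fixes m :: "nat \<Rightarrow> nat" and w :: "nat \<Rightarrow> real"
  assumes Tlim: "\<And>p. (\<lambda>n. op_trace (m n) (kernel_op (m n) t ^^ p) / real n) \<longlonglongrightarrow> w p"
begin

definition quad :: "nat \<Rightarrow> nat set \<Rightarrow> nat \<Rightarrow> nat \<Rightarrow> nat \<Rightarrow> 'w \<Rightarrow> real" where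
  "quad n J j q p \<omega> = ip (m n) (X \<omega> j) ((gram_op (m n) (1 / real n) (X \<omega>) J ^^ q) ((kernel_op (m n) t ^^ p) (X \<omega> j))) / real n"

definition tr :: "nat \<Rightarrow> nat set \<Rightarrow> nat \<Rightarrow> nat \<Rightarrow> 'w \<Rightarrow> real" where
  "tr n J q p \<omega> = op_trace (m n) (\<lambda>f. (gram_op (m n) (1 / real n) (X \<omega>) J ^^ q) ((kernel_op (m n) t ^^ p) f)) / real n"

lemma all_moments_divide: "all_moments M Z \<Longrightarrow> all_moments M (\<lambda>\<omega>. Z \<omega> / x)"
proof -
  note R = closed_ringD[OF am_ring]
  assume "all_moments M Z"
  from R(3)[OF this R(1)[of "1 / x"]] show ?thesis by simp
qed

lemma all_moments_quad: "all_moments M (quad n J j q p)"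
  unfolding quad_def[abs_def]
  by (intro all_moments_divide closed_ring_ip[OF am_ring] closed_ring_gram_op[OF am_ring] closed_ring_kernel_op[OF am_ring] am)

lemma all_moments_tr: "all_moments M (tr n J q p)"
  unfolding tr_def[abs_def]
  by (intro all_moments_divide closed_ring_op_trace[OF am_ring] am)

lemma quad_insert:
  assumes "finite J" "j \<notin> J"
  shows "quad n (insert j J) j k p \<omega> = quad n J j k p \<omega> + (\<Sum>q<k. quad n J j q p \<omega> * quad n (insert j J) j (k - 1 - q) 0 \<omega>)"
  using gram_op_funpow_insert[OF assms, of "1 / real n" "m n" "X \<omega>" k "(kernel_op (m n) t ^^ p) (X \<omega> j)"]
  by (simp add: quad_def)

lemma tr_Suc: "tr n J (Suc k) p \<omega> = (\<Sum>j\<in>J. quad n J j k p \<omega>) / real n"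
  unfolding tr_def op_trace_gram_op_Suc[OF sym_op_kernel_op[OF t_sym]] by (simp add: quad_def)

lemma gram_op_restrict: "gram_op mm s (restrict Y J) J = gram_op mm s Y J"
  by (rule gram_op_cong) simp

lemma measurable_coordinates:
  fixes J :: "nat set"
  defines "B \<equiv> Pi\<^sub>M UNIV (\<lambda>i::nat. borel :: real measure)"
  shows "(\<lambda>z. fst z i) \<in> borel_measurable (B \<Otimes>\<^sub>M Pi\<^sub>M J (\<lambda>_. B))"
    and "j \<in> J \<Longrightarrow> (\<lambda>z. snd z j i) \<in> borel_measurable (B \<Otimes>\<^sub>M Pi\<^sub>M J (\<lambda>_. B))"
    and "j \<in> J \<Longrightarrow> (\<lambda>Y. Y j i) \<in> borel_measurable (Pi\<^sub>M J (\<lambda>_. B))"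
proof -
  have c: "(\<lambda>x. x i) \<in> borel_measurable B" unfolding B_def by (rule measurable_component_singleton) simp
  show "(\<lambda>z. fst z i) \<in> borel_measurable (B \<Otimes>\<^sub>M Pi\<^sub>M J (\<lambda>_. B))"
    by (rule measurable_compose[OF measurable_fst c])
  show 1: "(\<lambda>Y. Y j i) \<in> borel_measurable (Pi\<^sub>M J (\<lambda>_. B))" if "j \<in> J"
    by (rule measurable_compose[OF measurable_component_singleton[OF that] c])
  show "(\<lambda>z. snd z j i) \<in> borel_measurable (B \<Otimes>\<^sub>M Pi\<^sub>M J (\<lambda>_. B))" if "j \<in> J"
    by (rule measurable_compose[OF measurable_snd 1[OF that]])
qed

lemma gram_op_trace_nonneg:
  assumes s: "s \<ge> 0"
  shows "0 \<le> op_trace mm (gram_op mm s Y J ^^ q)"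
  unfolding op_trace_def
proof (rule sum_nonneg)
  fix i assume "i \<in> {..<mm}"
  then have i: "i < mm" by simp
  have sym: "sym_op mm (gram_op mm s Y J ^^ q)"
    by (simp add: sym_op_def sym_op_funpow[OF sym_op_gram_op])
  show "0 \<le> (gram_op mm s Y J ^^ q) (unit_fun i) i"
    by (rule psd_entry_le(2)[OF linear_op_funpow[OF linear_op_gram_op] sym gram_op_funpow_psd[OF s] i i])
qed

text \<open>Given the other columns, A^q is a fixed symmetric positive operator. This confines the
  estimate to p = 0, since A^q T^p is in general neither symmetric nor positive.\<close>

lemma quad_moment_le:
  assumes j: "j \<notin> J"
  shows "expectation (\<lambda>\<omega>. quad n J j q 0 \<omega> ^ r) \<le> c r * fact (2 * r) * C_g ^ r * expectation (\<lambda>\<omega>. tr n J q 0 \<omega> ^ r)"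
proof -
  note RB = closed_ring_borel_measurable
  define D where "D = c r * fact (2 * r) * C_g ^ r"
  have D: "0 \<le> D" using c C_g by (simp add: D_def)
  define s where "s = 1 / real n"
  have s: "s \<ge> 0" by (simp add: s_def)
  define \<Phi> where "\<Phi> = (\<lambda>x Y. (ip (m n) x ((gram_op (m n) s Y J ^^ q) x) * s) ^ r)"
  \<comment> \<open>The idle kernel power with exponent 0 keeps the literal shape of
    \<open>tr\<close>.\<close>
  define \<Psi> where "\<Psi> = (\<lambda>Y. D * (op_trace (m n) (\<lambda>f. (gram_op (m n) s Y J ^^ q) ((kernel_op (m n) t ^^ 0) f)) * s) ^ r)"
  have sym: "sym_op (m n) (gram_op (m n) s Y J ^^ q)" for Y
    by (simp add: sym_op_def sym_op_funpow[OF sym_op_gram_op])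
  have lin: "linear_op (m n) (gram_op (m n) s Y J ^^ q)" for Y
    by (intro linear_op_funpow linear_op_gram_op)
  have \<Phi>_quad: "\<Phi> (X \<omega> j) (X \<omega>) = quad n J j q 0 \<omega> ^ r" for \<omega> by (simp add: \<Phi>_def quad_def s_def)
  have \<Psi>_tr: "\<Psi> (X \<omega>) = D * tr n J q 0 \<omega> ^ r" for \<omega> by (simp add: \<Psi>_def tr_def s_def)
  have "expectation (\<lambda>\<omega>. \<Phi> (X \<omega> j) (X \<omega>)) \<le> expectation (\<lambda>\<omega>. \<Psi> (X \<omega>))"
  proof (rule column_conditional_bound[where \<Phi> = \<Phi> and \<Psi> = \<Psi>, OF j])
    let ?B = "Pi\<^sub>M UNIV (\<lambda>i::nat. borel :: real measure)"
    show "(\<lambda>z. \<Phi> (fst z) (snd z)) \<in> borel_measurable (?B \<Otimes>\<^sub>M Pi\<^sub>M J (\<lambda>_. ?B))"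
      unfolding \<Phi>_def
      by (intro borel_measurable_power borel_measurable_times borel_measurable_const closed_ring_ip[OF RB]
          closed_ring_gram_op[OF RB] measurable_coordinates)
    show "\<Psi> \<in> borel_measurable (Pi\<^sub>M J (\<lambda>_. ?B))"
      unfolding \<Psi>_def
      by (intro borel_measurable_power borel_measurable_times borel_measurable_const closed_ring_op_trace[OF RB] measurable_coordinates)
    show "0 \<le> \<Phi> x Y" for x Y unfolding \<Phi>_def using s by (simp add: gram_op_funpow_psd)
    show "0 \<le> \<Psi> Y" for Y
      unfolding \<Psi>_def using s D gram_op_trace_nonneg[OF s, where mm = "m n" and Y = Y and J = J and q = q] by simp
    show "\<Phi> x (restrict Y J) = \<Phi> x Y" "\<Psi> (restrict Y J) = \<Psi> Y" for x Y
      by (simp_all add: \<Phi>_def \<Psi>_def gram_op_restrict)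
    show "integrable M (\<lambda>\<omega>. \<Phi> (X \<omega> j) (X \<omega>))" unfolding \<Phi>_quad by (rule all_momentsD[OF all_moments_quad])
    show "integrable M (\<lambda>\<omega>. \<Psi> (X \<omega>))" unfolding \<Psi>_tr by (intro integrable_mult_right all_momentsD[OF all_moments_tr])
    have amY: "all_moments M (\<lambda>\<omega>. ip (m n) (X \<omega> j) ((gram_op (m n) s Y J ^^ q) (X \<omega> j)))" for Y
      by (intro closed_ring_ip[OF am_ring] am closed_ring_gram_op[OF am_ring] closed_ringD(1)[where cl = "all_moments M", OF am_ring])
    show "integrable M (\<lambda>\<omega>. \<Phi> (X \<omega> j) Y)" for Y
      unfolding \<Phi>_def power_mult_distrib by (intro integrable_mult_left all_momentsD[OF amY])
    show "expectation (\<lambda>\<omega>. \<Phi> (X \<omega> j) Y) \<le> \<Psi> Y" for Y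
    proof -
      have "expectation (\<lambda>\<omega>. \<Phi> (X \<omega> j) Y) = expectation (\<lambda>\<omega>. ip (m n) (X \<omega> j) ((gram_op (m n) s Y J ^^ q) (X \<omega> j)) ^ r) * s ^ r"
        unfolding \<Phi>_def power_mult_distrib by simp
      also have "\<dots> \<le> (D * op_trace (m n) (gram_op (m n) s Y J ^^ q) ^ r) * s ^ r"
        unfolding D_def using s
        by (intro mult_right_mono quadratic_form_moment lin sym gram_op_funpow_psd) auto
      finally show ?thesis by (simp add: \<Psi>_def power_mult_distrib)
    qed
  qed
  then show ?thesis unfolding \<Phi>_quad \<Psi>_tr D_def by simp
qed

definition V :: "nat \<Rightarrow> real" where
  "V p = K * (2 * C_g\<^sup>2) * (K * C_g) ^ (2 * p)"

lemma V_nonneg: "0 \<le> V p"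
  using K C_g by (simp add: V_def)

text \<open>The squared Hilbert-Schmidt norm of A^q is tr(A^(2q)), while the normalisation
  contributes n^(-2). One power of n is used up to normalise that trace; the other is the rate
  1/n.\<close>

lemma quad_variance_le:
  assumes j: "j \<notin> J"
  shows "expectation (\<lambda>\<omega>. (quad n J j q p \<omega> - tr n J q (Suc p) \<omega>)\<^sup>2) \<le> V p / real n * expectation (\<lambda>\<omega>. tr n J (2 * q) 0 \<omega>)"
proof -
  note RB = closed_ring_borel_measurable
  define s where "s = 1 / real n"
  have s: "s \<ge> 0" by (simp add: s_def)
  define T where "T = kernel_op (m n) t"
  define \<Phi> where "\<Phi> = (\<lambda>x Y. ((ip (m n) x ((gram_op (m n) s Y J ^^ q) ((T ^^ p) x)) - op_trace (m n) (\<lambda>f. (gram_op (m n) s Y J ^^ q) ((T ^^ Suc p) f))) * s)\<^sup>2)"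
  define \<Psi> where "\<Psi> = (\<lambda>Y. (V p * s) * (op_trace (m n) (\<lambda>f. (gram_op (m n) s Y J ^^ (2 * q)) ((kernel_op (m n) t ^^ 0) f)) * s))"
  have \<Phi>_quad: "\<Phi> (X \<omega> j) (X \<omega>) = (quad n J j q p \<omega> - tr n J q (Suc p) \<omega>)\<^sup>2" for \<omega>
    by (simp add: \<Phi>_def quad_def tr_def s_def T_def diff_divide_distrib)
  have \<Psi>_tr: "\<Psi> (X \<omega>) = V p / real n * tr n J (2 * q) 0 \<omega>" for \<omega> by (simp add: \<Psi>_def tr_def s_def)
  have lin: "linear_op (m n) (\<lambda>f. (gram_op (m n) s Y J ^^ q) ((T ^^ p) f))" for Y
    unfolding T_def by (rule linear_op_comp[OF linear_op_funpow[OF linear_op_gram_op] linear_op_funpow[OF linear_op_kernel_op]])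
  have "expectation (\<lambda>\<omega>. \<Phi> (X \<omega> j) (X \<omega>)) \<le> expectation (\<lambda>\<omega>. \<Psi> (X \<omega>))"
  proof (rule column_conditional_bound[where \<Phi> = \<Phi> and \<Psi> = \<Psi>, OF j])
    let ?B = "Pi\<^sub>M UNIV (\<lambda>i::nat. borel :: real measure)"
    show "(\<lambda>z. \<Phi> (fst z) (snd z)) \<in> borel_measurable (?B \<Otimes>\<^sub>M Pi\<^sub>M J (\<lambda>_. ?B))"
      unfolding \<Phi>_def T_def
      by (intro borel_measurable_power borel_measurable_times borel_measurable_diff borel_measurable_const closed_ring_ip[OF RB]
          closed_ring_gram_op[OF RB] closed_ring_kernel_op[OF RB] closed_ring_op_trace[OF RB] measurable_coordinates)
    show "\<Psi> \<in> borel_measurable (Pi\<^sub>M J (\<lambda>_. ?B))"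
      unfolding \<Psi>_def
      by (intro borel_measurable_times borel_measurable_const closed_ring_op_trace[OF RB] measurable_coordinates)
    show "0 \<le> \<Phi> x Y" for x Y unfolding \<Phi>_def by simp
    show "0 \<le> \<Psi> Y" for Y
      unfolding \<Psi>_def using s V_nonneg[of p] gram_op_trace_nonneg[OF s, where mm = "m n" and Y = Y and J = J and q = "2 * q"] by simp
    show "\<Phi> x (restrict Y J) = \<Phi> x Y" "\<Psi> (restrict Y J) = \<Psi> Y" for x Y
      by (simp_all add: \<Phi>_def \<Psi>_def gram_op_restrict)
    show "integrable M (\<lambda>\<omega>. \<Phi> (X \<omega> j) (X \<omega>))" unfolding \<Phi>_quad by (rule integrable_sq_diff[OF all_moments_quad all_moments_tr])
    show "integrable M (\<lambda>\<omega>. \<Psi> (X \<omega>))" unfolding \<Psi>_tr by (intro integrable_mult_right all_momentsD[OF all_moments_tr])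
    have amY: "all_moments M (\<lambda>\<omega>. ip (m n) (X \<omega> j) ((gram_op (m n) s Y J ^^ q) ((T ^^ p) (X \<omega> j))))" for Y
      unfolding T_def by (intro closed_ring_ip[OF am_ring] am closed_ring_gram_op[OF am_ring] closed_ring_kernel_op[OF am_ring]
          closed_ringD(1)[where cl = "all_moments M", OF am_ring])
    show "integrable M (\<lambda>\<omega>. \<Phi> (X \<omega> j) Y)" for Y
      unfolding \<Phi>_def power_mult_distrib by (intro integrable_mult_left integrable_sq_diff_const amY)
    show "expectation (\<lambda>\<omega>. \<Phi> (X \<omega> j) Y) \<le> \<Psi> Y" for Y
    proof -
      let ?W = "gram_op (m n) s Y J"
      have "expectation (\<lambda>\<omega>. \<Phi> (X \<omega> j) Y) = expectation (\<lambda>\<omega>. (ip (m n) (X \<omega> j) ((?W ^^ q) ((T ^^ p) (X \<omega> j))) - op_trace (m n) (\<lambda>f. (?W ^^ q) ((T ^^ Suc p) f)))\<^sup>2) * s\<^sup>2"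
        unfolding \<Phi>_def power_mult_distrib by simp
      also have "\<dots> \<le> (K * (2 * C_g\<^sup>2) * hs_norm_sq (m n) (\<lambda>f. (?W ^^ q) ((T ^^ p) f))) * s\<^sup>2"
        using quadratic_form_variance[OF lin, of j Y] unfolding funpow_Suc_right o_def T_def by (rule mult_right_mono) simp
      also have "\<dots> \<le> (K * (2 * C_g\<^sup>2) * ((K * C_g) ^ (2 * p) * hs_norm_sq (m n) (?W ^^ q))) * s\<^sup>2"
        unfolding T_def using K
        by (intro mult_right_mono mult_left_mono hs_norm_sq_kernel_op_funpow_le[OF t_sym t_row_le] linear_op_funpow linear_op_gram_op) auto
      also have "\<dots> = \<Psi> Y"
        by (simp add: \<Psi>_def V_def hs_norm_sq_sym_funpow[OF sym_op_gram_op] power2_eq_square)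
      finally show ?thesis .
    qed
  qed
  then show ?thesis unfolding \<Phi>_quad \<Psi>_tr by simp
qed

text \<open>Reading the form as <A^q x, T^p x> separates T from A at the price of doubling q, and so
  reduces moment bounds for all p to the case p = 0.\<close>

lemma quad_abs_le:
  "\<bar>quad n J j q p \<omega>\<bar> \<le> quad n J j (2 * q) 0 \<omega> + (K * C_g) ^ (2 * p) * quad n J j 0 0 \<omega>"
proof -
  let ?W = "gram_op (m n) (1 / real n) (X \<omega>) J" and ?T = "kernel_op (m n) t" and ?x = "X \<omega> j"
  let ?u = "(?W ^^ q) ?x" and ?v = "(?T ^^ p) ?x"
  have "ip (m n) ?x ((?W ^^ q) ?v) = ip (m n) ?u ?v" by (rule sym_op_funpow[OF sym_op_gram_op])
  moreover have "\<bar>ip (m n) ?u ?v\<bar> \<le> ip (m n) ?u ?u + ip (m n) ?v ?v"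
  proof -
    show ?thesis unfolding ip_def sum.distrib[symmetric] by (rule order_trans[OF sum_abs sum_mono[OF abs_mult_le_squares]])
  qed
  moreover have "ip (m n) ?u ?u = ip (m n) ?x ((?W ^^ (2 * q)) ?x)"
    by (simp add: sym_op_funpow[OF sym_op_gram_op, symmetric] mult_2 funpow_add)
  moreover have "ip (m n) ?v ?v \<le> (K * C_g) ^ (2 * p) * ip (m n) ?x ?x"
    by (rule kernel_op_funpow_norm_le[OF t_sym t_row_le])
  ultimately have "\<bar>ip (m n) ?x ((?W ^^ q) ?v)\<bar> \<le> ip (m n) ?x ((?W ^^ (2 * q)) ?x) + (K * C_g) ^ (2 * p) * ip (m n) ?x ?x"
    by linarith
  then have "\<bar>ip (m n) ?x ((?W ^^ q) ?v)\<bar> / real n \<le> (ip (m n) ?x ((?W ^^ (2 * q)) ?x) + (K * C_g) ^ (2 * p) * ip (m n) ?x ?x) / real n"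
    by (rule divide_right_mono) simp
  then show ?thesis by (simp add: quad_def add_divide_distrib)
qed

section \<open>Moment bounds uniform over all column sets of size at most n\<close>

definition "I2 = {(n, J :: nat set). finite J \<and> card J \<le> n}"
definition "I3 = {(n, J :: nat set, j). finite J \<and> card J \<le> n \<and> j \<notin> J}"

lemma bounded_moments_average:
  assumes G: "bounded_moments I3 (\<lambda>(n, J, j). G n J j)"
  shows "bounded_moments I2 (\<lambda>(n, J) \<omega>. (\<Sum>j\<in>J. G n (J - {j}) j \<omega>) / real n)"
proof -
  have I: "(n, J - {j}, j) \<in> I3" if "(n, J) \<in> I2" "j \<in> J" for n J j
    using that card_Diff1_le[of J j] by (auto simp: I2_def I3_def)
  have am_G: "all_moments M (G n (J - {j}) j)" if "(n, J) \<in> I2" "j \<in> J" for n J j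
    using G I[OF that] by (force simp: bounded_moments_def)
  show ?thesis
    unfolding bounded_moments_def
  proof (intro conjI ballI allI)
    fix i assume "i \<in> I2"
    moreover obtain n J where i: "i = (n, J)" by (cases i)
    ultimately show "all_moments M ((\<lambda>(n, J) \<omega>. (\<Sum>j\<in>J. G n (J - {j}) j \<omega>) / real n) i)"
      unfolding i prod.case
      by (intro all_moments_divide closed_ring_sum[where cl = "all_moments M", OF am_ring] am_G) simp
  next
    fix r
    show "\<exists>C. \<forall>i\<in>I2. expectation (\<lambda>\<omega>. (\<lambda>(n, J) \<omega>. (\<Sum>j\<in>J. G n (J - {j}) j \<omega>) / real n) i \<omega> ^ (2 * r)) \<le> C"
    proof (cases "r = 0")
      case True
      then show ?thesis by (auto intro!: exI[of _ 1] simp: prob_space)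
    next
      case False
      obtain C where C: "\<And>n J j. (n, J, j) \<in> I3 \<Longrightarrow> expectation (\<lambda>\<omega>. G n J j \<omega> ^ (2 * r)) \<le> C"
        using G unfolding bounded_moments_def by force
      have "expectation (\<lambda>\<omega>. ((\<Sum>j\<in>J. G n (J - {j}) j \<omega>) / real n) ^ (2 * r)) \<le> max C 0" if nJ: "(n, J) \<in> I2" for n J
      proof (cases "n = 0")
        case True
        then show ?thesis using False by (simp add: power_0_left)
      next
        case n: False
        have J: "finite J" "card J \<le> n" using nJ by (auto simp: I2_def)
        have int: "integrable M (\<lambda>\<omega>. G n (J - {j}) j \<omega> ^ (2 * r))" if "j \<in> J" for j
          by (rule all_momentsD[OF am_G[OF nJ that]])
        have "expectation (\<lambda>\<omega>. ((\<Sum>j\<in>J. G n (J - {j}) j \<omega>) / real n) ^ (2 * r)) \<le> expectation (\<lambda>\<omega>. (\<Sum>j\<in>J. G n (J - {j}) j \<omega> ^ (2 * r)) / real n)"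
        proof (rule integral_mono)
          show "integrable M (\<lambda>\<omega>. ((\<Sum>j\<in>J. G n (J - {j}) j \<omega>) / real n) ^ (2 * r))"
            by (intro all_momentsD(3) all_moments_divide closed_ring_sum[where cl = "all_moments M", OF am_ring] am_G[OF nJ])
          show "integrable M (\<lambda>\<omega>. (\<Sum>j\<in>J. G n (J - {j}) j \<omega> ^ (2 * r)) / real n)"
            using int by auto
        qed (use average_power_le[OF J] n False in simp)
        also have "\<dots> = (\<Sum>j\<in>J. expectation (\<lambda>\<omega>. G n (J - {j}) j \<omega> ^ (2 * r))) / real n"
          using int by (simp add: Bochner_Integration.integral_sum)
        also have "\<dots> \<le> (\<Sum>j\<in>J. max C 0) / real n"
          using C[OF I[OF nJ]] by (intro divide_right_mono sum_mono) (auto intro: max.coboundedI1)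
        also have "\<dots> = real (card J) / real n * max C 0" by simp
        also have "\<dots> \<le> 1 * max C 0" using J n by (intro mult_right_mono) auto
        finally show ?thesis by simp
      qed
      then show ?thesis by (intro exI[of _ "max C 0"]) auto
    qed
  qed
qed

text \<open>Splitting off the column expresses a form in W through forms in A and forms in W of
  smaller order, and bounded moments survive the sums and products.\<close>

lemma bounded_moments_quad_insert:
  assumes h: "\<And>q. q \<le> k \<Longrightarrow> bounded_moments I3 (\<lambda>(n, J, j). quad n J j q p)"
    and h0: "\<And>q. q < k \<Longrightarrow> bounded_moments I3 (\<lambda>(n, J, j). quad n (insert j J) j q 0)"
  shows "bounded_moments I3 (\<lambda>(n, J, j). quad n (insert j J) j k p)"
proof (rule bounded_moments_dominated)
  let ?Y = "\<lambda>i \<omega>. (\<lambda>(n, J, j). quad n J j k p) i \<omega> + (\<Sum>q<k. (\<lambda>(n, J, j). quad n J j q p) i \<omega> * (\<lambda>(n, J, j). quad n (insert j J) j (k - 1 - q) 0) i \<omega>)"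
  show "bounded_moments I3 ?Y"
    by (intro bounded_moments_add bounded_moments_sum bounded_moments_mult h h0) auto
  show "all_moments M ((\<lambda>(n, J, j). quad n (insert j J) j k p) i)" for i
    by (cases i) (simp add: all_moments_quad)
  show "\<bar>(\<lambda>(n, J, j). quad n (insert j J) j k p) i \<omega>\<bar> \<le> \<bar>?Y i \<omega>\<bar>" if "i \<in> I3" for i \<omega>
  proof -
    obtain n J j where i: "i = (n, J, j)" by (cases i)
    then have "finite J" "j \<notin> J" using that by (simp_all add: I3_def)
    note eq = quad_insert[OF this, of n k p \<omega>]
    show ?thesis unfolding i by (simp only: prod.case eq order.refl)
  qed
qed

lemma tr_Suc_average: "(n, J) \<in> I2 \<Longrightarrow> tr n J (Suc k) p \<omega> = (\<Sum>j\<in>J. quad n (insert j (J - {j})) j k p \<omega>) / real n"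
  unfolding tr_Suc by (intro arg_cong[of _ _ "\<lambda>x. x / real n"] sum.cong refl) (simp add: insert_absorb)

lemma bounded_moments_cong:
  "(\<And>i. i \<in> I \<Longrightarrow> Z i = Y i) \<Longrightarrow> bounded_moments I Z \<longleftrightarrow> bounded_moments I Y"
  unfolding bounded_moments_def by simp

lemma bounded_moments_tr_Suc:
  assumes "bounded_moments I3 (\<lambda>(n, J, j). quad n (insert j J) j k p)"
  shows "bounded_moments I2 (\<lambda>(n, J). tr n J (Suc k) p)"
  using bounded_moments_average[OF assms]
  by (subst bounded_moments_cong[of _ _ "\<lambda>(n, J) \<omega>. (\<Sum>j\<in>J. quad n (insert j (J - {j})) j k p \<omega>) / real n"])
    (auto simp: tr_Suc_average fun_eq_iff)

lemma tr_zero: "tr n J 0 p \<omega> = op_trace (m n) (kernel_op (m n) t ^^ p) / real n"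
  by (simp add: tr_def)

text \<open>Traces and forms bound each other in turn: traces of order q bound the forms in A of
  order q, forms in A up to that order bound the forms in W, and averaging these over the columns
  gives traces of order q + 1.\<close>

lemma bounded_moments_tr0: "bounded_moments I2 (\<lambda>(n, J). tr n J q 0)"
  and bounded_moments_quad0: "bounded_moments I3 (\<lambda>(n, J, j). quad n J j q 0)"
proof -
  have quad: "bounded_moments I3 (\<lambda>(n, J, j). quad n J j q 0)" if tr: "bounded_moments I2 (\<lambda>(n, J). tr n J q 0)" for q
    unfolding bounded_moments_def
  proof (intro conjI ballI allI)
    show "all_moments M ((\<lambda>(n, J, j). quad n J j q 0) i)" for i by (cases i) (simp add: all_moments_quad)
    fix r
    obtain C where C: "\<And>n J. (n, J) \<in> I2 \<Longrightarrow> expectation (\<lambda>\<omega>. tr n J q 0 \<omega> ^ (2 * r)) \<le> C"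
      using tr unfolding bounded_moments_def by force
    let ?D = "c (2 * r) * fact (2 * (2 * r)) * C_g ^ (2 * r)"
    have "expectation (\<lambda>\<omega>. quad n J j q 0 \<omega> ^ (2 * r)) \<le> ?D * C" if "(n, J, j) \<in> I3" for n J j
    proof -
      have "j \<notin> J" "(n, J) \<in> I2" using that by (auto simp: I3_def I2_def)
      then show ?thesis
        using quad_moment_le[of j J n q "2 * r"] mult_left_mono[OF C, of n J ?D] c[of "2 * r"] C_g(2) by simp
    qed
    then show "\<exists>C. \<forall>i\<in>I3. expectation (\<lambda>\<omega>. (\<lambda>(n, J, j). quad n J j q 0) i \<omega> ^ (2 * r)) \<le> C"
      by (intro exI[of _ "?D * C"]) auto
  qed
  have tr: "bounded_moments I2 (\<lambda>(n, J). tr n J q 0)" for q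
  proof (induction q rule: less_induct)
    case (less q)
    note outer = less.IH
    show ?case
    proof (cases q)
      case 0
      \<comment> \<open>With exponent 0 the normalised trace is m n / n, which is bounded because it
        converges.\<close>
      obtain B where B: "\<And>n. \<bar>op_trace (m n) (kernel_op (m n) t ^^ 0) / real n\<bar> \<le> B"
        using convergent_imp_Bseq[OF convergentI[OF Tlim[of 0]]] unfolding Bseq_def real_norm_def by blast
      show ?thesis
        unfolding 0
      proof (rule bounded_moments_dominated[OF bounded_moments_const[of _ B]])
        show "all_moments M ((\<lambda>(n, J). tr n J 0 0) i)" for i by (cases i) (simp add: all_moments_tr)
        show "\<bar>(\<lambda>(n, J). tr n J 0 0) i \<omega>\<bar> \<le> \<bar>B\<bar>" for i \<omega>
          using order_trans[OF B abs_ge_self] by (cases i) (simp only: prod.case tr_zero)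
      qed
    next
      case (Suc k)
      have "bounded_moments I3 (\<lambda>(n, J, j). quad n (insert j J) j k' 0)" if "k' \<le> k" for k'
        using that
      proof (induction k' rule: less_induct)
        case (less k')
        show ?case
        proof (rule bounded_moments_quad_insert)
          fix q assume "q \<le> k'"
          then have "q < Suc k" using less.prems by simp
          then show "bounded_moments I3 (\<lambda>(n, J, j). quad n J j q 0)"
            by (intro quad outer) (simp add: Suc)
        qed (use less in auto)
      qed
      then show ?thesis unfolding Suc by (intro bounded_moments_tr_Suc) simp
    qed
  qed
  show "bounded_moments I2 (\<lambda>(n, J). tr n J q 0)" by (rule tr)
  show "bounded_moments I3 (\<lambda>(n, J, j). quad n J j q 0)" by (rule quad[OF tr])
qed

lemma bounded_moments_quad: "bounded_moments I3 (\<lambda>(n, J, j). quad n J j q p)"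
proof (rule bounded_moments_dominated)
  let ?Y = "\<lambda>i \<omega>. (\<lambda>(n, J, j). quad n J j (2 * q) 0) i \<omega> + (K * C_g) ^ (2 * p) * (\<lambda>(n, J, j). quad n J j 0 0) i \<omega>"
  show "bounded_moments I3 ?Y"
    by (intro bounded_moments_add bounded_moments_mult bounded_moments_const bounded_moments_quad0)
  show "all_moments M ((\<lambda>(n, J, j). quad n J j q p) i)" for i by (cases i) (simp add: all_moments_quad)
  show "\<bar>(\<lambda>(n, J, j). quad n J j q p) i \<omega>\<bar> \<le> \<bar>?Y i \<omega>\<bar>" for i \<omega>
    using order_trans[OF quad_abs_le abs_ge_self] by (cases i) (simp only: prod.case)
qed

lemma bounded_moments_quad_ins: "bounded_moments I3 (\<lambda>(n, J, j). quad n (insert j J) j k p)"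
proof (induction k arbitrary: p rule: less_induct)
  case (less k)
  show ?case by (rule bounded_moments_quad_insert[OF bounded_moments_quad less])
qed

text \<open>Removing a column for the splitting turns d missing columns into at most d + 1, so the
  induction has to cover all such J and d at once. The limit does not depend on them, since a fixed
  number of columns is negligible against n.\<close>

lemma L2_conv_tr:
  assumes J: "\<And>n. finite (J n)" "\<And>n. card (J n) \<le> n" "\<And>n. n \<le> card (J n) + d"
  shows "L2_conv (\<lambda>n. tr n (J n) k p) (loop_limit w k p)"
  using J
proof (induction k arbitrary: p d J rule: less_induct)
  case (less k)
  note IH = less.IH
  show ?case
  proof (cases k)
    case 0
    have "(\<lambda>n. tr n (J n) 0 p) = (\<lambda>n \<omega>. op_trace (m n) (kernel_op (m n) t ^^ p) / real n)"
      by (intro ext) (rule tr_zero)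
    then show ?thesis using L2_conv_deterministic[OF Tlim[of p]] by (simp add: 0)
  next
    case (Suc k')
    \<comment> \<open>Forms in A follow their conditional mean, a trace with one more factor T;
      hence the second index rises by one.\<close>
    have quad: "L2_conv (\<lambda>n. quad n (J n) (j n) q p) (loop_limit w q (Suc p))"
      if J: "\<And>n. finite (J n)" "\<And>n. card (J n) \<le> n" "\<And>n. n \<le> card (J n) + d" and j: "\<And>n. j n \<notin> J n" and q: "q \<le> k'"
      for J j q p d
    proof (rule L2_conv_close)
      show "L2_conv (\<lambda>n. tr n (J n) q (Suc p)) (loop_limit w q (Suc p))"
        by (rule IH[OF _ J]) (use Suc q in auto)
      have in3: "(n, J n, j n) \<in> I3" and in2: "(n, J n) \<in> I2" for n using J j by (auto simp: I3_def I2_def)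
      show "bounded_moments UNIV (\<lambda>n. quad n (J n) (j n) q p)"
        using bounded_moments_reindex[OF bounded_moments_quad[of q p], of UNIV "\<lambda>n. (n, J n, j n)"] in3 by simp
      obtain C where C: "\<And>n. \<bar>expectation (\<lambda>\<omega>. tr n (J n) (2 * q) 0 \<omega>)\<bar> \<le> C"
      proof -
        obtain C where "\<forall>i\<in>I2. expectation (\<lambda>\<omega>. (\<lambda>(n, J). tr n J (2 * q) 0) i \<omega> ^ (2 * 1)) \<le> C"
          using bounded_moments_tr0[of "2 * q", unfolded bounded_moments_def, THEN conjunct2, THEN spec, of 1] by (rule exE)
        then have C: "expectation (\<lambda>\<omega>. (tr n J (2 * q) 0 \<omega>)\<^sup>2) \<le> C" if "(n, J) \<in> I2" for n J
          using bspec[OF _ that] by force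
        have "\<bar>expectation (\<lambda>\<omega>. tr n (J n) (2 * q) 0 \<omega>)\<bar> \<le> 1 + C" for n
        proof -
          have i: "integrable M (tr n (J n) (2 * q) 0)" "integrable M (\<lambda>\<omega>. (tr n (J n) (2 * q) 0 \<omega>)\<^sup>2)"
            by (rule all_momentsD[OF all_moments_tr])+
          have "\<bar>expectation (\<lambda>\<omega>. tr n (J n) (2 * q) 0 \<omega>)\<bar> \<le> expectation (\<lambda>\<omega>. \<bar>tr n (J n) (2 * q) 0 \<omega>\<bar>)"
            by (rule integral_abs_bound)
          also have "\<dots> \<le> expectation (\<lambda>\<omega>. 1 + (tr n (J n) (2 * q) 0 \<omega>)\<^sup>2)"
            using i by (intro integral_mono Bochner_Integration.integrable_add integrable_const integrable_abs abs_le_one_plus_square)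
          also have "\<dots> \<le> 1 + C" using C[OF in2[of n]] i by (simp add: prob_space)
          finally show ?thesis .
        qed
        then show ?thesis by (rule that)
      qed
      have upper: "(\<lambda>n. V p * C * (1 / real n)) \<longlonglongrightarrow> 0"
        using tendsto_mult_left[OF lim_const_over_n[of 1], of "V p * C"] by simp
      show "(\<lambda>n. expectation (\<lambda>\<omega>. (quad n (J n) (j n) q p \<omega> - tr n (J n) q (Suc p) \<omega>)\<^sup>2)) \<longlonglongrightarrow> 0"
      proof (rule tendsto_sandwich[OF _ _ tendsto_const upper])
        show "\<forall>\<^sub>F n in sequentially. expectation (\<lambda>\<omega>. (quad n (J n) (j n) q p \<omega> - tr n (J n) q (Suc p) \<omega>)\<^sup>2) \<le> V p * C * (1 / real n)"
        proof (intro always_eventually allI)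
          fix n
          have "expectation (\<lambda>\<omega>. (quad n (J n) (j n) q p \<omega> - tr n (J n) q (Suc p) \<omega>)\<^sup>2) \<le> V p / real n * expectation (\<lambda>\<omega>. tr n (J n) (2 * q) 0 \<omega>)"
            by (rule quad_variance_le[OF j])
          also have "\<dots> \<le> V p / real n * C"
            using V_nonneg[of p] by (intro mult_left_mono order_trans[OF abs_ge_self C]) auto
          finally show "expectation (\<lambda>\<omega>. (quad n (J n) (j n) q p \<omega> - tr n (J n) q (Suc p) \<omega>)\<^sup>2) \<le> V p * C * (1 / real n)" by simp
        qed
      qed simp
    qed
    \<comment> \<open>Forms in W of order q share the limit of the trace of order q + 1, which is
      their average over the columns.\<close>
    have quad_ins: "L2_conv (\<lambda>n. quad n (insert (j n) (J n)) (j n) q p) (loop_limit w (Suc q) p)"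
      if J: "\<And>n. finite (J n)" "\<And>n. card (J n) \<le> n" "\<And>n. n \<le> card (J n) + d" and j: "\<And>n. j n \<notin> J n" and q: "q \<le> k'"
      for J j q p d
      using q
    proof (induction q arbitrary: p rule: less_induct)
      case (less q)
      have "L2_conv (\<lambda>n \<omega>. quad n (J n) (j n) q p \<omega> + (\<Sum>r<q. quad n (J n) (j n) r p \<omega> * quad n (insert (j n) (J n)) (j n) (q - 1 - r) 0 \<omega>))
        (loop_limit w q (Suc p) + (\<Sum>r<q. loop_limit w r (Suc p) * loop_limit w (Suc (q - 1 - r)) 0))"
        by (intro L2_conv_add L2_conv_sum L2_conv_mult quad[OF J j] less.IH) (use less.prems in auto)
      moreover have "loop_limit w q (Suc p) + (\<Sum>r<q. loop_limit w r (Suc p) * loop_limit w (Suc (q - 1 - r)) 0) = loop_limit w (Suc q) p"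
      proof -
        have "(\<Sum>r<q. loop_limit w r (Suc p) * loop_limit w (Suc (q - 1 - r)) 0) = (\<Sum>r<q. loop_limit w r (Suc p) * (if r = q then 1 else loop_limit w (q - r) 0))"
        proof (rule sum.cong[OF refl])
          fix r assume "r \<in> {..<q}"
          then have "Suc (q - 1 - r) = q - r" "r \<noteq> q" by auto
          then show "loop_limit w r (Suc p) * loop_limit w (Suc (q - 1 - r)) 0 = loop_limit w r (Suc p) * (if r = q then 1 else loop_limit w (q - r) 0)"
            by (simp only: if_False)
        qed
        then show ?thesis by (simp add: lessThan_Suc_atMost[symmetric])
      qed
      moreover have "(\<lambda>n. quad n (insert (j n) (J n)) (j n) q p) = (\<lambda>n \<omega>. quad n (J n) (j n) q p \<omega> + (\<Sum>r<q. quad n (J n) (j n) r p \<omega> * quad n (insert (j n) (J n)) (j n) (q - 1 - r) 0 \<omega>))"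
        by (intro ext) (rule quad_insert[OF J(1) j])
      ultimately show ?case by (simp only:)
    qed
    define \<tau> where "\<tau> = loop_limit w (Suc k') p"
    define f where "f = (\<lambda>n j. expectation (\<lambda>\<omega>. (quad n (insert j (J n - {j})) j k' p \<omega> - \<tau>)\<^sup>2))"
    \<comment> \<open>The worst column of each sample; convergence along it is uniform convergence over all columns.\<close>
    define j where "j = (\<lambda>n. if J n = {} then 0 else (SOME j. j \<in> J n \<and> (\<forall>i\<in>J n. f n i \<le> f n j)))"
    have j: "j n \<in> J n" "\<And>i. i \<in> J n \<Longrightarrow> f n i \<le> f n (j n)" if "J n \<noteq> {}" for n
    proof -
      have "\<exists>j. j \<in> J n \<and> (\<forall>i\<in>J n. f n i \<le> f n j)"
      proof -
        have fin: "finite (f n ` J n)" and "f n ` J n \<noteq> {}" using that less.prems(1)[of n] by auto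
        then have "Max (f n ` J n) \<in> f n ` J n" by (rule Max_in)
        then obtain j where j: "j \<in> J n" "Max (f n ` J n) = f n j" by blast
        have "f n i \<le> f n j" if "i \<in> J n" for i
          using Max_ge[OF fin, of "f n i"] that j(2) by simp
        with j(1) show ?thesis by blast
      qed
      from someI_ex[OF this] that show "j n \<in> J n" "\<And>i. i \<in> J n \<Longrightarrow> f n i \<le> f n (j n)" by (auto simp: j_def)
    qed
    have "L2_conv (\<lambda>n. quad n (insert (j n) (J n - {j n})) (j n) k' p) (loop_limit w (Suc k') p)"
    proof (rule quad_ins)
      show "card (J n - {j n}) \<le> n" for n
        using less.prems(1,2)[of n] card_Diff1_le[of "J n" "j n"] by linarith
      show "n \<le> card (J n - {j n}) + Suc d" for n
        using less.prems(3)[of n] less.prems(1)[of n] by (cases "j n \<in> J n") (auto simp: card_Diff_singleton_if)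
    qed (use less.prems in auto)
    then have f_lim: "(\<lambda>n. f n (j n)) \<longlonglongrightarrow> 0" unfolding f_def \<tau>_def by (rule L2_convD)
    show ?thesis
      unfolding Suc
    proof (rule L2_convI)
      have in2: "(n, J n) \<in> I2" for n using less.prems by (auto simp: I2_def)
      show "bounded_moments UNIV (\<lambda>n. tr n (J n) (Suc k') p)"
        using bounded_moments_reindex[OF bounded_moments_tr_Suc[OF bounded_moments_quad_ins[of k' p]], of UNIV "\<lambda>n. (n, J n)"] in2 by simp
      have "(\<lambda>n. 2 * f n (j n) + 2 * (\<tau> * (real d * (1 / real n)))\<^sup>2) \<longlonglongrightarrow> 2 * 0 + 2 * (\<tau> * (real d * 0))\<^sup>2"
        by (intro tendsto_intros f_lim lim_const_over_n)
      then show "(\<lambda>n. 2 * f n (j n) + 2 * (\<tau> * (real d * (1 / real n)))\<^sup>2) \<longlonglongrightarrow> 0" by simp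
      show "\<forall>\<^sub>F n in sequentially. expectation (\<lambda>\<omega>. (tr n (J n) (Suc k') p \<omega> - loop_limit w (Suc k') p)\<^sup>2) \<le> 2 * f n (j n) + 2 * (\<tau> * (real d * (1 / real n)))\<^sup>2"
      \<comment> \<open>From d + 1 on the set \<open>J n\<close> is nonempty, so a worst column
        exists.\<close>
      proof (rule eventually_sequentiallyI[of "Suc d"])
        fix n assume n: "Suc d \<le> n"
        have n0: "n \<ge> 1" using n by simp
        have ne: "J n \<noteq> {}" using n less.prems(3)[of n] by auto
        define N where "N = real (card (J n))"
        have N: "N \<le> real n" "real n \<le> N + real d" using less.prems(2,3)[of n] by (simp_all add: N_def flip: of_nat_add)
        let ?u = "\<lambda>j \<omega>. quad n (insert j (J n - {j})) j k' p \<omega> - \<tau>"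
        have int: "integrable M (\<lambda>\<omega>. (?u j \<omega>)\<^sup>2)" for j by (rule integrable_sq_diff_const[OF all_moments_quad])
        have "expectation (\<lambda>\<omega>. (tr n (J n) (Suc k') p \<omega> - loop_limit w (Suc k') p)\<^sup>2)
          \<le> expectation (\<lambda>\<omega>. 2 * ((\<Sum>j\<in>J n. (?u j \<omega>)\<^sup>2) / real n) + 2 * (\<tau> * (real d * (1 / real n)))\<^sup>2)"
        proof (rule integral_mono)
          show "integrable M (\<lambda>\<omega>. (tr n (J n) (Suc k') p \<omega> - loop_limit w (Suc k') p)\<^sup>2)"
            by (rule integrable_sq_diff_const[OF all_moments_tr])
          show "integrable M (\<lambda>\<omega>. 2 * ((\<Sum>j\<in>J n. (?u j \<omega>)\<^sup>2) / real n) + 2 * (\<tau> * (real d * (1 / real n)))\<^sup>2)"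
            using int by auto
          fix \<omega>
          \<comment> \<open>Dividing by n instead of \<open>card (J n)\<close> leaves a
            deterministic error \<tau> (N / n - 1), of size at most |\<tau>| d / n.\<close>
          have "tr n (J n) (Suc k') p \<omega> - \<tau> = (\<Sum>j\<in>J n. ?u j \<omega>) / real n + \<tau> * (N / real n - 1)"
            using n0 by (simp add: tr_Suc_average[OF in2] sum_subtractf N_def field_simps)
          then have "(tr n (J n) (Suc k') p \<omega> - \<tau>)\<^sup>2 \<le> 2 * ((\<Sum>j\<in>J n. ?u j \<omega>) / real n)\<^sup>2 + 2 * (\<tau> * (N / real n - 1))\<^sup>2"
            by (simp only: square_add_le)
          also have "((\<Sum>j\<in>J n. ?u j \<omega>) / real n)\<^sup>2 \<le> (\<Sum>j\<in>J n. (?u j \<omega>)\<^sup>2) / real n"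
            using average_power_le[OF less.prems(1,2) n0, of 1 "\<lambda>j. ?u j \<omega>"] by simp
          also have "(\<tau> * (N / real n - 1))\<^sup>2 \<le> (\<tau> * (real d * (1 / real n)))\<^sup>2"
          proof -
            have "N / real n \<le> 1" "1 \<le> (N + real d) / real n" using N n0 by simp_all
            then have "\<bar>N / real n - 1\<bar> \<le> \<bar>real d * (1 / real n)\<bar>" by (simp add: add_divide_distrib)
            then have "\<bar>\<tau> * (N / real n - 1)\<bar> \<le> \<bar>\<tau> * (real d * (1 / real n))\<bar>"
              unfolding abs_mult[of \<tau>] by (rule mult_left_mono) simp
            then show ?thesis by (simp only: abs_le_square_iff)
          qed
          finally show "(tr n (J n) (Suc k') p \<omega> - loop_limit w (Suc k') p)\<^sup>2 \<le> 2 * ((\<Sum>j\<in>J n. (?u j \<omega>)\<^sup>2) / real n) + 2 * (\<tau> * (real d * (1 / real n)))\<^sup>2"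
            by (simp add: \<tau>_def)
        qed
        also have "\<dots> = 2 * ((\<Sum>j\<in>J n. f n j) / real n) + 2 * (\<tau> * (real d * (1 / real n)))\<^sup>2"
          using int by (simp add: prob_space f_def)
        also have "(\<Sum>j\<in>J n. f n j) / real n \<le> (\<Sum>i\<in>J n. f n (j n)) / real n"
          by (intro divide_right_mono sum_mono j(2)[OF ne]) auto
        also have "(\<Sum>i\<in>J n. f n (j n)) / real n = N / real n * f n (j n)" by (simp add: N_def)
        also have "\<dots> \<le> 1 * f n (j n)"
          using N n0 by (intro mult_right_mono) (auto simp: f_def)
        finally show "expectation (\<lambda>\<omega>. (tr n (J n) (Suc k') p \<omega> - loop_limit w (Suc k') p)\<^sup>2) \<le> 2 * f n (j n) + 2 * (\<tau> * (real d * (1 / real n)))\<^sup>2"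
          by simp
      qed
    qed
  qed
qed

end

section \<open>Fourth moments\<close>

text \<open>For i <= k <= l <= r let u be the total length of the two outer gaps and v the middle
  gap. Then \<open>near\<close> together with the decay of t gives \<alpha>^u, \<open>gap\<close>
  gives \<alpha>^v, and the target exponent is u + 2v, at most four times the larger of u and v; the
  fourth root g pays for this. If the pairs interlace or are nested, \<open>near\<close> for the
  sorted indices already has the target exponent.\<close>

lemma four_index_bound_ordered:
  fixes E :: "nat \<Rightarrow> nat \<Rightarrow> nat \<Rightarrow> nat \<Rightarrow> real"
  assumes g: "0 \<le> g" "g \<le> 1" and \<alpha>: "\<alpha> = g ^ 4" and C: "0 \<le> C" and K: "0 \<le> K"
    and swap: "\<And>i k l r. E i k l r = E i l k r" "\<And>i k l r. E i k l r = E i k r l"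
    and t: "\<And>i l. \<bar>t i l\<bar> \<le> K * \<alpha> ^ ndist i l"
    and near: "\<And>i k l r. i \<le> k \<Longrightarrow> k \<le> l \<Longrightarrow> l \<le> r \<Longrightarrow> \<bar>E i k l r\<bar> \<le> C * \<alpha> ^ ((k - i) + (r - l))"
    and gap: "\<And>i k l r. i \<le> k \<Longrightarrow> k \<le> l \<Longrightarrow> l \<le> r \<Longrightarrow> \<bar>E i k l r - t i k * t l r\<bar> \<le> C * \<alpha> ^ (l - k)"
    and ord: "i \<le> k" "l \<le> r" "i \<le> l"
  shows "\<bar>E i k l r - t i k * t l r\<bar> \<le> (C + K\<^sup>2) * (g ^ ndist i l * g ^ ndist k r)"
proof -
  define Q where "Q = C + K\<^sup>2"
  have Q: "C \<le> Q" "0 \<le> Q" using C by (simp_all add: Q_def)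
  have pow: "Q * \<alpha> ^ u \<le> Q * g ^ v" if "v \<le> 4 * u" for u v
    unfolding \<alpha> power_mult[symmetric] by (intro mult_left_mono power_decreasing that g Q)
  have tt: "\<bar>t i k * t l r\<bar> \<le> K\<^sup>2 * \<alpha> ^ ((k - i) + (r - l))"
  proof -
    have "\<bar>t i k\<bar> * \<bar>t l r\<bar> \<le> (K * \<alpha> ^ ndist i k) * (K * \<alpha> ^ ndist l r)"
      using g K by (intro mult_mono t) (auto simp: \<alpha>)
    moreover have "ndist i k = k - i" "ndist l r = r - l" using ord by (simp_all add: ndist_le)
    ultimately show ?thesis by (simp only: abs_mult power_add power2_eq_square mult_ac)
  qed
  have a0: "0 \<le> \<alpha> ^ u" "\<alpha> \<le> 1" for u using g by (simp_all add: \<alpha> power_le_one)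
  have both: "\<bar>E i k l r - t i k * t l r\<bar> \<le> Q * \<alpha> ^ u"
    if "\<bar>E i k l r\<bar> \<le> C * \<alpha> ^ v" "u \<le> v" "u \<le> (k - i) + (r - l)" for u v
  proof -
    have "C * \<alpha> ^ v \<le> C * \<alpha> ^ u" "K\<^sup>2 * \<alpha> ^ ((k - i) + (r - l)) \<le> K\<^sup>2 * \<alpha> ^ u"
      using that a0(1)[of 1] a0(2) C by (auto intro!: mult_left_mono power_decreasing)
    then show ?thesis
      using that(1) tt abs_triangle_ineq4[of "E i k l r" "t i k * t l r"] by (simp add: Q_def distrib_right)
  qed
  have goal: "\<bar>E i k l r - t i k * t l r\<bar> \<le> Q * g ^ (ndist i l + ndist k r)"
  proof (cases "k \<le> l")
    case True
    define u where "u = (k - i) + (r - l)"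
    define v where "v = l - k"
    have 1: "\<bar>E i k l r - t i k * t l r\<bar> \<le> Q * \<alpha> ^ u"
      by (rule both[OF near]) (use ord True in \<open>auto simp: u_def\<close>)
    have 2: "\<bar>E i k l r - t i k * t l r\<bar> \<le> Q * \<alpha> ^ v"
    proof (rule order.trans[OF gap])
      show "C * \<alpha> ^ (l - k) \<le> Q * \<alpha> ^ v" unfolding v_def using Q a0(1) by (rule_tac mult_right_mono) auto
    qed (use ord True in auto)
    have d: "ndist i l + ndist k r \<le> 2 * (u + v)"
      using ord True by (simp add: ndist_le u_def v_def)
    show ?thesis
    proof (cases "u \<le> v")
      case True
      show ?thesis by (rule order.trans[OF 2 pow]) (use True d in simp)
    next
      case False
      show ?thesis by (rule order.trans[OF 1 pow]) (use False d in simp)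
    qed
  next
    case False
    show ?thesis
    proof (cases "k \<le> r")
      case True
      have "\<bar>E i l k r\<bar> \<le> C * \<alpha> ^ ((l - i) + (r - k))"
        by (rule near) (use ord False True in auto)
      then have "\<bar>E i k l r\<bar> \<le> C * \<alpha> ^ ((l - i) + (r - k))" using swap(1)[of i k l r] by simp
      then have "\<bar>E i k l r - t i k * t l r\<bar> \<le> Q * \<alpha> ^ ((l - i) + (r - k))"
        by (rule both) (use ord False True in auto)
      then show ?thesis
        by (rule order.trans[OF _ pow]) (use ord False True in \<open>simp add: ndist_le\<close>)
    next
      case k: False
      have "\<bar>E i l r k\<bar> \<le> C * \<alpha> ^ ((l - i) + (k - r))"
        by (rule near) (use ord k in auto)
      then have "\<bar>E i k l r\<bar> \<le> C * \<alpha> ^ ((l - i) + (k - r))"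
        using swap(1)[of i k l r] swap(2)[of i l k r] by simp
      then have "\<bar>E i k l r - t i k * t l r\<bar> \<le> Q * \<alpha> ^ ((l - i) + (k - r))"
        by (rule both) (use ord False k in auto)
      then show ?thesis
        by (rule order.trans[OF _ pow]) (use ord False k in \<open>simp add: ndist_le ndist_ge\<close>)
    qed
  qed
  then show ?thesis by (simp add: Q_def power_add)
qed

text \<open>Exchanging i with k, l with r, or the two pairs leaves the left-hand side unchanged, and
  adding the second linking pairing makes the bound equally invariant. These symmetries reduce every
  order of the indices to the one already treated.\<close>

lemma four_index_bound:
  fixes E :: "nat \<Rightarrow> nat \<Rightarrow> nat \<Rightarrow> nat \<Rightarrow> real"
  assumes g: "0 \<le> g" "g \<le> 1" and \<alpha>: "\<alpha> = g ^ 4" and C: "0 \<le> C" and K: "0 \<le> K"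
    and swap: "\<And>i k l r. E i k l r = E i l k r" "\<And>i k l r. E i k l r = E i k r l" "\<And>i k l r. E i k l r = E k i l r"
    and t: "\<And>i l. \<bar>t i l\<bar> \<le> K * \<alpha> ^ ndist i l" and t_sym: "\<And>i l. t i l = t l i"
    and near: "\<And>i k l r. i \<le> k \<Longrightarrow> k \<le> l \<Longrightarrow> l \<le> r \<Longrightarrow> \<bar>E i k l r\<bar> \<le> C * \<alpha> ^ ((k - i) + (r - l))"
    and gap: "\<And>i k l r. i \<le> k \<Longrightarrow> k \<le> l \<Longrightarrow> l \<le> r \<Longrightarrow> \<bar>E i k l r - t i k * t l r\<bar> \<le> C * \<alpha> ^ (l - k)"
  shows "\<bar>E i k l r - t i k * t l r\<bar> \<le> (C + K\<^sup>2) * (g ^ ndist i l * g ^ ndist k r + g ^ ndist i r * g ^ ndist k l)"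
proof -
  define B where "B = (\<lambda>i k l r. (C + K\<^sup>2) * (g ^ ndist i l * g ^ ndist k r + g ^ ndist i r * g ^ ndist k l))"
  define D where "D = (\<lambda>i k l r. \<bar>E i k l r - t i k * t l r\<bar>)"
  have base: "D i k l r \<le> B i k l r" if "i \<le> k" "l \<le> r" "i \<le> l" for i k l r
  proof -
    have "D i k l r \<le> (C + K\<^sup>2) * (g ^ ndist i l * g ^ ndist k r)"
      unfolding D_def by (rule four_index_bound_ordered[OF g \<alpha> C K swap(1,2) t near gap that])
    also have "\<dots> \<le> B i k l r"
      unfolding B_def using g C by (intro mult_left_mono) auto
    finally show ?thesis .
  qed
  have s1: "D i k l r = D k i l r" "B i k l r = B k i l r" for i k l r
    using swap(3)[of i k l r] t_sym[of i k] by (simp_all add: D_def B_def add.commute mult.commute)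
  have s2: "D i k l r = D i k r l" "B i k l r = B i k r l" for i k l r
    using swap(2)[of i k l r] t_sym[of l r] by (simp_all add: D_def B_def add.commute)
  have s3: "D i k l r = D l r i k" "B i k l r = B l r i k" for i k l r
  proof -
    have "E i k l r = E i l k r" by (rule swap)
    also have "\<dots> = E l i k r" by (rule swap)
    also have "\<dots> = E l i r k" by (rule swap)
    also have "\<dots> = E l r i k" by (rule swap)
    finally show "D i k l r = D l r i k" by (simp add: D_def mult.commute)
    show "B i k l r = B l r i k"
      by (simp add: B_def ndist_commute[of l i] ndist_commute[of r k] ndist_commute[of l k] ndist_commute[of r i] mult.commute)
  qed
  have step2: "D i k l r \<le> B i k l r" if "i \<le> k" "l \<le> r" for i k l r
    using base[of i k l r] base[of l r i k] s3[of i k l r] that by (cases "i \<le> l") auto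
  have step1: "D i k l r \<le> B i k l r" if "i \<le> k" for i k l r
    using step2[of i k l r] step2[of i k r l] s2[of i k l r] that by (cases "l \<le> r") auto
  have "D i k l r \<le> B i k l r"
    using step1[of i k l r] step1[of k i l r] s1[of i k l r] by (cases "i \<le> k") auto
  then show ?thesis by (simp add: D_def B_def)
qed

text \<open>A single pair can only be {1, 2} itself. The remainder in (A1) therefore vanishes for k
  = 1, and second moments are exactly covariances.\<close>

lemma S_perm_1_1: "S_perm 1 1 = {}"
proof -
  have False if \<sigma>: "\<sigma> \<in> S_perm 1 1" for \<sigma>
  proof -
    have p: "\<sigma> permutes {1..2::nat}" and ne: "{\<sigma> 1, \<sigma> 2} \<noteq> {1, 2::nat}"
      using \<sigma> by (auto simp: S_perm_def)
    have "{1..2} = {1, 2::nat}" by auto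
    then have "\<sigma> ` {1, 2} = {1, 2}" using permutes_image[OF p] by simp
    then show False using ne by simp
  qed
  then show ?thesis by auto
qed

text \<open>A permutation in $S^j_4$ matches some index of the first pair with one of the second.\<close>

lemma S_perm_2_prod_le:
  fixes ix :: "nat \<Rightarrow> nat" and \<alpha> :: real
  assumes \<sigma>: "\<sigma> \<in> S_perm j 2" and j: "j \<in> {1..2}" and \<alpha>: "0 \<le> \<alpha>" "\<alpha> \<le> 1" and mono: "mono_on {1..4} ix"
  shows "(\<Prod>l=1..j. \<alpha> ^ nat \<bar>int (ix (\<sigma> (2 * l - 1))) - int (ix (\<sigma> (2 * l)))\<bar>) \<le> \<alpha> ^ (ix 3 - ix 2)"
proof -
  let ?f = "\<lambda>l. \<alpha> ^ nat \<bar>int (ix (\<sigma> (2 * l - 1))) - int (ix (\<sigma> (2 * l)))\<bar>"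
  have p: "\<sigma> permutes {1..4}" using \<sigma> by (simp add: S_perm_def)
  obtain l where l: "l \<in> {1..j}" and ne: "{\<sigma> (2 * l - 1), \<sigma> (2 * l)} \<noteq> {1, 2}" "{\<sigma> (2 * l - 1), \<sigma> (2 * l)} \<noteq> {3, 4}"
  proof -
    obtain l where l: "l \<in> {1..j}" "\<forall>l'\<in>{1..2}. {\<sigma> (2 * l - 1), \<sigma> (2 * l)} \<noteq> {2 * l' - 1, 2 * l'}"
      using \<sigma> by (auto simp: S_perm_def)
    show ?thesis by (rule that[OF l(1)]) (use l(2)[rule_format, of 1] l(2)[rule_format, of 2] in auto)
  qed
  define u where "u = \<sigma> (2 * l - 1)"
  define v where "v = \<sigma> (2 * l)"
  have lr: "2 * l - 1 \<in> {1..4}" "2 * l \<in> {1..4}" "2 * l - 1 \<noteq> 2 * l" using l j by auto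
  have uv: "u \<in> {1..4}" "v \<in> {1..4}" "u \<noteq> v"
    using lr permutes_in_image[OF p] permutes_inj[OF p] by (auto simp: u_def v_def dest: injD)
  have "1 \<le> u \<and> u \<le> 4" "1 \<le> v \<and> v \<le> 4" using uv by simp_all
  then have "u = 1 \<or> u = 2 \<or> u = 3 \<or> u = 4" "v = 1 \<or> v = 2 \<or> v = 3 \<or> v = 4" by presburger+
  moreover have "{u, v} \<noteq> {1, 2}" "{u, v} \<noteq> {3, 4}" using ne by (simp_all only: u_def v_def not_False_eq_True)
  ultimately have cases: "(u \<le> 2 \<and> 3 \<le> v) \<or> (v \<le> 2 \<and> 3 \<le> u)"
    using uv(3) by (elim disjE) (simp_all add: insert_commute)
  have "ix 3 - ix 2 \<le> nat \<bar>int (ix u) - int (ix v)\<bar>"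
    using cases
  proof
    assume *: "u \<le> 2 \<and> 3 \<le> v"
    have "ix u \<le> ix 2" "ix 3 \<le> ix v" using * uv by (auto intro!: mono_onD[OF mono])
    then show ?thesis by linarith
  next
    assume *: "v \<le> 2 \<and> 3 \<le> u"
    have "ix v \<le> ix 2" "ix 3 \<le> ix u" using * uv by (auto intro!: mono_onD[OF mono])
    then show ?thesis by linarith
  qed
  then have fl: "?f l \<le> \<alpha> ^ (ix 3 - ix 2)"
    unfolding u_def v_def by (intro power_decreasing \<alpha>)
  have "(\<Prod>l=1..j. ?f l) = ?f l * (\<Prod>i\<in>{1..j} - {l}. ?f i)" by (rule prod.remove) (use l in auto)
  also have "\<dots> \<le> ?f l * 1" by (intro mult_left_mono prod_le_1) (use \<alpha> in \<open>auto simp: power_le_one\<close>)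
  finally show ?thesis using fl by simp
qed

section \<open>Covariance decay from the moment conditions\<close>

text \<open>Row sums bound the kernel operator in the supremum norm, in which unit vectors have norm
  1. The estimate yields the geometric growth of the H_p.\<close>

lemma (in covariance_decay) op_trace_kernel_op_funpow_le:
  "\<bar>op_trace mm (kernel_op mm t ^^ p)\<bar> \<le> real mm * (K * C_g) ^ p"
proof -
  have KC: "0 \<le> K * C_g" using K C_g by simp
  have entry: "\<bar>(kernel_op mm t ^^ p) f i\<bar> \<le> (K * C_g) ^ p" if f: "\<And>i. \<bar>f i\<bar> \<le> 1" for f i
  proof (induction p arbitrary: i)
    case (Suc p)
    have "\<bar>(kernel_op mm t ^^ Suc p) f i\<bar> \<le> (\<Sum>l<mm. \<bar>t i l\<bar> * (K * C_g) ^ p)"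
      unfolding funpow.simps o_def kernel_op_def[of _ _ "_ _"]
      by (rule order.trans[OF sum_abs]) (auto simp: abs_mult intro!: sum_mono mult_left_mono Suc)
    also have "\<dots> \<le> K * C_g * (K * C_g) ^ p"
      unfolding sum_distrib_right[symmetric] using KC by (intro mult_right_mono t_row_le) auto
    finally show ?case by simp
  qed (use f in simp)
  have "\<bar>op_trace mm (kernel_op mm t ^^ p)\<bar> \<le> (\<Sum>i<mm. (K * C_g) ^ p)"
    unfolding op_trace_def by (rule order.trans[OF sum_abs sum_mono]) (rule entry, simp add: unit_fun_def)
  then show ?thesis by simp
qed

section \<open>The sample covariance matrix as a Gram operator\<close>

lemma W_mat_carrier: "W_mat a m n \<omega> \<in> carrier_mat m m"
  unfolding W_mat_def data_mat_def by (rule smult_carrier_mat, rule mult_carrier_mat[of _ m n]) simp_all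

lemma W_mat_entry:
  assumes "i < m" "l < m"
  shows "W_mat a m n \<omega> $$ (i, l) = gram_op m (1 / real n) (\<lambda>j i. a i j \<omega>) {..<n} (unit_fun l) i"
proof -
  have "W_mat a m n \<omega> $$ (i, l) = 1 / real n * (\<Sum>j<n. a i j \<omega> * a l j \<omega>)"
    using assms by (simp add: W_mat_def data_mat_def scalar_prod_def atLeast0LessThan)
  also have "\<dots> = gram_op m (1 / real n) (\<lambda>j i. a i j \<omega>) {..<n} (unit_fun l) i"
    unfolding gram_op_def sum_distrib_left using assms by (intro sum.cong refl) (simp add: ip_unit_fun)
  finally show ?thesis .
qed

lemma W_mat_sym: "(W_mat a m n \<omega>)\<^sup>T = W_mat a m n \<omega>"
proof (rule eq_matI)
  show "(W_mat a m n \<omega>)\<^sup>T $$ (i, l) = W_mat a m n \<omega> $$ (i, l)"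
    if "i < dim_row (W_mat a m n \<omega>)" "l < dim_col (W_mat a m n \<omega>)" for i l
  proof -
    have il: "i < m" "l < m" using that W_mat_carrier[of a m n \<omega>] by auto
    then have "(W_mat a m n \<omega>)\<^sup>T $$ (i, l) = W_mat a m n \<omega> $$ (l, i)" using W_mat_carrier[of a m n \<omega>] by simp
    also have "\<dots> = W_mat a m n \<omega> $$ (i, l)"
      using il by (simp add: W_mat_entry gram_op_def ip_unit_fun mult_ac)
    finally show ?thesis .
  qed
  show "dim_row (W_mat a m n \<omega>)\<^sup>T = dim_row (W_mat a m n \<omega>)" "dim_col (W_mat a m n \<omega>)\<^sup>T = dim_col (W_mat a m n \<omega>)"
    using carrier_matD[OF W_mat_carrier[of a m n \<omega>]] by simp_all
qed

lemma mat_trace_W_mat: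
  "mat_trace (W_mat a m n \<omega> ^\<^sub>m k) = op_trace m (gram_op m (1 / real n) (\<lambda>j i. a i j \<omega>) {..<n} ^^ k)"
proof (rule op_trace_funpow_eq_mat_trace[symmetric])
  show "W_mat a m n \<omega> \<in> carrier_mat m m" by (rule W_mat_carrier)
  show "linear_op m (gram_op m (1 / real n) (\<lambda>j i. a i j \<omega>) {..<n})" by (rule linear_op_gram_op)
qed (simp add: W_mat_entry)

text \<open>Everything is proved for column 0 and carried to the other columns by equality in law;
  the constants for k = 1 and k = 2 are merged into a single \<open>K\<close>.\<close>

lemma covariance_decay_of_moment_conditions:
  fixes M :: "'w measure" and a :: "nat \<Rightarrow> nat \<Rightarrow> 'w \<Rightarrow> real"
  assumes P: "prob_space M"
    and rv: "\<And>i j. a i j \<in> borel_measurable M"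
    and moments: "\<And>i k. integrable M (\<lambda>\<omega>. a i 0 \<omega> ^ k)"
    and indep: "prob_space.indep_vars M (\<lambda>j. Pi\<^sub>M UNIV (\<lambda>i. borel)) (\<lambda>j \<omega>. \<lambda>i. a i j \<omega>) UNIV"
    and ident: "\<And>j. distr M (Pi\<^sub>M UNIV (\<lambda>i. borel)) (\<lambda>\<omega> i. a i j \<omega>) = distr M (Pi\<^sub>M UNIV (\<lambda>i. borel)) (\<lambda>\<omega> i. a i 0 \<omega>)"
    and \<alpha>: "0 \<le> \<alpha>" "\<alpha> < 1" and c0: "\<And>k. k \<ge> 1 \<Longrightarrow> 0 \<le> c k"
    and A1: "\<And>k ix. k \<ge> 1 \<Longrightarrow> mono_on {1..2*k} ix \<Longrightarrow>
        \<bar>(\<integral>\<omega>. (\<Prod>p=1..2*k. a (ix p) 0 \<omega>) \<partial>M) - (\<Prod>l=1..k. cov M (a (ix (2*l - 1)) 0) (a (ix (2*l)) 0))\<bar>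
        \<le> c k * (\<Sum>j=1..k. \<Sum>\<sigma>\<in>S_perm j k. \<Prod>l=1..j. \<alpha> ^ nat \<bar>int (ix (\<sigma> (2*l - 1))) - int (ix (\<sigma> (2*l)))\<bar>)"
    and A2: "\<And>k ix. k \<ge> 1 \<Longrightarrow> mono_on {1..2*k} ix \<Longrightarrow>
        \<bar>(\<integral>\<omega>. (\<Prod>p=1..2*k. a (ix p) 0 \<omega>) \<partial>M)\<bar> \<le> c k * (\<Prod>l=1..k. \<alpha> ^ nat \<bar>int (ix (2*l - 1)) - int (ix (2*l))\<bar>)"
  shows "\<exists>g K c. covariance_decay M a (\<lambda>i l. cov M (a i 0) (a l 0)) g K c"
proof -
  interpret prob_space M by fact
  let ?S = "Pi\<^sub>M UNIV (\<lambda>i::nat. borel :: real measure)"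
  have col: "(\<lambda>\<omega> i. a i j \<omega>) \<in> M \<rightarrow>\<^sub>M ?S" for j
    by (rule measurable_PiM_single') (use rv in auto)
  have coord: "(\<lambda>x. x i) \<in> borel_measurable ?S" for i :: nat
    by (rule measurable_component_singleton) simp
  have col_eq: "expectation (\<lambda>\<omega>. \<phi> (\<lambda>i. a i j \<omega>)) = expectation (\<lambda>\<omega>. \<phi> (\<lambda>i. a i 0 \<omega>))"
    if "\<phi> \<in> borel_measurable ?S" for \<phi> :: "(nat \<Rightarrow> real) \<Rightarrow> real" and j
    using integral_distr[OF col[of j] that] integral_distr[OF col[of 0] that] ident[of j] by simp
  have am: "all_moments M (a i j)" for i j
    unfolding all_moments_def
  proof (intro conjI allI rv)
    fix k
    have \<phi>: "(\<lambda>x. x i ^ k) \<in> borel_measurable ?S" using coord[of i] by (rule borel_measurable_power)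
    show "integrable M (\<lambda>\<omega>. a i j \<omega> ^ k)"
      using integrable_distr_eq[OF col[of j] \<phi>] integrable_distr_eq[OF col[of 0] \<phi>] ident[of j] moments[of i k] by simp
  qed
  define t where "t = (\<lambda>i l. cov M (a i 0) (a l 0))"
  have t_sym: "t i l = t l i" for i l by (simp add: t_def cov_def mult.commute)
  have dist: "nat \<bar>int i - int l\<bar> = ndist i l" for i l by (simp add: ndist_def)
  \<comment> \<open>The fourth root asked for by the four-index estimate; since \<alpha> <= g it
    serves for all other bounds too.\<close>
  define g where "g = sqrt (sqrt \<alpha>)"
  have g: "0 \<le> g" "g < 1" using \<alpha> by (simp_all add: g_def)
  have g4: "\<alpha> = g ^ 4"
  proof -
    have "g ^ 4 = (g\<^sup>2)\<^sup>2" by simp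
    then show ?thesis using \<alpha> by (simp add: g_def)
  qed
  have \<alpha>_le_g: "\<alpha> ^ u \<le> g ^ u" for u
    using power_decreasing[of 1 4 g] g by (intro power_mono) (auto simp: g4)
  define E2 where "E2 = (\<lambda>i l. expectation (\<lambda>\<omega>. a i 0 \<omega> * a l 0 \<omega>))"
  have E2: "E2 i l = t i l \<and> \<bar>t i l\<bar> \<le> c 1 * \<alpha> ^ ndist i l" for i l
  proof -
    have ordered: "E2 i l = t i l \<and> \<bar>t i l\<bar> \<le> c 1 * \<alpha> ^ ndist i l" if "i \<le> l" for i l
    proof -
      define ix where "ix = (\<lambda>p::nat. if p = 1 then i else l)"
      have mono: "mono_on {1..2 * 1} ix" using that by (auto simp: mono_on_def ix_def)
      have "{1..2 * 1} = {1, 2::nat}" by auto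
      then have prod: "(\<Prod>p=1..2 * 1. a (ix p) 0 \<omega>) = a i 0 \<omega> * a l 0 \<omega>" for \<omega> by (simp add: ix_def)
      have "\<bar>E2 i l - t i l\<bar> \<le> 0"
        using A1[OF order.refl mono] unfolding prod E2_def t_def
        by (simp add: S_perm_1_1[unfolded One_nat_def] ix_def)
      moreover have "\<bar>E2 i l\<bar> \<le> c 1 * \<alpha> ^ ndist i l"
        using A2[OF order.refl mono] unfolding prod E2_def dist by (simp add: ix_def)
      ultimately show ?thesis by simp
    qed
    show ?thesis
    proof (cases "i \<le> l")
      case False
      then have "E2 l i = t l i \<and> \<bar>t l i\<bar> \<le> c 1 * \<alpha> ^ ndist l i" by (intro ordered) simp
      moreover have "E2 i l = E2 l i" by (simp add: E2_def mult.commute)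
      ultimately show ?thesis by (simp add: t_sym ndist_commute)
    qed (rule ordered)
  qed
  define E4 where "E4 = (\<lambda>i k l r. expectation (\<lambda>\<omega>. a i 0 \<omega> * a k 0 \<omega> * (a l 0 \<omega> * a r 0 \<omega>)))"
  define N where "N = real (card (S_perm 1 2) + card (S_perm 2 2))"
  \<comment> \<open>One constant for both conditions: it dominates \<open>c 2\<close> from (A2) as
    well as \<open>c 2 * N\<close> from (A1), where \<open>N\<close> counts the permutations in the
    remainder.\<close>
  define C where "C = c 2 * max 1 N"
  have C: "0 \<le> C" "c 2 \<le> C" "c 2 * N \<le> C"
    using c0[of 2] mult_left_mono[of 1 "max 1 N" "c 2"] mult_left_mono[of N "max 1 N" "c 2"] by (auto simp: C_def)
  have E4: "\<bar>E4 i k l r - t i k * t l r\<bar> \<le> C * \<alpha> ^ (l - k) \<and> \<bar>E4 i k l r\<bar> \<le> C * \<alpha> ^ ((k - i) + (r - l))"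
    if "i \<le> k" "k \<le> l" "l \<le> r" for i k l r
  proof -
    define ix where "ix = (\<lambda>p::nat. if p = 1 then i else if p = 2 then k else if p = 3 then l else r)"
    have mono4: "mono_on {1..4} ix" using that by (auto simp: mono_on_def ix_def)
    then have mono: "mono_on {1..2 * 2} ix" by simp
    have "{1..2 * 2} = {1, 2, 3, 4::nat}" by auto
    then have prod: "(\<Prod>p=1..2 * 2. a (ix p) 0 \<omega>) = a i 0 \<omega> * a k 0 \<omega> * (a l 0 \<omega> * a r 0 \<omega>)" for \<omega>
      by (simp add: ix_def mult.assoc)
    have two: "{1..2} = {1, 2::nat}" by auto
    have "\<bar>E4 i k l r - t i k * t l r\<bar> \<le> c 2 * (\<Sum>j=1..2. \<Sum>\<sigma>\<in>S_perm j 2. \<Prod>l=1..j. \<alpha> ^ nat \<bar>int (ix (\<sigma> (2*l - 1))) - int (ix (\<sigma> (2*l)))\<bar>)"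
    proof -
      have "(\<Prod>l=1..2. cov M (a (ix (2*l - 1)) 0) (a (ix (2*l)) 0)) = t i k * t l r"
        unfolding two by (simp add: ix_def t_def)
      then show ?thesis using A1[of 2 ix, OF _ mono] unfolding prod E4_def by simp
    qed
    also have "\<dots> \<le> c 2 * (\<Sum>j=1..2. \<Sum>\<sigma>\<in>S_perm j 2. \<alpha> ^ (l - k))"
    proof (intro mult_left_mono sum_mono c0)
      have ix: "l - k = ix 3 - ix 2" by (simp add: ix_def)
      fix j \<sigma> assume "j \<in> {1..2::nat}" "\<sigma> \<in> S_perm j 2"
      then show "(\<Prod>l=1..j. \<alpha> ^ nat \<bar>int (ix (\<sigma> (2*l - 1))) - int (ix (\<sigma> (2*l)))\<bar>) \<le> \<alpha> ^ (l - k)"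
        unfolding ix by (intro S_perm_2_prod_le \<alpha>(1) less_imp_le[OF \<alpha>(2)] mono4)
    qed simp
    also have "(\<Sum>j=1..2. \<Sum>\<sigma>\<in>S_perm j 2. \<alpha> ^ (l - k)) = N * \<alpha> ^ (l - k)"
      unfolding two by (simp add: N_def distrib_right)
    also have "c 2 * (N * \<alpha> ^ (l - k)) \<le> C * \<alpha> ^ (l - k)"
      unfolding mult.assoc[symmetric] using \<alpha> by (intro mult_right_mono C) auto
    finally have 1: "\<bar>E4 i k l r - t i k * t l r\<bar> \<le> C * \<alpha> ^ (l - k)" .
    have "\<bar>E4 i k l r\<bar> \<le> c 2 * (\<Prod>l=1..2. \<alpha> ^ nat \<bar>int (ix (2*l - 1)) - int (ix (2*l))\<bar>)"
      using A2[of 2 ix, OF _ mono] unfolding prod E4_def by simp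
    also have "(\<Prod>l=1..2. \<alpha> ^ nat \<bar>int (ix (2*l - 1)) - int (ix (2*l))\<bar>) = \<alpha> ^ ((k - i) + (r - l))"
    proof -
      have "ndist i k = k - i" "ndist l r = r - l" using that by (simp_all add: ndist_le)
      then show ?thesis unfolding two dist power_add by (simp add: ix_def)
    qed
    also have "c 2 * \<alpha> ^ ((k - i) + (r - l)) \<le> C * \<alpha> ^ ((k - i) + (r - l))"
      using \<alpha> by (intro mult_right_mono C) auto
    finally show ?thesis using 1 by blast
  qed
  define K where "K = c 1 + (C + (c 1)\<^sup>2)"
  have c1: "0 \<le> c 1" using c0 by simp
  have K: "c 1 \<le> K" "C + (c 1)\<^sup>2 \<le> K" "0 \<le> K" using c1 C by (simp_all add: K_def)
  have fourth: "\<bar>E4 i k l r - t i k * t l r\<bar> \<le> K * (g ^ ndist i l * g ^ ndist k r + g ^ ndist i r * g ^ ndist k l)" for i k l r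
  proof -
    have "\<bar>E4 i k l r - t i k * t l r\<bar> \<le> (C + (c 1)\<^sup>2) * (g ^ ndist i l * g ^ ndist k r + g ^ ndist i r * g ^ ndist k l)"
    proof (rule four_index_bound[OF g(1) _ g4 C(1) c1])
      show "E4 i k l r = E4 i l k r" "E4 i k l r = E4 i k r l" "E4 i k l r = E4 k i l r" for i k l r
        by (simp_all add: E4_def mult_ac)
      show "g \<le> 1" using g by simp
      show "\<bar>t i l\<bar> \<le> c 1 * \<alpha> ^ ndist i l" for i l using E2[of i l] by (rule conjunct2)
      show "t i l = t l i" for i l by (rule t_sym)
      show "\<bar>E4 i k l r\<bar> \<le> C * \<alpha> ^ ((k - i) + (r - l))" if "i \<le> k" "k \<le> l" "l \<le> r" for i k l r
        using E4[OF that] by (rule conjunct2)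
      show "\<bar>E4 i k l r - t i k * t l r\<bar> \<le> C * \<alpha> ^ (l - k)" if "i \<le> k" "k \<le> l" "l \<le> r" for i k l r
        using E4[OF that] by (rule conjunct1)
    qed
    also have "\<dots> \<le> K * (g ^ ndist i l * g ^ ndist k r + g ^ ndist i r * g ^ ndist k l)"
      using g by (intro mult_right_mono K) auto
    finally show ?thesis .
  qed
  \<comment> \<open>The given constants start at k = 1; for r = 0 the empty product has expectation
    1.\<close>
  define c' where "c' = (\<lambda>r. if r = 0 then 1 else c r)"
  have c': "0 \<le> c' r" for r using c0 by (simp add: c'_def)
  have even: "\<bar>expectation (\<lambda>\<omega>. \<Prod>p=1..2*r. a (ix p) 0 \<omega>)\<bar>
        \<le> c' r * (\<Sum>\<sigma> | \<sigma> permutes {1..2*r}. \<Prod>l=1..r. g ^ ndist (ix (\<sigma> (2 * l - 1))) (ix (\<sigma> (2 * l))))" for r ix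
  proof (cases "r = 0")
    case True
    then show ?thesis by (simp add: c'_def prob_space)
  next
    case False
    let ?F = "\<lambda>\<sigma>. \<Prod>l=1..r. g ^ ndist (ix (\<sigma> (2 * l - 1))) (ix (\<sigma> (2 * l)))"
    \<comment> \<open>The sorting permutation is one of the nonnegative summands on the right, so
      (A2) for the sorted tuple suffices.\<close>
    obtain \<sigma> where \<sigma>: "\<sigma> permutes {1..2*r}" "mono_on {1..2*r} (ix \<circ> \<sigma>)" by (rule sorting_permutation)
    have "(\<Prod>p=1..2*r. a (ix p) 0 \<omega>) = (\<Prod>p=1..2*r. a ((ix \<circ> \<sigma>) p) 0 \<omega>)" for \<omega>
      using prod.permute[OF \<sigma>(1), of "\<lambda>p. a (ix p) 0 \<omega>"] by (simp add: o_def)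
    then have "\<bar>expectation (\<lambda>\<omega>. \<Prod>p=1..2*r. a (ix p) 0 \<omega>)\<bar> = \<bar>expectation (\<lambda>\<omega>. \<Prod>p=1..2*r. a ((ix \<circ> \<sigma>) p) 0 \<omega>)\<bar>"
      by simp
    also have "\<dots> \<le> c r * (\<Prod>l=1..r. \<alpha> ^ ndist (ix (\<sigma> (2 * l - 1))) (ix (\<sigma> (2 * l))))"
      using A2[OF _ \<sigma>(2)] False unfolding dist by simp
    also have "\<dots> \<le> c r * ?F \<sigma>"
      using False \<alpha> by (intro mult_left_mono c0 prod_mono conjI \<alpha>_le_g) auto
    also have "\<dots> \<le> c r * (\<Sum>\<sigma> | \<sigma> permutes {1..2*r}. ?F \<sigma>)"
    proof (intro mult_left_mono c0)
      show "?F \<sigma> \<le> (\<Sum>\<sigma> | \<sigma> permutes {1..2*r}. ?F \<sigma>)"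
        by (rule member_le_sum[of \<sigma> _ ?F]) (use \<sigma>(1) g in \<open>auto intro!: prod_nonneg finite_permutations\<close>)
    qed (use False in simp)
    finally show ?thesis using False by (simp add: c'_def)
  qed
  have "covariance_decay M a t g K c'"
  proof (unfold_locales)
    show "\<bar>t i l\<bar> \<le> K * g ^ ndist i l" for i l
    proof -
      have "\<bar>t i l\<bar> \<le> c 1 * \<alpha> ^ ndist i l" using E2 by blast
      also have "\<dots> \<le> K * g ^ ndist i l" using K \<alpha> by (intro mult_mono \<alpha>_le_g) auto
      finally show ?thesis .
    qed
    show "expectation (\<lambda>\<omega>. a i j \<omega> * a l j \<omega>) = t i l" for i l j
    proof -
      have "(\<lambda>x. x i * x l) \<in> borel_measurable ?S" by (intro borel_measurable_times coord)
      from col_eq[OF this, of j] show ?thesis using E2[of i l] by (simp add: E2_def)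
    qed
    show "\<bar>expectation (\<lambda>\<omega>. a i j \<omega> * a k j \<omega> * (a l j \<omega> * a r j \<omega>)) - t i k * t l r\<bar>
        \<le> K * (g ^ ndist i l * g ^ ndist k r + g ^ ndist i r * g ^ ndist k l)" for i k l r j
    proof -
      have "(\<lambda>x. x i * x k * (x l * x r)) \<in> borel_measurable ?S" by (intro borel_measurable_times coord)
      from col_eq[OF this, of j] show ?thesis using fourth[of i k l r] by (simp add: E4_def)
    qed
    show "\<bar>expectation (\<lambda>\<omega>. \<Prod>p=1..2*r. a (ix p) j \<omega>)\<bar>
        \<le> c' r * (\<Sum>\<sigma> | \<sigma> permutes {1..2*r}. \<Prod>l=1..r. g ^ ndist (ix (\<sigma> (2 * l - 1))) (ix (\<sigma> (2 * l))))" for r ix j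
    proof -
      have "(\<lambda>x. \<Prod>p=1..2*r. x (ix p)) \<in> borel_measurable ?S" by (intro borel_measurable_prod coord)
      from col_eq[OF this, of j] show ?thesis using even[of ix r] by simp
    qed
    show "all_moments M (a i j)" for i j by (rule am)
    show "indep_vars (\<lambda>j. Pi\<^sub>M UNIV (\<lambda>i. borel)) (\<lambda>j \<omega>. \<lambda>i. a i j \<omega>) UNIV" by (rule indep)
    show "0 \<le> g" "g < 1" "0 \<le> K" by (rule g K(3))+
    show "0 \<le> c' r" for r by (rule c')
    show "t i l = t l i" for i l by (rule t_sym)
  qed
  then show ?thesis unfolding t_def by blast
qed

section \<open>Weak convergence of the expected spectral distribution\<close>

theorem mainTheorem1:
  fixes M :: "'w measure" and a :: "nat \<Rightarrow> nat \<Rightarrow> 'w \<Rightarrow> real"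
    and m :: "nat \<Rightarrow> nat" and y :: real and H :: "nat \<Rightarrow> real"
  assumes P: "prob_space M"
    and rv: "\<And>i j. a i j \<in> borel_measurable M"
    and moments: "\<And>i k. integrable M (\<lambda>\<omega>. a i 0 \<omega> ^ k)"
    and indep: "prob_space.indep_vars M (\<lambda>j. Pi\<^sub>M UNIV (\<lambda>i. borel))
                  (\<lambda>j \<omega>. \<lambda>i. a i j \<omega>) UNIV"
    and ident: "\<And>j. distr M (Pi\<^sub>M UNIV (\<lambda>i. borel)) (\<lambda>\<omega> i. a i j \<omega>)
                    = distr M (Pi\<^sub>M UNIV (\<lambda>i. borel)) (\<lambda>\<omega> i. a i 0 \<omega>)"
    and stat: "\<And>j h. distr M (Pi\<^sub>M UNIV (\<lambda>i. borel)) (\<lambda>\<omega> i. a (i + h) j \<omega>)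
                    = distr M (Pi\<^sub>M UNIV (\<lambda>i. borel)) (\<lambda>\<omega> i. a i j \<omega>)"
    and mn: "(\<lambda>n. real (m n) / real n) \<longlonglongrightarrow> y" and ypos: "y > 0"
    and H: "\<And>k. k \<ge> 1 \<Longrightarrow>
              (\<lambda>mm. mat_trace (mat mm mm (\<lambda>(i, i'). cov M (a i 0) (a i' 0)) ^\<^sub>m k) / real mm)
                \<longlonglongrightarrow> H k"
    and A: "\<exists>\<alpha>::real. 0 \<le> \<alpha> \<and> \<alpha> < 1 \<and>
              (\<forall>k\<ge>1. \<exists>c::real. c \<ge> 0 \<and>
                 (\<forall>ix :: nat \<Rightarrow> nat. mono_on {1..2*k} ix \<longrightarrow>
                    \<bar>(\<integral>\<omega>. (\<Prod>p=1..2*k. a (ix p) 0 \<omega>) \<partial>M)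
                      - (\<Prod>l=1..k. cov M (a (ix (2*l - 1)) 0) (a (ix (2*l)) 0))\<bar>
                    \<le> c * (\<Sum>j=1..k. \<Sum>\<sigma>\<in>S_perm j k.
                             \<Prod>l=1..j. \<alpha> ^ nat \<bar>int (ix (\<sigma> (2*l - 1))) - int (ix (\<sigma> (2*l)))\<bar>)
                  \<and> \<bar>(\<integral>\<omega>. (\<Prod>p=1..2*k. a (ix p) 0 \<omega>) \<partial>M)\<bar>
                    \<le> c * (\<Prod>l=1..k. \<alpha> ^ nat \<bar>int (ix (2*l - 1)) - int (ix (2*l))\<bar>)))"
  shows "\<exists>\<mu>. real_distribution \<mu> \<and>
           weak_conv_m (\<lambda>n. M \<bind> (\<lambda>\<omega>. esd (W_mat a (m n) n \<omega>))) \<mu> \<and>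
           (\<forall>k\<ge>1. integrable \<mu> (\<lambda>x. x ^ k) \<and> (\<integral>x. x ^ k \<partial>\<mu>) = moment_formula y H k)"
proof -
  interpret prob_space M by fact
  obtain \<alpha> where \<alpha>: "0 \<le> \<alpha>" "\<alpha> < 1" and Ak: "\<forall>k\<ge>1. \<exists>c. 0 \<le> c \<and> (\<forall>ix :: nat \<Rightarrow> nat. mono_on {1..2*k} ix \<longrightarrow>
        \<bar>(\<integral>\<omega>. (\<Prod>p=1..2*k. a (ix p) 0 \<omega>) \<partial>M) - (\<Prod>l=1..k. cov M (a (ix (2*l - 1)) 0) (a (ix (2*l)) 0))\<bar>
        \<le> c * (\<Sum>j=1..k. \<Sum>\<sigma>\<in>S_perm j k. \<Prod>l=1..j. \<alpha> ^ nat \<bar>int (ix (\<sigma> (2*l - 1))) - int (ix (\<sigma> (2*l)))\<bar>) \<and>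
        \<bar>(\<integral>\<omega>. (\<Prod>p=1..2*k. a (ix p) 0 \<omega>) \<partial>M)\<bar> \<le> c * (\<Prod>l=1..k. \<alpha> ^ nat \<bar>int (ix (2*l - 1)) - int (ix (2*l))\<bar>))"
    using A by blast
  define Q where "Q = (\<lambda>k c. 0 \<le> c \<and> (\<forall>ix :: nat \<Rightarrow> nat. mono_on {1..2*k} ix \<longrightarrow>
        \<bar>(\<integral>\<omega>. (\<Prod>p=1..2*k. a (ix p) 0 \<omega>) \<partial>M) - (\<Prod>l=1..k. cov M (a (ix (2*l - 1)) 0) (a (ix (2*l)) 0))\<bar>
        \<le> c * (\<Sum>j=1..k. \<Sum>\<sigma>\<in>S_perm j k. \<Prod>l=1..j. \<alpha> ^ nat \<bar>int (ix (\<sigma> (2*l - 1))) - int (ix (\<sigma> (2*l)))\<bar>) \<and>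
        \<bar>(\<integral>\<omega>. (\<Prod>p=1..2*k. a (ix p) 0 \<omega>) \<partial>M)\<bar> \<le> c * (\<Prod>l=1..k. \<alpha> ^ nat \<bar>int (ix (2*l - 1)) - int (ix (2*l))\<bar>)))"
  have ex: "\<exists>c. Q k c" if "k \<ge> 1" for k
    unfolding Q_def by (rule Ak[THEN spec, THEN mp, OF that])
  define c where "c = (\<lambda>k. SOME c. Q k c)"
  have c: "Q k (c k)" if "k \<ge> 1" for k
    unfolding c_def by (rule someI_ex[OF ex[OF that]])
  have c0: "0 \<le> c k" if "k \<ge> 1" for k using c[OF that] by (simp only: Q_def)
  note A1 = c[unfolded Q_def, THEN conjunct2, THEN spec, THEN mp, THEN conjunct1]
    and A2 = c[unfolded Q_def, THEN conjunct2, THEN spec, THEN mp, THEN conjunct2]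
  define t where "t = (\<lambda>i l. cov M (a i 0) (a l 0))"
  obtain g K c' where cd: "covariance_decay M a t g K c'"
  proof -
    have "\<exists>g K c. covariance_decay M a (\<lambda>i l. cov M (a i 0) (a l 0)) g K c"
      by (rule covariance_decay_of_moment_conditions[where \<alpha> = \<alpha> and c = c, OF P rv moments indep ident \<alpha>]) (fact c0 A1 A2)+
    then show ?thesis using that unfolding t_def by blast
  qed
  interpret covariance_decay M a t g K c' by (rule cd)
  \<comment> \<open>tr(T^p) / n is m / n times tr(T^p) / m; for p = 0 the limit is y itself,
    whatever value \<open>H\<close> has at 0.\<close>
  define w where "w = (\<lambda>p. y * (if p = 0 then 1 else H p))"
  have m_top: "filterlim m at_top sequentially"
  proof -
    have eq: "\<forall>\<^sub>F n in sequentially. real (m n) / real n * real n = real (m n)"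
      using eventually_gt_at_top[of 0] by eventually_elim simp
    have "filterlim (\<lambda>n. real (m n) / real n * real n) at_top sequentially"
      by (rule filterlim_tendsto_pos_mult_at_top[OF mn ypos filterlim_real_sequentially])
    then show ?thesis
      by (simp only: filterlim_sequentially_iff_filterlim_real filterlim_cong[OF refl refl eq])
  qed
  have trace_T: "op_trace mm (kernel_op mm t ^^ p) = mat_trace (mat mm mm (\<lambda>(i, i'). cov M (a i 0) (a i' 0)) ^\<^sub>m p)" for mm p
    by (rule op_trace_funpow_eq_mat_trace[OF _ linear_op_kernel_op]) (simp_all add: kernel_op_unit_fun t_def)
  have T0: "op_trace mm (kernel_op mm t ^^ 0) = real mm" for mm
    by (simp add: op_trace_def unit_fun_def)
  have T_avg: "(\<lambda>mm. op_trace mm (kernel_op mm t ^^ p) / real mm) \<longlonglongrightarrow> (if p = 0 then 1 else H p)" for p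
  proof (cases "p = 0")
    case True
    have "\<forall>\<^sub>F mm in sequentially. real mm / real mm = 1"
      using eventually_gt_at_top[of 0] by eventually_elim simp
    then have "(\<lambda>mm. op_trace mm (kernel_op mm t ^^ 0) / real mm) \<longlonglongrightarrow> 1"
      unfolding T0 by (rule tendsto_eventually)
    then show ?thesis unfolding True if_P[OF refl] .
  next
    case False
    then have "p \<ge> 1" by simp
    from H[OF this] show ?thesis using False unfolding trace_T by (simp only: if_False)
  qed
  have m_pos: "\<forall>\<^sub>F n in sequentially. m n > 0"
    using m_top[unfolded filterlim_at_top, THEN spec, of 1] by (rule eventually_mono) simp
  have T_lim: "(\<lambda>n. op_trace (m n) (kernel_op (m n) t ^^ p) / real n) \<longlonglongrightarrow> w p" for p
  proof -
    have lim: "(\<lambda>n. real (m n) / real n * (op_trace (m n) (kernel_op (m n) t ^^ p) / real (m n))) \<longlonglongrightarrow> w p"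
      unfolding w_def by (rule tendsto_mult[OF mn filterlim_compose[OF T_avg m_top]])
    have "\<forall>\<^sub>F n in sequentially. real (m n) / real n * (op_trace (m n) (kernel_op (m n) t ^^ p) / real (m n)) = op_trace (m n) (kernel_op (m n) t ^^ p) / real n"
      using m_pos by eventually_elim simp
    with lim show ?thesis by (rule Lim_transform_eventually)
  qed
  interpret sample_covariance M a t g K c' m w
    by unfold_locales (rule T_lim)
  \<comment> \<open>Division by y passes from the normalisation 1/n to 1/m; the zeroth moment is the
    total mass.\<close>
  define L where "L = (\<lambda>k. if k = 0 then 1 else loop_limit w k 0 / y)"
  \<comment> \<open>Coefficients of the series to be inverted: they agree with \<open>w\<close>
    except at 0, where the constant term 1 takes the place of y.\<close>
  define v where "v = (\<lambda>l. if l = 0 then 1 else y * H l)"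
  have lagrange: "real (Suc k) * (if k = 0 then 1 else loop_limit w k 0) = fps_nth (Abs_fps v ^ Suc k) k" for k
  proof (rule loop_recursion_lagrange[where \<tau> = "loop_limit w" and w = v and M = "\<lambda>j. if j = 0 then 1 else loop_limit w j 0"])
    show "v l = (if l = 0 then 1 else loop_limit w 0 l)" for l by (simp add: v_def w_def)
    show "loop_limit w (Suc k) p = (\<Sum>q\<le>k. loop_limit w q (Suc p) * (if k - q = 0 then 1 else loop_limit w (k - q) 0))" for k p
    proof -
      have "(if q = k then 1 else loop_limit w (k - q) 0) = (if k - q = 0 then 1 else loop_limit w (k - q) 0)" if "q \<in> {..k}" for q
      proof (cases "q = k")
        case False
        then have "k - q \<noteq> 0" using that by simp
        then show ?thesis using False by (simp only: if_False)
      qed simp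
      then show ?thesis unfolding loop_limit.simps(2) by (intro sum.cong refl) (simp only:)
    qed
  qed simp
  have L_formula: "L k = moment_formula y H k" if k: "k \<ge> 1" for k
  proof -
    have k0: "k \<noteq> 0" using k by simp
    have e: "fps_nth (Abs_fps v ^ Suc k) k = real (Suc k) * (y * moment_formula y H k)"
      by (rule moment_formula_lagrange[OF k ypos]) (simp add: v_def)
    have "real (Suc k) * loop_limit w k 0 = real (Suc k) * (y * moment_formula y H k)"
      using lagrange[of k] unfolding e if_not_P[OF k0] .
    then have "loop_limit w k 0 = y * moment_formula y H k"
      by (simp only: mult_cancel_left of_nat_eq_0_iff) simp
    then show ?thesis using k0 ypos by (simp add: L_def)
  qed
  have H_le: "\<bar>H p\<bar> \<le> (K * C_g) ^ p" if p: "p \<ge> 1" for p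
  proof (rule LIMSEQ_le_const2[OF tendsto_rabs])
    show "(\<lambda>mm. op_trace mm (kernel_op mm t ^^ p) / real mm) \<longlonglongrightarrow> H p" using T_avg[of p] p by simp
    have "\<bar>op_trace mm (kernel_op mm t ^^ p) / real mm\<bar> \<le> (K * C_g) ^ p" if "1 \<le> mm" for mm
    proof -
      have "\<bar>op_trace mm (kernel_op mm t ^^ p)\<bar> / real mm \<le> real mm * (K * C_g) ^ p / real mm"
        by (rule divide_right_mono[OF op_trace_kernel_op_funpow_le]) simp
      then show ?thesis using that by simp
    qed
    then show "\<exists>N. \<forall>mm\<ge>N. \<bar>op_trace mm (kernel_op mm t ^^ p) / real mm\<bar> \<le> (K * C_g) ^ p" by blast
  qed
  \<comment> \<open>The factor 1 + y absorbs the single y in \<open>v l\<close>, since y <= (1 +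
    y)^l for l >= 1.\<close>
  define D where "D = (1 + y) * (K * C_g)"
  have D: "0 \<le> D" using ypos K C_g(2) by (simp add: D_def)
  have v_le: "\<bar>v l\<bar> \<le> D ^ l" for l
  proof (cases "l = 0")
    case False
    have "y \<le> (1 + y) ^ 1" by simp
    also have "\<dots> \<le> (1 + y) ^ l" using False ypos by (intro power_increasing) auto
    finally have "y * \<bar>H l\<bar> \<le> (1 + y) ^ l * (K * C_g) ^ l"
      using False ypos by (intro mult_mono H_le) simp_all
    then show ?thesis using False ypos by (simp add: v_def D_def power_mult_distrib abs_mult)
  qed (simp add: v_def)
  \<comment> \<open>The coefficient bound for the power k + 1 gives (2D)^k 2^(k+1) = 2 (4D)^k; the
    added 1 in the constant covers k = 0.\<close>
  have L_le: "\<bar>L k\<bar> \<le> (1 + 2 / y) * (4 * D) ^ k" for k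
  proof (cases "k = 0")
    case True
    then show ?thesis using ypos by (simp add: L_def)
  next
    case False
    have pow: "(4 * D) ^ k = (2 * D) ^ k * 2 ^ k" by (subst power_mult_distrib[symmetric]) simp
    have "1 * \<bar>loop_limit w k 0\<bar> \<le> real (Suc k) * \<bar>loop_limit w k 0\<bar>"
      by (rule mult_right_mono) simp_all
    also have "\<dots> = \<bar>real (Suc k) * loop_limit w k 0\<bar>" by (simp add: abs_mult)
    also have "\<dots> = \<bar>fps_nth (Abs_fps v ^ Suc k) k\<bar>" using lagrange[of k] False by (simp only: if_False)
    also have "\<dots> \<le> (2 * D) ^ k * 2 ^ Suc k" by (rule fps_nth_power_bound[OF D v_le])
    also have "\<dots> = 2 * (4 * D) ^ k" unfolding pow by simp
    finally have le: "\<bar>loop_limit w k 0\<bar> \<le> 2 * (4 * D) ^ k" by simp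
    have "\<bar>L k\<bar> = \<bar>loop_limit w k 0\<bar> / y" using False ypos by (simp add: L_def)
    also have "\<dots> \<le> 2 * (4 * D) ^ k / y" using ypos by (intro divide_right_mono le) simp
    also have "\<dots> = 2 / y * (4 * D) ^ k" by simp
    also have "\<dots> \<le> (1 + 2 / y) * (4 * D) ^ k"
      using D by (intro mult_right_mono) simp_all
    finally show ?thesis .
  qed
  have trace_W: "mat_trace (W_mat a (m n) n \<omega> ^\<^sub>m k) = op_trace (m n) (\<lambda>f. (gram_op (m n) (1 / real n) (X \<omega>) {..<n} ^^ k) ((kernel_op (m n) t ^^ 0) f))" for n k \<omega>
    by (simp add: mat_trace_W_mat)
  have am_W: "all_moments M (\<lambda>\<omega>. mat_trace (W_mat a (m n) n \<omega> ^\<^sub>m k))" for n k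
    unfolding trace_W by (intro closed_ring_op_trace[OF am_ring] am)
  define \<mu> where "\<mu> = (\<lambda>n. M \<bind> (\<lambda>\<omega>. esd (W_mat a (m n) n \<omega>)))"
  \<comment> \<open>For m n = 0 there are no eigenvalues, and \<open>esd\<close> carries no
    information. A point mass stands in for these finitely many n, so that the method of moments
    applies to the whole sequence.\<close>
  define \<mu>' where "\<mu>' = (\<lambda>n. if m n > 0 then \<mu> n else return borel 0)"
  have esd: "real_distribution (\<mu> n)" "integrable (\<mu> n) (\<lambda>x. x ^ k)"
    "(\<integral>x. x ^ k \<partial>\<mu> n) = expectation (\<lambda>\<omega>. mat_trace (W_mat a (m n) n \<omega> ^\<^sub>m k)) / real (m n)" if "m n > 0" for n k
    unfolding \<mu>_def
    by (rule expected_esd[where A = "\<lambda>\<omega>. W_mat a (m n) n \<omega>" and n = "m n", OF P W_mat_carrier W_mat_sym that all_momentsD(2)[OF am_W]])+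
  have \<mu>'_dist: "real_distribution (\<mu>' n)" for n
  proof (cases "m n > 0")
    case True
    then show ?thesis using esd(1)[OF True] by (simp add: \<mu>'_def)
  next
    case False
    then show ?thesis
      by (simp add: \<mu>'_def real_distribution_def real_distribution_axioms_def prob_space_return)
  qed
  have \<mu>'_int: "integrable (\<mu>' n) (\<lambda>x. x ^ k)" for n k
  proof (cases "m n > 0")
    case True
    then show ?thesis using esd(2)[OF True] by (simp add: \<mu>'_def)
  next
    case False
    have "(\<lambda>x. x ^ k) \<in> borel_measurable (return borel (0::real))" by simp
    moreover have "(\<integral>\<^sup>+x. ennreal (norm (x ^ k)) \<partial>return borel (0::real)) < \<infinity>"
      by (subst nn_integral_return) simp_all
    ultimately show ?thesis using False by (simp add: \<mu>'_def integrable_iff_bounded)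
  qed
  have \<mu>'_lim: "(\<lambda>n. \<integral>x. x ^ k \<partial>\<mu>' n) \<longlonglongrightarrow> L k" for k
  proof (cases "k = 0")
    case True
    then show ?thesis
      using \<mu>'_dist by (simp add: L_def prob_space.prob_space real_distribution.axioms(1))
  next
    case False
    have tr: "tr n {..<n} k 0 = (\<lambda>\<omega>. mat_trace (W_mat a (m n) n \<omega> ^\<^sub>m k) / real n)" for n
      by (rule ext) (simp only: tr_def trace_W)
    have "L2_conv (\<lambda>n. tr n {..<n} k 0) (loop_limit w k 0)"
      by (rule L2_conv_tr[where J = "\<lambda>n. {..<n}" and d = 0]) simp_all
    from tendsto_divide[OF L2_conv_expectation[OF this] mn]
    have lim: "(\<lambda>n. expectation (tr n {..<n} k 0) / (real (m n) / real n)) \<longlonglongrightarrow> loop_limit w k 0 / y"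
      using ypos by simp
    have "\<forall>\<^sub>F n in sequentially. expectation (tr n {..<n} k 0) / (real (m n) / real n) = (\<integral>x. x ^ k \<partial>\<mu>' n)"
      using m_pos eventually_gt_at_top[of 0]
    proof eventually_elim
      case (elim n)
      have "(\<integral>x. x ^ k \<partial>\<mu>' n) = expectation (\<lambda>\<omega>. mat_trace (W_mat a (m n) n \<omega> ^\<^sub>m k)) / real (m n)"
        using elim esd(3)[OF elim(1), of k] by (simp add: \<mu>'_def)
      then show ?case using elim by (simp add: tr)
    qed
    with lim have "(\<lambda>n. \<integral>x. x ^ k \<partial>\<mu>' n) \<longlonglongrightarrow> loop_limit w k 0 / y"
      by (rule Lim_transform_eventually)
    then show ?thesis using False by (simp add: L_def)
  qed
  have D4: "0 \<le> 4 * D" using D by simp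
  from method_of_moments[OF \<mu>'_dist \<mu>'_int \<mu>'_lim L_le D4]
  obtain \<nu> where \<nu>: "real_distribution \<nu>" "weak_conv_m \<mu>' \<nu>"
    and \<nu>_mom: "\<forall>k. integrable \<nu> (\<lambda>x. x ^ k) \<and> (\<integral>x. x ^ k \<partial>\<nu>) = L k"
    by blast
  \<comment> \<open>The distribution functions of \<open>\<mu>\<close> and \<open>\<mu>'\<close>
    agree for all large n, so the replacement does not affect the limit.\<close>
  have "weak_conv_m \<mu> \<nu>"
    unfolding weak_conv_m_def weak_conv_def
  proof (intro allI impI)
    fix x assume "isCont (cdf \<nu>) x"
    then have lim: "(\<lambda>n. cdf (\<mu>' n) x) \<longlonglongrightarrow> cdf \<nu> x"
      using \<nu>(2) unfolding weak_conv_m_def weak_conv_def by blast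
    have "\<forall>\<^sub>F n in sequentially. cdf (\<mu>' n) x = cdf (\<mu> n) x"
      using m_pos by eventually_elim (simp add: \<mu>'_def)
    with lim show "(\<lambda>n. cdf (\<mu> n) x) \<longlonglongrightarrow> cdf \<nu> x" by (rule Lim_transform_eventually)
  qed
  then have "weak_conv_m (\<lambda>n. M \<bind> (\<lambda>\<omega>. esd (W_mat a (m n) n \<omega>))) \<nu>" unfolding \<mu>_def .
  moreover have "integrable \<nu> (\<lambda>x. x ^ k) \<and> (\<integral>x. x ^ k \<partial>\<nu>) = moment_formula y H k" if "k \<ge> 1" for k
    using \<nu>_mom L_formula[OF that] by simp
  ultimately show ?thesis using \<nu>(1) by blast
qed

end
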